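(* Suppose $\xi(s)=\beta^2s^2/2$ and that for some $q\in[0,1]$, $\lim_{N\to\infty}\mathbb{E}\langle(R_{1,2}-q)^2\rangle=0$. Then $$\lim_{N\to\infty}\mathbb{E}\Bigl(\frac1N\bigl\langle\log G_N(\sigma)\bigr\rangle-I_N(\langle\sigma\rangle)-C(q)\Bigr)^2=0.$$
   Context: This is the Sherrington–Kirkpatrick model: for $\beta,h\in\mathbb{R}$ and $\sigma\in\Sigma_N=\{-1,+1\}^N$, $$H_N(\sigma)=\frac{\beta}{\sqrt{2N}}\sum_{i,j=1}^Ng_{ij}\sigma_i\sigma_j+h\sum_{i=1}^N\sigma_i,$$ with $g_{ij}$ i.i.d. standard Gaussians ($\mathbb{E}$ is expectation over them); the Gaussian part has covariance $N\xi(\frac1N\sum_i\sigma^1_i\sigma^2_i)$ with $\xi(s)=\beta^2s^2/2$. $G_N(\sigma)=\exp H_N(\sigma)/\sum_{\sigma'\in\Sigma_N}\exp H_N(\sigma')$ is the Gibbs measure, $\langle\cdot\rangle$ is the average with respect to $G_N$ and its products (independent replicas $\sigma^1,\sigma^2,\dots$ from $G_N$), $\langle\sigma\rangle=(\langle\sigma_1\rangle,\dots,\langle\sigma_N\rangle)$, and $R_{1,2}=\frac1N\sum_{i=1}^N\sigma^1_i\sigma^2_i$. Thus $\langle\log G_N(\sigma)\rangle=\sum_{\sigma\in\Sigma_N}G_N(\sigma)\log G_N(\sigma)$. $I_N(m)=\frac1N\sum_{i=1}^NI(m_i)$ for $m\in[-1,1]^N$, with $I(x)=\frac{1+x}2\log\frac{1+x}2+\frac{1-x}2\log\frac{1-x}2$,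 and $C(u)=\frac12\bigl(\xi(1)-\xi(u)-\xi'(u)(1-u)\bigr)=\frac{\beta^2}4(1-u)^2$. *)

theory Defs
  imports "HOL-Probability.Probability"
begin

text \<open>Configurations are extensional functions on the sites \<open>{1..N}\<close>, so that sums over
  them run over a finite set with \<open>2 ^ N\<close> elements.\<close>

definition configs :: "nat \<Rightarrow> (nat \<Rightarrow> real) set" where
  "configs N = {1..N} \<rightarrow>\<^sub>E {- 1, 1}"

definition hamiltonian ::
    "real \<Rightarrow> real \<Rightarrow> nat \<Rightarrow> (nat \<times> nat \<Rightarrow> real) \<Rightarrow> (nat \<Rightarrow> real) \<Rightarrow> real" where
  "hamiltonian \<beta> h N g \<sigma> =
     \<beta> / sqrt (2 * real N) * (\<Sum>i=1..N. \<Sum>j=1..N. g (i, j) * \<sigma> i * \<sigma> j)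
     + h * (\<Sum>i=1..N. \<sigma> i)"

definition gibbs ::
    "real \<Rightarrow> real \<Rightarrow> nat \<Rightarrow> (nat \<times> nat \<Rightarrow> real) \<Rightarrow> (nat \<Rightarrow> real) \<Rightarrow> real" where
  "gibbs \<beta> h N g \<sigma> =
     exp (hamiltonian \<beta> h N g \<sigma>) / (\<Sum>\<tau>\<in>configs N. exp (hamiltonian \<beta> h N g \<tau>))"

definition gibbs_avg ::
    "real \<Rightarrow> real \<Rightarrow> nat \<Rightarrow> (nat \<times> nat \<Rightarrow> real) \<Rightarrow> ((nat \<Rightarrow> real) \<Rightarrow> real) \<Rightarrow> real" where
  "gibbs_avg \<beta> h N g f = (\<Sum>\<sigma>\<in>configs N. gibbs \<beta> h N g \<sigma> * f \<sigma>)"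

text \<open>The average over two independent replicas drawn with the same disorder \<open>g\<close>.\<close>

definition gibbs_avg2 ::
    "real \<Rightarrow> real \<Rightarrow> nat \<Rightarrow> (nat \<times> nat \<Rightarrow> real)
      \<Rightarrow> ((nat \<Rightarrow> real) \<Rightarrow> (nat \<Rightarrow> real) \<Rightarrow> real) \<Rightarrow> real" where
  "gibbs_avg2 \<beta> h N g f =
     (\<Sum>(\<sigma>, \<tau>)\<in>configs N \<times> configs N. gibbs \<beta> h N g \<sigma> * gibbs \<beta> h N g \<tau> * f \<sigma> \<tau>)"

definition magnetization ::
    "real \<Rightarrow> real \<Rightarrow> nat \<Rightarrow> (nat \<times> nat \<Rightarrow> real) \<Rightarrow> nat \<Rightarrow> real" where
  "magnetization \<beta> h N g i = gibbs_avg \<beta> h N g (\<lambda>\<sigma>. \<sigma> i)"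

definition overlap :: "nat \<Rightarrow> (nat \<Rightarrow> real) \<Rightarrow> (nat \<Rightarrow> real) \<Rightarrow> real" where
  "overlap N \<sigma> \<tau> = 1 / real N * (\<Sum>i=1..N. \<sigma> i * \<tau> i)"

text \<open>At \<open>x = 1\<close> and \<open>x = - 1\<close> the convention \<open>0 log 0 = 0\<close> holds automatically.\<close>

definition coin_neg_entropy :: "real \<Rightarrow> real" where
  "coin_neg_entropy x = (1 + x) / 2 * ln ((1 + x) / 2) + (1 - x) / 2 * ln ((1 - x) / 2)"

definition mean_coin_neg_entropy :: "nat \<Rightarrow> (nat \<Rightarrow> real) \<Rightarrow> real" where
  "mean_coin_neg_entropy N m = 1 / real N * (\<Sum>i=1..N. coin_neg_entropy (m i))"

definition xi :: "real \<Rightarrow> real \<Rightarrow> real" where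
  "xi \<beta> s = \<beta>\<^sup>2 * s\<^sup>2 / 2"

definition onsager :: "(real \<Rightarrow> real) \<Rightarrow> real \<Rightarrow> real" where
  "onsager \<xi> u = 1 / 2 * (\<xi> 1 - \<xi> u - deriv \<xi> u * (1 - u))"

lemma onsager_xi: "onsager (xi \<beta>) u = \<beta>\<^sup>2 / 4 * (1 - u)\<^sup>2"
proof -
  have "(xi \<beta> has_field_derivative \<beta>\<^sup>2 * u) (at u)"
    unfolding xi_def [abs_def] by (auto intro!: derivative_eq_intros)
  then have "deriv (xi \<beta>) u = \<beta>\<^sup>2 * u"
    by (rule DERIV_imp_deriv)
  then show ?thesis
    by (simp add: onsager_def xi_def field_simps power2_eq_square)
qed

end

theory Submission
  imports Defs
begin

text \<open>
  Write \<open>W\<close> for the Gaussian part of the mean energy per site, \<open>m\<^sub>i\<close> for the magnetizations, \<open>Z\<close> for the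
  partition function and \<open>I\<close> for the entropy function of a coin. The logarithm of a Gibbs weight is the
  energy minus \<open>ln Z\<close>, so the quantity in question is the sum of \<open>W\<close> and of the average over sites of
  \<open>h * m\<^sub>i - I (m\<^sub>i)\<close>, minus \<open>ln Z / N\<close>. Each of these three terms converges in mean square to a constant,
  and the three constants combine to \<open>\<beta>\<^sup>2 / 4 * (1 - q)\<^sup>2\<close>.

  The energy is treated by Gaussian integration by parts, which expresses the first two moments of \<open>W\<close>
  through overlaps of replicas (\<open>site_energy_moments\<close>, \<open>site_energy_concentration\<close>). The two other terms
  are treated by the cavity method. Remove a site \<open>i\<close>, without changing the coupling constant. The
  bonds at \<open>i\<close> are independent of the remaining system, and the field that they create on \<open>i\<close> is, given
  that system, a Gaussian field with covariance \<open>\<beta>\<^sup>2\<close> times the overlap. The overlap of the smaller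
  system is still concentrated at \<open>q\<close>: its Gibbs averages are compared with those of the larger one
  through the weights \<open>2 * cosh\<close> of the removed spin, which are at least \<open>2\<close> and have bounded moments
  (\<open>overlap_transfer\<close>, \<open>weighted_overlap_dev_le\<close>). Therefore the Gibbs averages of \<open>exp (\<plusminus> field)\<close> are close
  to \<open>exp (\<plusminus> z + \<beta>\<^sup>2 * (1 - q) / 2)\<close>, where \<open>z\<close> is the mean field (\<open>log_error_second_moment\<close>), and \<open>z\<close> is
  conditionally Gaussian with variance close to \<open>\<beta>\<^sup>2 * q\<close> (\<open>mean_field_law\<close>).

  Consequently \<open>m\<^sub>i\<close> is close to \<open>tanh (h + z)\<close>. Its conditional law hardly depends on the smaller
  system, and the other magnetizations hardly change when \<open>i\<close> is removed, so averages over sites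
  of continuous functions of the \<open>m\<^sub>i\<close> concentrate (\<open>mag_avg_concentration\<close>).
  For the free energy, \<open>ln Z\<close> is built up site by site. A new site contributes
  \<open>\<beta>\<^sup>2 * (1 - q) / 2 + ln (2 * cosh (h + z))\<close> up to a small error, and the change of the normalization
  \<open>sqrt (2 * N)\<close> of the coupling contributes \<open>- W / 2\<close>, because \<open>ln Z\<close> is convex in the coupling
  (\<open>renormalization_bracket\<close>). The increments are nearly uncorrelated with the past, so \<open>ln Z / N\<close>
  converges in mean square (\<open>add_site\<close>, \<open>ln_Z_L2\<close>).

  In the sum of the three limits the integrals of \<open>ln (2 * cosh)\<close> cancel, because
  \<open>I (tanh x) = x * tanh x - ln (2 * cosh x)\<close>; Stein's identity and \<open>q = E (tanh\<^sup>2)\<close> give the rest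
  (\<open>limit_identity\<close>).
\<close>

section \<open>Gaussian arrays\<close>

text \<open>The index set is the whole type, so that arrays are total functions and redrawing some
  coordinates (\<open>override_on\<close>) stays in the same space.\<close>

abbreviation gauss_array :: "('k \<Rightarrow> real) measure" where
  "gauss_array \<equiv> PiM UNIV (\<lambda>_. std_normal_distribution)"

lemma prob_space_std_normal: "prob_space std_normal_distribution"
  by (rule prob_space_normal_density) simp

lemma prob_space_gauss_array: "prob_space gauss_array"
  by (intro prob_space_PiM prob_space_std_normal)

interpretation gauss: prob_space "gauss_array :: ('k \<Rightarrow> real) measure"
  by (rule prob_space_gauss_array)

interpretation std_normal: prob_space std_normal_distribution
  by (rule prob_space_std_normal)

interpretation gaussP: product_prob_space "\<lambda>_::'k. std_normal_distribution" UNIV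
  by (rule product_prob_spaceI, rule prob_space_std_normal)

lemma space_gauss_array [simp]: "space gauss_array = UNIV"
  by (simp add: space_PiM)

lemma measurable_coordinate [measurable]: "(\<lambda>x. x k) \<in> borel_measurable gauss_array"
  using measurable_component_singleton[of k UNIV "\<lambda>_. std_normal_distribution"] by simp

lemma measurable_into_gauss_array:
  assumes "\<And>k. (\<lambda>x. f x k) \<in> borel_measurable M"
  shows "f \<in> measurable M gauss_array"
  by (rule measurable_PiM_single') (use assms in \<open>auto simp: space_PiM\<close>)

text \<open>Stated for complex factors as well, because it serves for the moment generating function and for
  the characteristic function of a linear form.\<close>

lemma expectation_prod_coordinates:
  fixes f :: "'k \<Rightarrow> real \<Rightarrow> 'b::{real_normed_field,banach,second_countable_topology}"
  assumes "finite I" and int: "\<And>k. k \<in> I \<Longrightarrow> integrable std_normal_distribution (f k)"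
  shows "integrable gauss_array (\<lambda>x. \<Prod>k\<in>I. f k (x k))"
    and "(\<integral>x. (\<Prod>k\<in>I. f k (x k)) \<partial>gauss_array) = (\<Prod>k\<in>I. integral\<^sup>L std_normal_distribution (f k))"
proof -
  let ?P = "PiM I (\<lambda>_. std_normal_distribution)"
  have D: "distr gauss_array ?P (\<lambda>x. restrict x I) = ?P"
    by (rule gaussP.distr_PiM_restrict_finite) (use \<open>finite I\<close> in auto)
  have i: "integrable ?P (\<lambda>x. \<Prod>k\<in>I. f k (x k))"
    using assms by (rule gaussP.product_integrable_prod)
  have m: "(\<lambda>x. restrict x I) \<in> measurable gauss_array ?P"
    by (rule measurable_restrict_subset) simp
  have "integrable gauss_array (\<lambda>x. (\<lambda>x. \<Prod>k\<in>I. f k (x k)) (restrict x I))"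
    using i by (subst integrable_distr_eq[symmetric, OF m]) (auto simp: D)
  then show "integrable gauss_array (\<lambda>x. \<Prod>k\<in>I. f k (x k))"
    by (rule Bochner_Integration.integrable_cong[THEN iffD1, rotated 2]) auto
  have "(\<integral>x. (\<Prod>k\<in>I. f k (x k)) \<partial>gauss_array)
      = (\<integral>x. (\<lambda>x. \<Prod>k\<in>I. f k (x k)) (restrict x I) \<partial>gauss_array)"
    by (intro Bochner_Integration.integral_cong) auto
  also have "\<dots> = (\<integral>x. (\<Prod>k\<in>I. f k (x k)) \<partial>?P)"
    using i by (subst integral_distr[symmetric, OF m]) (auto simp: D)
  also have "\<dots> = (\<Prod>k\<in>I. integral\<^sup>L std_normal_distribution (f k))"
    using assms by (rule gaussP.product_integral_prod)
  finally show "(\<integral>x. (\<Prod>k\<in>I. f k (x k)) \<partial>gauss_array) = (\<Prod>k\<in>I. integral\<^sup>L std_normal_distribution (f k))" .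
qed

lemma std_normal_exp:
  shows integrable_std_normal_exp: "integrable std_normal_distribution (\<lambda>t. exp (c * t))"
    and std_normal_mgf: "(\<integral>t. exp (c * t) \<partial>std_normal_distribution) = exp (c\<^sup>2 / 2)"
proof -
  have e: "std_normal_density t * exp (c * t) = exp (c\<^sup>2 / 2) * normal_density c 1 t" for t :: real
  proof -
    have "- t\<^sup>2 / 2 + c * t = c\<^sup>2 / 2 + (- (t - c)\<^sup>2 / 2)"
      by (simp add: power2_eq_square field_simps)
    then have "exp (- t\<^sup>2 / 2) * exp (c * t) = exp (c\<^sup>2 / 2) * exp (- (t - c)\<^sup>2 / 2)"
      by (simp only: exp_add[symmetric])
    then show ?thesis
      by (simp add: normal_density_def)
  qed
  show "integrable std_normal_distribution (\<lambda>t. exp (c * t))"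
    by (subst integrable_density) (auto simp: e)
  show "(\<integral>t. exp (c * t) \<partial>std_normal_distribution) = exp (c\<^sup>2 / 2)"
    by (subst integral_density) (auto simp: e)
qed

lemma integrable_std_normal_exp_abs: "integrable std_normal_distribution (\<lambda>t. exp (c * \<bar>t\<bar>))"
proof (rule Bochner_Integration.integrable_bound)
  show "integrable std_normal_distribution (\<lambda>t. exp (c * t) + exp (- c * t))"
    by (intro Bochner_Integration.integrable_add integrable_std_normal_exp)
  have "exp (c * \<bar>t\<bar>) \<le> exp (c * t) + exp (- c * t)" for t
    by (cases "t \<ge> 0") (auto simp: abs_if)
  then show "AE t in std_normal_distribution. norm (exp (c * \<bar>t\<bar>)) \<le> norm (exp (c * t) + exp (- c * t))"
    by (intro AE_I2) (metis abs_exp_cancel abs_ge_self order_trans real_norm_def)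
qed auto

lemma gauss_array_mgf:
  assumes "finite I"
  shows "(\<integral>x. exp (\<Sum>k\<in>I. a k * x k) \<partial>gauss_array) = exp ((\<Sum>k\<in>I. (a k)\<^sup>2) / 2)"
  using expectation_prod_coordinates(2)[OF assms integrable_std_normal_exp, of a] assms
  by (simp add: exp_sum std_normal_mgf sum_divide_distrib)

text \<open>Rotational invariance of the Gaussian law: a linear form sees only the length of its
  coefficient vector. This also covers the degenerate vector \<open>0\<close>.\<close>

lemma gauss_array_linear_form:
  fixes f :: "real \<Rightarrow> real"
  assumes I: "finite I" and [measurable]: "f \<in> borel_measurable borel"
  shows "(\<integral>x. f (\<Sum>k\<in>I. a k * x k) \<partial>gauss_array)
       = (\<integral>t. f (sqrt (\<Sum>k\<in>I. (a k)\<^sup>2) * t) \<partial>std_normal_distribution)"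
proof -
  let ?s = "sqrt (\<Sum>k\<in>I. (a k)\<^sup>2)"
  let ?X = "\<lambda>x. \<Sum>k\<in>I. a k * x k" and ?Y = "\<lambda>t. ?s * t"
  let ?M1 = "distr gauss_array borel ?X" and ?M2 = "distr std_normal_distribution borel ?Y"
  have [measurable]: "?X \<in> borel_measurable gauss_array" by measurable
  have ch: "(\<integral>t. iexp (u * t) \<partial>std_normal_distribution) = complex_of_real (exp (- (u\<^sup>2) / 2))" for u
    using fun_cong[OF char_std_normal_distribution, of u] by (simp add: char_def)
  have int: "integrable std_normal_distribution (\<lambda>t. iexp (u * t))" for u
    by (rule std_normal.integrable_const_bound[where B=1]) auto
  have "char ?M1 = char ?M2"
  proof
    fix u
    have "char ?M1 u = (\<integral>x. iexp (u * ?X x) \<partial>gauss_array)"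
      by (simp add: char_def integral_distr)
    also have "\<dots> = (\<integral>x. (\<Prod>k\<in>I. iexp ((u * a k) * x k)) \<partial>gauss_array)"
      using I by (simp add: exp_sum[symmetric] sum_distrib_left mult_ac)
    also have "\<dots> = (\<Prod>k\<in>I. complex_of_real (exp (- ((u * a k)\<^sup>2) / 2)))"
      by (subst expectation_prod_coordinates(2)[OF I int]) (simp only: ch)
    also have "\<dots> = complex_of_real (\<Prod>k\<in>I. exp (- ((u * a k)\<^sup>2) / 2))"
      by simp
    also have "\<dots> = complex_of_real (exp (- ((u * ?s)\<^sup>2) / 2))"
      using I by (simp add: exp_sum[symmetric] sum_distrib_left sum_divide_distrib[symmetric]
          sum_negf power_mult_distrib sum_nonneg)
    also have "\<dots> = (\<integral>t. iexp ((u * ?s) * t) \<partial>std_normal_distribution)"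
      by (rule ch[symmetric])
    also have "\<dots> = char ?M2 u"
      by (simp add: char_def integral_distr mult_ac)
    finally show "char ?M1 u = char ?M2 u" .
  qed
  moreover have "real_distribution ?M1"
    by (rule gauss.real_distribution_distr) simp
  moreover have "real_distribution ?M2"
    by (rule std_normal.real_distribution_distr) simp
  ultimately have "?M1 = ?M2"
    using Levy_uniqueness by blast
  then have "(\<integral>t. f t \<partial>?M1) = (\<integral>t. f t \<partial>?M2)" by simp
  then show ?thesis
    by (simp add: integral_distr)
qed

text \<open>A class of functions of finitely many coordinates that is closed under the operations used below
  and whose members are integrable. Energies, their exponentials and logarithms of partition functions
  all grow at most exponentially, so a single bound covers every integrability condition.\<close>

definition tame :: "(('k \<Rightarrow> real) \<Rightarrow> real) \<Rightarrow> bool" where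
  "tame F \<longleftrightarrow> F \<in> borel_measurable gauss_array \<and>
     (\<exists>I C c. finite I \<and> C \<ge> 0 \<and> c \<ge> 0 \<and> (\<forall>x. \<bar>F x\<bar> \<le> C * exp (c * (\<Sum>k\<in>I. \<bar>x k\<bar>))))"

lemma tame_measurable: "tame F \<Longrightarrow> F \<in> borel_measurable gauss_array"
  by (simp add: tame_def)

lemma tame_integrable:
  assumes "tame F" shows "integrable gauss_array F"
proof -
  from assms obtain I C c where I: "finite I" "C \<ge> 0"
    and b: "\<And>x. \<bar>F x\<bar> \<le> C * exp (c * (\<Sum>k\<in>I. \<bar>x k\<bar>))" and m: "F \<in> borel_measurable gauss_array"
    unfolding tame_def by blast
  have e: "exp (c * (\<Sum>k\<in>I. \<bar>x k\<bar>)) = (\<Prod>k\<in>I. exp (c * \<bar>x k\<bar>))" for x :: "'a \<Rightarrow> real"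
    using I by (simp add: exp_sum sum_distrib_left)
  have "integrable gauss_array (\<lambda>x. C * (\<Prod>k\<in>I. exp (c * \<bar>x k\<bar>)))"
    by (intro integrable_mult_right expectation_prod_coordinates(1) I integrable_std_normal_exp_abs)
  then show ?thesis
    by (rule Bochner_Integration.integrable_bound)
       (use b m I in \<open>auto simp: e[symmetric] abs_mult\<close>)
qed

lemma tame_bounded_by:
  assumes "F \<in> borel_measurable gauss_array" "tame G" "\<And>x. \<bar>F x\<bar> \<le> \<bar>G x\<bar>"
  shows "tame F"
proof -
  from assms(2) obtain I C c where "finite I" "C \<ge> 0" "c \<ge> 0"
    "\<And>x. \<bar>G x\<bar> \<le> C * exp (c * (\<Sum>k\<in>I. \<bar>x k\<bar>))"
    unfolding tame_def by blast
  then show ?thesis using assms(1,3) unfolding tame_def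
    by (intro conjI exI[of _ I] exI[of _ C] exI[of _ c]) (auto intro: order_trans)
qed

lemma tame_const [intro, simp]: "tame (\<lambda>_. a)"
  unfolding tame_def by (intro conjI exI[of _ "{}"] exI[of _ "\<bar>a\<bar>"] exI[of _ 0]) auto

lemma tame_coordinate [intro, simp]: "tame (\<lambda>x. x k)"
proof -
  have "\<bar>t\<bar> \<le> exp \<bar>t\<bar>" for t :: real
    using exp_ge_add_one_self[of "\<bar>t\<bar>"] by linarith
  then show ?thesis
    unfolding tame_def by (intro conjI exI[of _ "{k}"] exI[of _ 1] exI[of _ 1]) auto
qed

lemma tame_joint_bound:
  assumes "tame F" "tame G"
  obtains I C c where "finite I" "C \<ge> 0" "c \<ge> 0"
    "\<And>x. \<bar>F x\<bar> \<le> C * exp (c * (\<Sum>k\<in>I. \<bar>x k\<bar>))" "\<And>x. \<bar>G x\<bar> \<le> C * exp (c * (\<Sum>k\<in>I. \<bar>x k\<bar>))"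
proof -
  from assms(1) obtain I C c where 1: "finite I" "C \<ge> 0" "c \<ge> 0"
    "\<And>x. \<bar>F x\<bar> \<le> C * exp (c * (\<Sum>k\<in>I. \<bar>x k\<bar>))" unfolding tame_def by blast
  from assms(2) obtain I' C' c' where 2: "finite I'" "C' \<ge> 0" "c' \<ge> 0"
    "\<And>x. \<bar>G x\<bar> \<le> C' * exp (c' * (\<Sum>k\<in>I'. \<bar>x k\<bar>))" unfolding tame_def by blast
  have "\<bar>F x\<bar> \<le> max C C' * exp (max c c' * (\<Sum>k\<in>I \<union> I'. \<bar>x k\<bar>))" for x
    by (rule order_trans[OF 1(4)]) (use 1 2 in \<open>intro mult_mono; auto intro!: mult_mono sum_mono2 sum_nonneg\<close>)
  moreover have "\<bar>G x\<bar> \<le> max C C' * exp (max c c' * (\<Sum>k\<in>I \<union> I'. \<bar>x k\<bar>))" for x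
    by (rule order_trans[OF 2(4)]) (use 1 2 in \<open>intro mult_mono; auto intro!: mult_mono sum_mono2 sum_nonneg\<close>)
  ultimately show ?thesis
    using 1 2 by (intro that[of "I \<union> I'" "max C C'" "max c c'"]) auto
qed

lemma tame_add [intro]:
  assumes "tame F" "tame G" shows "tame (\<lambda>x. F x + G x)"
proof -
  obtain I C c where *: "finite I" "C \<ge> 0" "c \<ge> 0"
    "\<And>x. \<bar>F x\<bar> \<le> C * exp (c * (\<Sum>k\<in>I. \<bar>x k\<bar>))" "\<And>x. \<bar>G x\<bar> \<le> C * exp (c * (\<Sum>k\<in>I. \<bar>x k\<bar>))"
    by (rule tame_joint_bound[OF assms]) blast
  have "\<bar>F x + G x\<bar> \<le> 2 * C * exp (c * (\<Sum>k\<in>I. \<bar>x k\<bar>))" for x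
    using *(4,5)[of x] by linarith
  then show ?thesis
    using * assms[THEN tame_measurable] unfolding tame_def
    by (intro conjI exI[of _ I] exI[of _ "2 * C"] exI[of _ c]) auto
qed

lemma tame_mult [intro]:
  assumes "tame F" "tame G" shows "tame (\<lambda>x. F x * G x)"
proof -
  obtain I C c where *: "finite I" "C \<ge> 0" "c \<ge> 0"
    "\<And>x. \<bar>F x\<bar> \<le> C * exp (c * (\<Sum>k\<in>I. \<bar>x k\<bar>))" "\<And>x. \<bar>G x\<bar> \<le> C * exp (c * (\<Sum>k\<in>I. \<bar>x k\<bar>))"
    by (rule tame_joint_bound[OF assms]) blast
  have "\<bar>F x * G x\<bar> \<le> (C * C) * exp ((2 * c) * (\<Sum>k\<in>I. \<bar>x k\<bar>))" for x
  proof -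
    have "\<bar>F x\<bar> * \<bar>G x\<bar> \<le> (C * exp (c * (\<Sum>k\<in>I. \<bar>x k\<bar>))) * (C * exp (c * (\<Sum>k\<in>I. \<bar>x k\<bar>)))"
      using *(2,4,5) by (intro mult_mono) auto
    also have "\<dots> = (C * C) * (exp (c * (\<Sum>k\<in>I. \<bar>x k\<bar>)) * exp (c * (\<Sum>k\<in>I. \<bar>x k\<bar>)))"
      by (simp only: mult_ac)
    also have "\<dots> = (C * C) * exp ((2 * c) * (\<Sum>k\<in>I. \<bar>x k\<bar>))"
      by (simp add: exp_add[symmetric])
    finally show ?thesis by (simp add: abs_mult)
  qed
  then show ?thesis
    using * assms[THEN tame_measurable] unfolding tame_def
    by (intro conjI exI[of _ I] exI[of _ "C * C"] exI[of _ "2 * c"]) auto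
qed

lemma tame_uminus [intro]: "tame F \<Longrightarrow> tame (\<lambda>x. - F x)"
  using tame_mult[OF tame_const[of "-1"], of F] by simp

lemma tame_diff [intro]: "tame F \<Longrightarrow> tame G \<Longrightarrow> tame (\<lambda>x. F x - G x)"
  using tame_add[OF _ tame_uminus, of F G] by simp

lemma tame_divide_const [intro]: "tame F \<Longrightarrow> tame (\<lambda>x. F x / a)"
  using tame_mult[OF _ tame_const[of "inverse a"], of F] by (simp add: field_simps)

lemma tame_power [intro]: "tame F \<Longrightarrow> tame (\<lambda>x. F x ^ n)"
  by (induction n) auto

lemma tame_abs [intro]: "tame F \<Longrightarrow> tame (\<lambda>x. \<bar>F x\<bar>)"
  by (rule tame_bounded_by[of _ F]) (auto dest: tame_measurable)

lemma tame_sum [intro]: "(\<And>i. i \<in> A \<Longrightarrow> tame (F i)) \<Longrightarrow> tame (\<lambda>x. \<Sum>i\<in>A. F i x)"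
  by (induction A rule: infinite_finite_induct) auto

lemma tame_exp_linear:
  assumes "finite I" shows "tame (\<lambda>x. exp (b + (\<Sum>k\<in>I. a k * x k)))"
proof -
  have "\<bar>exp (b + (\<Sum>k\<in>I. a k * x k))\<bar> \<le> exp b * exp ((\<Sum>k\<in>I. \<bar>a k\<bar>) * (\<Sum>k\<in>I. \<bar>x k\<bar>))" for x
  proof -
    have "(\<Sum>k\<in>I. a k * x k) \<le> (\<Sum>k\<in>I. \<bar>a k\<bar> * \<bar>x k\<bar>)"
      by (intro sum_mono) (metis abs_ge_self abs_mult)
    also have "\<dots> \<le> (\<Sum>k\<in>I. (\<Sum>k\<in>I. \<bar>a k\<bar>) * \<bar>x k\<bar>)"
      using assms by (intro sum_mono mult_right_mono member_le_sum) auto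
    finally show ?thesis
      by (simp add: exp_add[symmetric] sum_distrib_left)
  qed
  then show ?thesis
    unfolding tame_def using assms
    by (intro conjI exI[of _ I] exI[of _ "exp b"] exI[of _ "\<Sum>k\<in>I. \<bar>a k\<bar>"]) (auto intro: sum_nonneg)
qed

text \<open>Redrawing the coordinates in \<open>J\<close> from an independent copy does not change the law. Every
  conditioning argument below uses this form of Fubini's theorem.\<close>

lemma distr_resample:
  "distr (gauss_array \<Otimes>\<^sub>M gauss_array) gauss_array (\<lambda>(x, y). override_on x y J)
     = (gauss_array :: ('k \<Rightarrow> real) measure)"
proof (rule gaussP.PiM_eq)
  show "sets (distr (gauss_array \<Otimes>\<^sub>M gauss_array) gauss_array (\<lambda>(x, y). override_on x y J))
      = sets gauss_array" by simp
next
  fix F :: "'k set" and A :: "'k \<Rightarrow> real set"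
  assume F: "finite F" "F \<subseteq> UNIV" and A: "\<And>i. i \<in> F \<Longrightarrow> A i \<in> sets std_normal_distribution"
  let ?G = "gauss_array :: ('k \<Rightarrow> real) measure"
  have m: "(\<lambda>(x, y). override_on x y J) \<in> measurable (?G \<Otimes>\<^sub>M ?G) ?G"
    by (rule measurable_into_gauss_array) (auto simp: override_on_def split_beta)
  have S: "prod_emb UNIV (\<lambda>_. std_normal_distribution) F (Pi\<^sub>E F A) \<in> sets ?G"
    using F A by (intro sets_PiM_I) auto
  have eq: "(\<lambda>(x, y). override_on x y J) -` prod_emb UNIV (\<lambda>_. std_normal_distribution) F (Pi\<^sub>E F A)
        \<inter> space (?G \<Otimes>\<^sub>M ?G)
      = prod_emb UNIV (\<lambda>_. std_normal_distribution) (F - J) (Pi\<^sub>E (F - J) A)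
        \<times> prod_emb UNIV (\<lambda>_. std_normal_distribution) (F \<inter> J) (Pi\<^sub>E (F \<inter> J) A)"
    by (auto simp: prod_emb_def space_pair_measure space_PiM override_on_def PiE_iff Pi_iff
        split: if_splits)
  have "emeasure (distr (?G \<Otimes>\<^sub>M ?G) ?G (\<lambda>(x, y). override_on x y J))
          (prod_emb UNIV (\<lambda>_. std_normal_distribution) F (Pi\<^sub>E F A))
      = emeasure ?G (prod_emb UNIV (\<lambda>_. std_normal_distribution) (F - J) (Pi\<^sub>E (F - J) A))
        * emeasure ?G (prod_emb UNIV (\<lambda>_. std_normal_distribution) (F \<inter> J) (Pi\<^sub>E (F \<inter> J) A))"
    unfolding emeasure_distr[OF m S] eq
    using F A by (intro gauss.emeasure_pair_measure_Times sets_PiM_I) auto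
  also have "\<dots> = (\<Prod>i\<in>F - J. emeasure std_normal_distribution (A i))
        * (\<Prod>i\<in>F \<inter> J. emeasure std_normal_distribution (A i))"
    using F A by (subst (1 2) gaussP.emeasure_PiM_emb) auto
  also have "\<dots> = (\<Prod>i\<in>F. emeasure std_normal_distribution (A i))"
    using prod.Int_Diff[OF F(1), of "\<lambda>i. emeasure std_normal_distribution (A i)" J]
    by (simp only: mult.commute)
  finally show "emeasure (distr (?G \<Otimes>\<^sub>M ?G) ?G (\<lambda>(x, y). override_on x y J))
      (prod_emb UNIV (\<lambda>_. std_normal_distribution) F (Pi\<^sub>E F A)) = (\<Prod>i\<in>F. emeasure std_normal_distribution (A i))" .
qed

lemma measurable_override_on:
  "(\<lambda>(x, y). override_on x y J) \<in> measurable (gauss_array \<Otimes>\<^sub>M gauss_array) gauss_array"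
  by (rule measurable_into_gauss_array) (auto simp: override_on_def split_beta)

lemma measurable_override_on_right: "(\<lambda>y. override_on x y J) \<in> measurable gauss_array gauss_array"
  by (rule measurable_into_gauss_array) (auto simp: override_on_def)

lemma tame_resample:
  assumes "tame F" shows "tame (\<lambda>y. F (override_on x y J))"
proof -
  from assms obtain I C c where *: "finite I" "C \<ge> 0" "c \<ge> 0"
    "\<And>x. \<bar>F x\<bar> \<le> C * exp (c * (\<Sum>k\<in>I. \<bar>x k\<bar>))" and F: "F \<in> borel_measurable gauss_array"
    unfolding tame_def by blast
  have "\<bar>F (override_on x y J)\<bar> \<le> (C * exp (c * (\<Sum>k\<in>I. \<bar>x k\<bar>))) * exp (c * (\<Sum>k\<in>I. \<bar>y k\<bar>))" for y
  proof -
    have "(\<Sum>k\<in>I. \<bar>override_on x y J k\<bar>) \<le> (\<Sum>k\<in>I. \<bar>x k\<bar> + \<bar>y k\<bar>)"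
      by (intro sum_mono) (auto simp: override_on_def)
    then have "C * exp (c * (\<Sum>k\<in>I. \<bar>override_on x y J k\<bar>))
        \<le> C * exp (c * (\<Sum>k\<in>I. \<bar>x k\<bar>) + c * (\<Sum>k\<in>I. \<bar>y k\<bar>))"
      using * by (intro mult_left_mono) (auto simp: sum.distrib distrib_left[symmetric] mult_left_mono)
    then show ?thesis
      using *(4)[of "override_on x y J"] by (simp add: exp_add mult_ac)
  qed
  moreover have "(\<lambda>y. F (override_on x y J)) \<in> borel_measurable gauss_array"
    using measurable_compose[OF measurable_override_on_right F] .
  ultimately show ?thesis
    unfolding tame_def using *
    by (intro conjI exI[of _ I] exI[of _ "C * exp (c * (\<Sum>k\<in>I. \<bar>x k\<bar>))"] exI[of _ c]) auto
qed

lemma expectation_resample: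
  assumes "tame F"
  shows "integrable gauss_array (\<lambda>x. \<integral>y. F (override_on x y J) \<partial>gauss_array)"
    and "(\<integral>x. F x \<partial>gauss_array) = (\<integral>x. (\<integral>y. F (override_on x y J) \<partial>gauss_array) \<partial>gauss_array)"
proof -
  interpret P: pair_sigma_finite gauss_array gauss_array
    by standard
  note F = tame_measurable[OF assms]
  have "integrable (distr (gauss_array \<Otimes>\<^sub>M gauss_array) gauss_array (\<lambda>(x, y). override_on x y J)) F"
    unfolding distr_resample by (rule tame_integrable[OF assms])
  then have i: "integrable (gauss_array \<Otimes>\<^sub>M gauss_array) (\<lambda>z. F (case z of (x, y) \<Rightarrow> override_on x y J))"
    by (subst (asm) integrable_distr_eq[OF measurable_override_on F])
  then have i': "integrable (gauss_array \<Otimes>\<^sub>M gauss_array) (\<lambda>(x, y). F (override_on x y J))"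
    by (simp add: split_beta')
  show "integrable gauss_array (\<lambda>x. \<integral>y. F (override_on x y J) \<partial>gauss_array)"
    by (rule P.integrable_fst[OF i'])
  have "(\<integral>x. F x \<partial>gauss_array)
      = (\<integral>x. F x \<partial>distr (gauss_array \<Otimes>\<^sub>M gauss_array) gauss_array (\<lambda>(x, y). override_on x y J))"
    by (simp only: distr_resample)
  also have "\<dots> = (\<integral>z. F (case z of (x, y) \<Rightarrow> override_on x y J) \<partial>(gauss_array \<Otimes>\<^sub>M gauss_array))"
    by (rule integral_distr[OF measurable_override_on F])
  also have "\<dots> = (\<integral>z. (\<lambda>(x, y). F (override_on x y J)) z \<partial>(gauss_array \<Otimes>\<^sub>M gauss_array))"
    by (simp add: split_beta')
  also have "\<dots> = (\<integral>x. (\<integral>y. F (override_on x y J) \<partial>gauss_array) \<partial>gauss_array)"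
    using P.integral_fst'[OF i'] by simp
  finally show "(\<integral>x. F x \<partial>gauss_array)
    = (\<integral>x. (\<integral>y. F (override_on x y J) \<partial>gauss_array) \<partial>gauss_array)" .
qed

lemma expectation_resample_le:
  assumes "tame F" "tame D" "\<And>x. (\<integral>y. F (override_on x y J) \<partial>gauss_array) \<le> D x"
  shows "(\<integral>x. F x \<partial>gauss_array) \<le> (\<integral>x. D x \<partial>gauss_array)"
  unfolding expectation_resample(2)[OF assms(1), of J]
  by (intro integral_mono expectation_resample(1) tame_integrable assms)

lemma expectation_coordinate:
  fixes f :: "real \<Rightarrow> real"
  assumes "f \<in> borel_measurable borel"
  shows "(\<integral>x. f (x k) \<partial>gauss_array) = (\<integral>t. f t \<partial>std_normal_distribution)"
  using gauss_array_linear_form[of "{k}" f "\<lambda>_. 1"] assms by simp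

text \<open>Stein's identity, from the fundamental theorem of calculus for \<open>F\<close> times the Gaussian
  density, which vanishes at both ends of the line.\<close>

lemma std_normal_integration_by_parts:
  assumes F: "\<And>t. (F has_real_derivative F' t) (at t)" and cont: "\<And>t. isCont F' t"
    and bF: "\<And>t. \<bar>F t\<bar> \<le> C * exp (c * \<bar>t\<bar>)" and bF': "\<And>t. \<bar>F' t\<bar> \<le> C * exp (c * \<bar>t\<bar>)"
  shows "(\<integral>t. t * F t \<partial>std_normal_distribution) = (\<integral>t. F' t \<partial>std_normal_distribution)"
proof -
  let ?\<phi> = std_normal_density
  have C: "C \<ge> 0" using bF[of 0] by (auto intro: order_trans[OF abs_ge_zero])
  have contF: "isCont F t" for t by (rule DERIV_isCont[OF F])
  have [measurable]: "F \<in> borel_measurable borel" "F' \<in> borel_measurable borel"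
    using contF cont by (auto intro!: borel_measurable_continuous_onI simp: continuous_on_eq_continuous_at)
  have i1: "integrable std_normal_distribution F'"
    by (rule Bochner_Integration.integrable_bound[OF integrable_mult_right[OF integrable_std_normal_exp_abs], of _ C c])
       (use bF' C in \<open>auto simp: abs_mult\<close>)
  have i2: "integrable std_normal_distribution (\<lambda>t. t * F t)"
  proof (rule Bochner_Integration.integrable_bound[OF integrable_mult_right[OF integrable_std_normal_exp_abs], of _ C "c + 1"])
    have "\<bar>t * F t\<bar> \<le> \<bar>C * exp ((c + 1) * \<bar>t\<bar>)\<bar>" for t
    proof -
      have "\<bar>t\<bar> \<le> exp \<bar>t\<bar>" using exp_ge_add_one_self[of "\<bar>t\<bar>"] by linarith
      then have "\<bar>t\<bar> * \<bar>F t\<bar> \<le> exp \<bar>t\<bar> * (C * exp (c * \<bar>t\<bar>))"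
        by (intro mult_mono bF) auto
      also have "\<dots> = C * exp ((c + 1) * \<bar>t\<bar>)"
        by (simp add: exp_add[symmetric] algebra_simps)
      finally show ?thesis using C by (simp add: abs_mult)
    qed
    then show "AE t in std_normal_distribution. norm (t * F t) \<le> norm (C * exp ((c + 1) * \<bar>t\<bar>))"
      by auto
  qed auto
  have j: "integrable lborel (\<lambda>t. ?\<phi> t * F' t)" "integrable lborel (\<lambda>t. ?\<phi> t * (t * F t))"
    using i1 i2 by (auto simp: integrable_density)
  have dphi: "(?\<phi> has_real_derivative - t * ?\<phi> t) (at t)" for t
    unfolding std_normal_density_def by (auto intro!: derivative_eq_intros simp: field_simps)
  let ?G = "\<lambda>t. ?\<phi> t * F' t - ?\<phi> t * (t * F t)"
  \<comment> \<open>The constant comes from completing the square in \<open>(c + 1) * \<bar>t\<bar> - t\<^sup>2 / 2\<close>.\<close>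
  have decay: "\<bar>?\<phi> t * F t\<bar> \<le> C * exp ((c + 1)\<^sup>2 / 2) * exp (- \<bar>t\<bar>)" for t
  proof -
    have "c * \<bar>t\<bar> - t\<^sup>2 / 2 \<le> (c + 1)\<^sup>2 / 2 - \<bar>t\<bar>"
      using zero_le_power2[of "\<bar>t\<bar> - (c + 1)"] by (simp add: power2_diff algebra_simps power2_eq_square)
    then have e: "exp (- t\<^sup>2 / 2) * exp (c * \<bar>t\<bar>) \<le> exp ((c + 1)\<^sup>2 / 2) * exp (- \<bar>t\<bar>)"
      by (simp add: exp_add[symmetric] algebra_simps)
    have "1 \<le> 2 * pi" using pi_ge_two by linarith
    then have "1 / sqrt (2 * pi) \<le> 1" by (simp add: real_le_rsqrt)
    then have p: "?\<phi> t \<le> exp (- t\<^sup>2 / 2)"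
      unfolding std_normal_density_def using mult_right_mono[of "1 / sqrt (2 * pi)" 1 "exp (- t\<^sup>2 / 2)"] by auto
    have "\<bar>?\<phi> t * F t\<bar> = ?\<phi> t * \<bar>F t\<bar>" by (simp add: abs_mult)
    also have "\<dots> \<le> exp (- t\<^sup>2 / 2) * (C * exp (c * \<bar>t\<bar>))"
      by (intro mult_mono p bF) auto
    also have "\<dots> = C * (exp (- t\<^sup>2 / 2) * exp (c * \<bar>t\<bar>))" by simp
    also have "\<dots> \<le> C * (exp ((c + 1)\<^sup>2 / 2) * exp (- \<bar>t\<bar>))"
      by (intro mult_left_mono e C)
    finally show ?thesis by (simp add: mult_ac)
  qed
  have lim: "((\<lambda>t. ?\<phi> t * F t) \<longlongrightarrow> 0) L" if "filterlim (\<lambda>t::real. \<bar>t\<bar>) at_top L" for L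
  proof (rule Lim_null_comparison)
    show "\<forall>\<^sub>F t in L. norm (?\<phi> t * F t) \<le> C * exp ((c + 1)\<^sup>2 / 2) * exp (- \<bar>t\<bar>)"
      using decay by (intro always_eventually) auto
    have "((\<lambda>t. exp (- \<bar>t\<bar>)) \<longlongrightarrow> (0::real)) L"
      by (rule filterlim_compose[OF exp_at_bot filterlim_compose[OF filterlim_uminus_at_bot_at_top that]])
    from tendsto_mult_left[OF this, of "C * exp ((c + 1)\<^sup>2 / 2)"]
    show "((\<lambda>t. C * exp ((c + 1)\<^sup>2 / 2) * exp (- \<bar>t\<bar>)) \<longlongrightarrow> 0) L" by simp
  qed
  have "(LBINT t=-\<infinity>..\<infinity>. ?G t) = 0 - 0"
  proof (rule interval_integral_FTC_integrable[where F = "\<lambda>t. ?\<phi> t * F t"])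
    fix t
    show "((\<lambda>t. ?\<phi> t * F t) has_vector_derivative ?G t) (at t)"
      unfolding has_real_derivative_iff_has_vector_derivative[symmetric]
      by (auto intro!: derivative_eq_intros dphi F simp: algebra_simps)
    have "isCont ?\<phi> t" by (rule DERIV_isCont[OF dphi])
    then show "isCont ?G t" by (intro continuous_intros cont contF)
  next
    show "set_integrable lborel (einterval (- \<infinity>) \<infinity>) ?G"
      using j by (simp add: set_integrable_def)
    show "(((\<lambda>t. ?\<phi> t * F t) \<circ> real_of_ereal) \<longlongrightarrow> 0) (at_right (- \<infinity>))"
      using filterlim_compose[OF filterlim_abs_real filterlim_uminus_at_top_at_bot]
      by (simp add: ereal_tendsto_simps lim)
    show "(((\<lambda>t. ?\<phi> t * F t) \<circ> real_of_ereal) \<longlongrightarrow> 0) (at_left \<infinity>)"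
      by (simp add: ereal_tendsto_simps lim filterlim_abs_real)
  qed simp
  then have "(\<integral>t. ?G t \<partial>lborel) = 0"
    by (simp add: interval_lebesgue_integral_def set_lebesgue_integral_def)
  then have "(\<integral>t. ?\<phi> t * F' t \<partial>lborel) = (\<integral>t. ?\<phi> t * (t * F t) \<partial>lborel)"
    using j by simp
  then show ?thesis
    by (simp add: integral_density)
qed

text \<open>The one-dimensional identity in coordinate \<open>k\<close>, with all other coordinates frozen.\<close>

lemma gauss_array_integration_by_parts:
  fixes F F' :: "('k \<Rightarrow> real) \<Rightarrow> real"
  assumes "tame F" "tame F'"
    and F: "\<And>x t. ((\<lambda>t. F (x(k := t))) has_real_derivative F' (x(k := t))) (at t)"
    and cont: "\<And>x t. isCont (\<lambda>t. F' (x(k := t))) t"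
  shows "(\<integral>x. x k * F x \<partial>gauss_array) = (\<integral>x. F' x \<partial>gauss_array)"
proof -
  have upd: "override_on x y {k} = x(k := y k)" for x y :: "'k \<Rightarrow> real"
    by (auto simp: override_on_def)
  have "(\<integral>y. y k * F (x(k := y k)) \<partial>gauss_array) = (\<integral>y. F' (x(k := y k)) \<partial>gauss_array)" for x
  proof -
    obtain I C c where *: "finite I" "C \<ge> 0" "c \<ge> 0"
      "\<And>x. \<bar>F x\<bar> \<le> C * exp (c * (\<Sum>k\<in>I. \<bar>x k\<bar>))" "\<And>x. \<bar>F' x\<bar> \<le> C * exp (c * (\<Sum>k\<in>I. \<bar>x k\<bar>))"
      by (rule tame_joint_bound[OF assms(1,2)]) blast
    let ?C = "C * exp (c * (\<Sum>k\<in>I. \<bar>x k\<bar>))"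
    have b: "C * exp (c * (\<Sum>i\<in>I. \<bar>(x(k := t)) i\<bar>)) \<le> ?C * exp (c * \<bar>t\<bar>)" for t
    proof -
      have "(\<Sum>i\<in>I. \<bar>(x(k := t)) i\<bar>) \<le> (\<Sum>i\<in>I. \<bar>x i\<bar> + (if i = k then \<bar>t\<bar> else 0))"
        by (intro sum_mono) auto
      also have "\<dots> \<le> (\<Sum>i\<in>I. \<bar>x i\<bar>) + \<bar>t\<bar>"
        using *(1) by (simp add: sum.distrib)
      finally have "c * (\<Sum>i\<in>I. \<bar>(x(k := t)) i\<bar>) \<le> c * (\<Sum>i\<in>I. \<bar>x i\<bar>) + c * \<bar>t\<bar>"
        using *(3) by (metis distrib_left mult_left_mono)
      then show ?thesis
        using *(2) by (simp add: exp_add[symmetric] mult.assoc mult_left_mono)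
    qed
    have contF: "isCont (\<lambda>t. F (x(k := t))) t" for t by (rule DERIV_isCont[OF F])
    have [measurable]: "(\<lambda>t. F (x(k := t))) \<in> borel_measurable borel" "(\<lambda>t. F' (x(k := t))) \<in> borel_measurable borel"
      using contF cont by (auto intro!: borel_measurable_continuous_onI simp: continuous_on_eq_continuous_at)
    have "(\<integral>t. t * F (x(k := t)) \<partial>std_normal_distribution) = (\<integral>t. F' (x(k := t)) \<partial>std_normal_distribution)"
      by (rule std_normal_integration_by_parts[OF F cont])
         (rule order_trans[OF *(4) b], rule order_trans[OF *(5) b])
    then show ?thesis
      using expectation_coordinate[of "\<lambda>t. t * F (x(k := t))" k] expectation_coordinate[of "\<lambda>t. F' (x(k := t))" k]
      by simp
  qed
  then show ?thesis
    using expectation_resample(2)[OF tame_mult[OF tame_coordinate assms(1)], of k "{k}"]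
      expectation_resample(2)[OF assms(2), of "{k}"]
    by (simp add: upd)
qed

lemma quadratic_nonneg_imp_discriminant:
  fixes a b c :: real
  assumes "\<And>t. 0 \<le> t\<^sup>2 * a + 2 * t * b + c" "a \<ge> 0"
  shows "b\<^sup>2 \<le> a * c"
proof (cases "a = 0")
  case True
  have "b = 0"
  proof (rule ccontr)
    assume "b \<noteq> 0"
    then show False using assms(1)[of "- (c + 1) / (2 * b)"] True by (simp add: field_simps)
  qed
  then show ?thesis using True by simp
next
  case False
  then have a: "a > 0" using assms by simp
  have "0 \<le> a * ((- b / a)\<^sup>2 * a + 2 * (- b / a) * b + c)"
    using a assms(1)[of "- b / a"] by (intro mult_nonneg_nonneg) auto
  also have "\<dots> = a * c - b\<^sup>2"
    using a by (simp add: field_simps power2_eq_square)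
  finally show ?thesis by simp
qed

lemma gauss_Cauchy_Schwarz:
  assumes F: "tame F" and G: "tame G"
  shows "\<bar>\<integral>x. F x * G x \<partial>gauss_array\<bar>
     \<le> sqrt (\<integral>x. (F x)\<^sup>2 \<partial>gauss_array) * sqrt (\<integral>x. (G x)\<^sup>2 \<partial>gauss_array)"
proof -
  have "(\<integral>x. F x * G x \<partial>gauss_array)\<^sup>2 \<le> (\<integral>x. (F x)\<^sup>2 \<partial>gauss_array) * (\<integral>x. (G x)\<^sup>2 \<partial>gauss_array)"
  proof (rule quadratic_nonneg_imp_discriminant)
    fix t
    have "0 \<le> (\<integral>x. (t * F x + G x)\<^sup>2 \<partial>gauss_array)"
      by simp
    also have "\<dots> = (\<integral>x. t\<^sup>2 * (F x)\<^sup>2 + 2 * t * (F x * G x) + (G x)\<^sup>2 \<partial>gauss_array)"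
      by (simp add: power2_eq_square algebra_simps)
    also have "\<dots> = t\<^sup>2 * (\<integral>x. (F x)\<^sup>2 \<partial>gauss_array) + 2 * t * (\<integral>x. F x * G x \<partial>gauss_array) + (\<integral>x. (G x)\<^sup>2 \<partial>gauss_array)"
      using tame_integrable[OF tame_power[OF F, of 2]] tame_integrable[OF tame_power[OF G, of 2]]
        tame_integrable[OF tame_mult[OF F G]] by simp
    finally show "0 \<le> t\<^sup>2 * (\<integral>x. (F x)\<^sup>2 \<partial>gauss_array) + 2 * t * (\<integral>x. F x * G x \<partial>gauss_array) + (\<integral>x. (G x)\<^sup>2 \<partial>gauss_array)" .
  qed simp
  then have "sqrt ((\<integral>x. F x * G x \<partial>gauss_array)\<^sup>2)
      \<le> sqrt ((\<integral>x. (F x)\<^sup>2 \<partial>gauss_array) * (\<integral>x. (G x)\<^sup>2 \<partial>gauss_array))"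
    by (rule real_sqrt_le_mono)
  then show ?thesis
    by (simp only: real_sqrt_abs real_sqrt_mult)
qed

section \<open>Weighted averages\<close>

text \<open>Weights are not normalized: Gibbs weights are exponentials of the energy, and adding a site
  multiplies them by a factor.\<close>

definition wavg :: "'s set \<Rightarrow> ('s \<Rightarrow> real) \<Rightarrow> ('s \<Rightarrow> real) \<Rightarrow> real" where
  "wavg S w f = (\<Sum>\<sigma>\<in>S. w \<sigma> * f \<sigma>) / (\<Sum>\<sigma>\<in>S. w \<sigma>)"

lemma wavg_cong: "(\<And>\<sigma>. \<sigma> \<in> S \<Longrightarrow> f \<sigma> = f' \<sigma>) \<Longrightarrow> wavg S w f = wavg S w f'"
  unfolding wavg_def by simp

lemma wavg_add: "wavg S w (\<lambda>\<sigma>. f \<sigma> + f' \<sigma>) = wavg S w f + wavg S w f'"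
  unfolding wavg_def by (simp add: distrib_left sum.distrib add_divide_distrib)

lemma wavg_diff: "wavg S w (\<lambda>\<sigma>. f \<sigma> - f' \<sigma>) = wavg S w f - wavg S w f'"
  unfolding wavg_def by (simp add: right_diff_distrib sum_subtractf diff_divide_distrib)

lemma wavg_cmult: "wavg S w (\<lambda>\<sigma>. a * f \<sigma>) = a * wavg S w f"
  unfolding wavg_def by (simp add: sum_distrib_left mult_ac)

lemma wavg_multc: "wavg S w (\<lambda>\<sigma>. f \<sigma> * a) = wavg S w f * a"
  using wavg_cmult[of S w a f] by (simp add: mult.commute)

lemma wavg_uminus: "wavg S w (\<lambda>\<sigma>. - f \<sigma>) = - wavg S w f"
  using wavg_cmult[of S w "-1" f] by simp

lemma wavg_divide: "wavg S w (\<lambda>\<sigma>. f \<sigma> / a) = wavg S w f / a"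
  using wavg_multc[of S w f "inverse a"] by (simp add: divide_inverse)

lemma wavg_sum: "wavg S w (\<lambda>\<sigma>. \<Sum>i\<in>A. f i \<sigma>) = (\<Sum>i\<in>A. wavg S w (f i))"
  by (induction A rule: infinite_finite_induct) (auto simp: wavg_add, auto simp: wavg_def)

lemma wavg_product: "wavg S w f * wavg T v f' = wavg S w (\<lambda>\<sigma>. wavg T v (\<lambda>\<tau>. f \<sigma> * f' \<tau>))"
  by (simp add: wavg_cmult wavg_multc)

locale positive_weights =
  fixes S :: "'s set" and w :: "'s \<Rightarrow> real"
  assumes fin: "finite S" and ne: "S \<noteq> {}" and pos: "\<And>\<sigma>. \<sigma> \<in> S \<Longrightarrow> w \<sigma> > 0"
begin

lemma total_pos: "(\<Sum>\<sigma>\<in>S. w \<sigma>) > 0"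
  using fin ne pos by (rule sum_pos)

lemma wavg_const: "wavg S w (\<lambda>_. a) = a"
  unfolding wavg_def using total_pos by (simp add: sum_distrib_right[symmetric])

lemma wavg_mono: "(\<And>\<sigma>. \<sigma> \<in> S \<Longrightarrow> f \<sigma> \<le> f' \<sigma>) \<Longrightarrow> wavg S w f \<le> wavg S w f'"
  unfolding wavg_def using total_pos pos
  by (intro divide_right_mono sum_mono mult_left_mono) (auto intro: less_imp_le)

lemma wavg_le: "(\<And>\<sigma>. \<sigma> \<in> S \<Longrightarrow> f \<sigma> \<le> a) \<Longrightarrow> wavg S w f \<le> a"
  using wavg_mono[of f "\<lambda>_. a"] by (simp add: wavg_const)

lemma wavg_ge: "(\<And>\<sigma>. \<sigma> \<in> S \<Longrightarrow> a \<le> f \<sigma>) \<Longrightarrow> a \<le> wavg S w f"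
  using wavg_mono[of "\<lambda>_. a" f] by (simp add: wavg_const)

lemma wavg_abs: "\<bar>wavg S w f\<bar> \<le> wavg S w (\<lambda>\<sigma>. \<bar>f \<sigma>\<bar>)"
proof -
  have "wavg S w f \<le> wavg S w (\<lambda>\<sigma>. \<bar>f \<sigma>\<bar>)" "wavg S w (\<lambda>\<sigma>. - f \<sigma>) \<le> wavg S w (\<lambda>\<sigma>. \<bar>f \<sigma>\<bar>)"
    by (auto intro: wavg_mono)
  then show ?thesis by (simp add: wavg_uminus)
qed

lemma wavg_abs_le: "(\<And>\<sigma>. \<sigma> \<in> S \<Longrightarrow> \<bar>f \<sigma>\<bar> \<le> a) \<Longrightarrow> \<bar>wavg S w f\<bar> \<le> a"
  using wavg_abs[of f] wavg_le[of "\<lambda>\<sigma>. \<bar>f \<sigma>\<bar>" a] by simp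

lemma wavg_square_le: "(wavg S w f)\<^sup>2 \<le> wavg S w (\<lambda>\<sigma>. (f \<sigma>)\<^sup>2)"
proof -
  have "0 \<le> wavg S w (\<lambda>\<sigma>. (f \<sigma> - wavg S w f)\<^sup>2)"
    by (intro wavg_ge) simp
  also have "\<dots> = wavg S w (\<lambda>\<sigma>. (f \<sigma>)\<^sup>2 - (2 * wavg S w f) * f \<sigma> + (wavg S w f)\<^sup>2)"
    by (intro wavg_cong) (simp add: power2_diff mult_ac)
  also have "\<dots> = wavg S w (\<lambda>\<sigma>. (f \<sigma>)\<^sup>2) - (wavg S w f)\<^sup>2"
    by (simp only: wavg_add wavg_diff wavg_cmult wavg_const) (simp add: power2_eq_square)
  finally show ?thesis by simp
qed

lemma exp_wavg_le: "exp (wavg S w f) \<le> wavg S w (\<lambda>\<sigma>. exp (f \<sigma>))"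
proof -
  let ?m = "wavg S w f"
  have "exp ?m = wavg S w (\<lambda>\<sigma>. exp ?m * (1 + (f \<sigma> - ?m)))"
    by (simp only: wavg_cmult wavg_add wavg_diff wavg_const) simp
  also have "\<dots> \<le> wavg S w (\<lambda>\<sigma>. exp ?m * exp (f \<sigma> - ?m))"
    by (intro wavg_mono mult_left_mono exp_ge_add_one_self) auto
  also have "\<dots> = wavg S w (\<lambda>\<sigma>. exp (f \<sigma>))"
    by (simp add: exp_add[symmetric])
  finally show ?thesis .
qed

end

text \<open>Differentiating a Gibbs average in a parameter of the energy produces a covariance with the
  derivative of the energy.\<close>

lemma DERIV_wavg:
  assumes "positive_weights S (\<lambda>\<sigma>. exp (e \<sigma> t))"
    and e: "\<And>\<sigma>. \<sigma> \<in> S \<Longrightarrow> (e \<sigma> has_real_derivative e' \<sigma>) (at t)"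
    and f: "\<And>\<sigma>. \<sigma> \<in> S \<Longrightarrow> (f \<sigma> has_real_derivative f' \<sigma>) (at t)"
  shows "((\<lambda>t. wavg S (\<lambda>\<sigma>. exp (e \<sigma> t)) (\<lambda>\<sigma>. f \<sigma> t)) has_real_derivative
      (let A = wavg S (\<lambda>\<sigma>. exp (e \<sigma> t)) in
        A f' + A (\<lambda>\<sigma>. f \<sigma> t * e' \<sigma>) - A (\<lambda>\<sigma>. f \<sigma> t) * A e')) (at t)"
proof -
  interpret positive_weights S "\<lambda>\<sigma>. exp (e \<sigma> t)" by fact
  let ?Z = "\<Sum>\<sigma>\<in>S. exp (e \<sigma> t)" and ?N = "\<Sum>\<sigma>\<in>S. exp (e \<sigma> t) * f \<sigma> t"
  have Z: "((\<lambda>t. \<Sum>\<sigma>\<in>S. exp (e \<sigma> t)) has_real_derivative (\<Sum>\<sigma>\<in>S. exp (e \<sigma> t) * e' \<sigma>)) (at t)"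
    by (intro DERIV_sum DERIV_fun_exp e)
  have N: "((\<lambda>t. \<Sum>\<sigma>\<in>S. exp (e \<sigma> t) * f \<sigma> t) has_real_derivative
      (\<Sum>\<sigma>\<in>S. (exp (e \<sigma> t) * e' \<sigma>) * f \<sigma> t + f' \<sigma> * exp (e \<sigma> t))) (at t)"
    by (intro DERIV_sum DERIV_mult DERIV_fun_exp e f)
  have "((\<lambda>t. wavg S (\<lambda>\<sigma>. exp (e \<sigma> t)) (\<lambda>\<sigma>. f \<sigma> t)) has_real_derivative
      ((\<Sum>\<sigma>\<in>S. (exp (e \<sigma> t) * e' \<sigma>) * f \<sigma> t + f' \<sigma> * exp (e \<sigma> t)) * ?Z
        - ?N * (\<Sum>\<sigma>\<in>S. exp (e \<sigma> t) * e' \<sigma>)) / (?Z * ?Z)) (at t)"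
    unfolding wavg_def using total_pos by (intro DERIV_divide N Z) auto
  also have "((\<Sum>\<sigma>\<in>S. (exp (e \<sigma> t) * e' \<sigma>) * f \<sigma> t + f' \<sigma> * exp (e \<sigma> t)) * ?Z
        - ?N * (\<Sum>\<sigma>\<in>S. exp (e \<sigma> t) * e' \<sigma>)) / (?Z * ?Z)
      = (\<Sum>\<sigma>\<in>S. (exp (e \<sigma> t) * e' \<sigma>) * f \<sigma> t + f' \<sigma> * exp (e \<sigma> t)) / ?Z
        - ?N / ?Z * ((\<Sum>\<sigma>\<in>S. exp (e \<sigma> t) * e' \<sigma>) / ?Z)"
    using total_pos by (simp add: field_simps)
  finally show ?thesis
    unfolding Let_def wavg_def by (simp add: sum.distrib add_divide_distrib mult_ac add_ac)
qed

section \<open>The Gibbs measure on a finite set of sites\<close>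

definition spins :: "nat set \<Rightarrow> (nat \<Rightarrow> real) set" where
  "spins V = V \<rightarrow>\<^sub>E {- 1, 1}"

definition pair_energy :: "nat set \<Rightarrow> (nat \<times> nat \<Rightarrow> real) \<Rightarrow> (nat \<Rightarrow> real) \<Rightarrow> real" where
  "pair_energy V g \<sigma> = (\<Sum>k\<in>V \<times> V. g k * (\<sigma> (fst k) * \<sigma> (snd k)))"

definition energy :: "real \<Rightarrow> real \<Rightarrow> nat set \<Rightarrow> (nat \<times> nat \<Rightarrow> real) \<Rightarrow> (nat \<Rightarrow> real) \<Rightarrow> real" where
  "energy c h V g \<sigma> = c * pair_energy V g \<sigma> + h * (\<Sum>i\<in>V. \<sigma> i)"

definition Zsum :: "real \<Rightarrow> real \<Rightarrow> nat set \<Rightarrow> (nat \<times> nat \<Rightarrow> real) \<Rightarrow> real" where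
  "Zsum c h V g = (\<Sum>\<sigma>\<in>spins V. exp (energy c h V g \<sigma>))"

definition gavg ::
    "real \<Rightarrow> real \<Rightarrow> nat set \<Rightarrow> (nat \<times> nat \<Rightarrow> real) \<Rightarrow> ((nat \<Rightarrow> real) \<Rightarrow> real) \<Rightarrow> real" where
  "gavg c h V g f = wavg (spins V) (\<lambda>\<sigma>. exp (energy c h V g \<sigma>)) f"

text \<open>The overlap is normalized by a parameter instead of the number of sites, so that removing a
  site changes neither the coupling constant nor the normalization.\<close>

definition olap :: "real \<Rightarrow> nat set \<Rightarrow> (nat \<Rightarrow> real) \<Rightarrow> (nat \<Rightarrow> real) \<Rightarrow> real" where
  "olap n V \<sigma> \<tau> = (\<Sum>i\<in>V. \<sigma> i * \<tau> i) / n"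

lemma finite_spins [simp]: "finite V \<Longrightarrow> finite (spins V)"
  unfolding spins_def by (rule finite_PiE) auto

lemma card_spins: "finite V \<Longrightarrow> card (spins V) = 2 ^ card V"
  unfolding spins_def by (simp add: card_PiE numeral_2_eq_2)

lemma spins_nonempty [simp]: "spins V \<noteq> {}"
  unfolding spins_def by (auto simp: PiE_eq_empty_iff)

lemma spins_values: "\<sigma> \<in> spins V \<Longrightarrow> i \<in> V \<Longrightarrow> \<sigma> i = -1 \<or> \<sigma> i = 1"
  unfolding spins_def by (auto simp: PiE_iff)

lemma spins_square: "\<sigma> \<in> spins V \<Longrightarrow> i \<in> V \<Longrightarrow> \<sigma> i * \<sigma> i = 1"
  using spins_values[of \<sigma> V i] by auto

lemma spins_abs: "\<sigma> \<in> spins V \<Longrightarrow> i \<in> V \<Longrightarrow> \<bar>\<sigma> i\<bar> = 1"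
  using spins_values[of \<sigma> V i] by auto

lemma gibbs_weights: "finite V \<Longrightarrow> positive_weights (spins V) (\<lambda>\<sigma>. exp (energy c h V g \<sigma>))"
  by unfold_locales auto

lemmas gavg_cong = wavg_cong[of "spins V" _ _ "\<lambda>\<sigma>. exp (energy c h V g \<sigma>)" for c h V g, folded gavg_def]
lemmas gavg_linear = wavg_add[of "spins V" "\<lambda>\<sigma>. exp (energy c h V g \<sigma>)" for c h V g, folded gavg_def]
  wavg_diff[of "spins V" "\<lambda>\<sigma>. exp (energy c h V g \<sigma>)" for c h V g, folded gavg_def]
  wavg_cmult[of "spins V" "\<lambda>\<sigma>. exp (energy c h V g \<sigma>)" for c h V g, folded gavg_def]
  wavg_multc[of "spins V" "\<lambda>\<sigma>. exp (energy c h V g \<sigma>)" for c h V g, folded gavg_def]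
  wavg_divide[of "spins V" "\<lambda>\<sigma>. exp (energy c h V g \<sigma>)" for c h V g, folded gavg_def]
  wavg_uminus[of "spins V" "\<lambda>\<sigma>. exp (energy c h V g \<sigma>)" for c h V g, folded gavg_def]
lemmas gavg_sum = wavg_sum[of "spins V" "\<lambda>\<sigma>. exp (energy c h V g \<sigma>)" for c h V g, folded gavg_def]
lemmas gavg_const = positive_weights.wavg_const[OF gibbs_weights, folded gavg_def]
lemmas gavg_mono = positive_weights.wavg_mono[OF gibbs_weights, folded gavg_def]
lemmas gavg_le = positive_weights.wavg_le[OF gibbs_weights, folded gavg_def]
lemmas gavg_ge = positive_weights.wavg_ge[OF gibbs_weights, folded gavg_def]
lemmas gavg_abs = positive_weights.wavg_abs[OF gibbs_weights, folded gavg_def]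
lemmas gavg_abs_le = positive_weights.wavg_abs_le[OF gibbs_weights, folded gavg_def]
lemmas gavg_square_le = positive_weights.wavg_square_le[OF gibbs_weights, folded gavg_def]

lemma Zsum_pos: "finite V \<Longrightarrow> Zsum c h V g > 0"
  unfolding Zsum_def by (rule positive_weights.total_pos[OF gibbs_weights])

lemma abs_olap_le:
  assumes "finite V" "\<sigma> \<in> spins V" "\<tau> \<in> spins V" "n > 0" "real (card V) \<le> n"
  shows "\<bar>olap n V \<sigma> \<tau>\<bar> \<le> 1"
proof -
  have "\<bar>\<Sum>i\<in>V. \<sigma> i * \<tau> i\<bar> \<le> (\<Sum>i\<in>V. 1)"
    using assms by (intro order_trans[OF sum_abs] sum_mono) (auto simp: abs_mult spins_abs)
  then show ?thesis
    using assms unfolding olap_def by (simp add: abs_div)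
qed

lemma olap_self:
  assumes "\<sigma> \<in> spins V" shows "olap n V \<sigma> \<sigma> = real (card V) / n"
  unfolding olap_def using assms by (simp add: spins_square)

text \<open>The square of an overlap is a sum over bonds. This is how the bond correlations from Gaussian
  integration by parts turn into overlaps.\<close>

lemma olap_square:
  "(olap n V \<sigma> \<tau>)\<^sup>2 = (\<Sum>k\<in>V \<times> V. (\<sigma> (fst k) * \<sigma> (snd k)) * (\<tau> (fst k) * \<tau> (snd k))) / n\<^sup>2"
proof -
  have "(\<Sum>i\<in>V. \<sigma> i * \<tau> i)\<^sup>2 = (\<Sum>k\<in>V \<times> V. (\<sigma> (fst k) * \<sigma> (snd k)) * (\<tau> (fst k) * \<tau> (snd k)))"
    by (simp add: power2_eq_square sum_product sum.cartesian_product split_beta mult_ac)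
  then show ?thesis
    unfolding olap_def by (simp add: power_divide)
qed

lemma tame_pair_energy [intro]: "tame (\<lambda>g. pair_energy V g \<sigma>)"
  unfolding pair_energy_def by (intro tame_sum tame_mult tame_coordinate tame_const)

lemma tame_exp_energy:
  assumes "finite V" shows "tame (\<lambda>g. exp (a * energy c h V g \<sigma>))"
proof -
  have "a * energy c h V g \<sigma> = a * h * (\<Sum>i\<in>V. \<sigma> i)
      + (\<Sum>k\<in>V \<times> V. a * c * (\<sigma> (fst k) * \<sigma> (snd k)) * g k)" for g
    unfolding energy_def pair_energy_def by (simp add: sum_distrib_left algebra_simps)
  then show ?thesis
    using tame_exp_linear[of "V \<times> V"] assms by simp
qed

lemma measurable_energy [measurable]: "(\<lambda>g. energy c h V g \<sigma>) \<in> borel_measurable gauss_array"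
  unfolding energy_def pair_energy_def by measurable

lemma measurable_Zsum [measurable]: "(\<lambda>g. Zsum c h V g) \<in> borel_measurable gauss_array"
  unfolding Zsum_def by measurable

lemma tame_Zsum [intro]: "finite V \<Longrightarrow> tame (\<lambda>g. Zsum c h V g)"
  unfolding Zsum_def using tame_exp_energy[of V 1] by (auto intro!: tame_sum)

lemma tame_ln_Zsum [intro]:
  assumes "finite V" shows "tame (\<lambda>g. ln (Zsum c h V g))"
proof -
  obtain \<sigma> where \<sigma>: "\<sigma> \<in> spins V" using spins_nonempty by blast
  show ?thesis
  proof (rule tame_bounded_by)
    show "tame (\<lambda>g. Zsum c h V g + exp (-1 * energy c h V g \<sigma>))"
      by (intro tame_add tame_Zsum tame_exp_energy assms)
    fix g
    have Z: "Zsum c h V g > 0" by (rule Zsum_pos[OF assms])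
    have "exp (energy c h V g \<sigma>) \<le> Zsum c h V g"
      unfolding Zsum_def using \<sigma> assms by (intro member_le_sum) auto
    then have "inverse (Zsum c h V g) \<le> exp (- energy c h V g \<sigma>)"
      unfolding exp_minus by (intro le_imp_inverse_le) auto
    moreover have "ln (Zsum c h V g) \<le> Zsum c h V g" using ln_le_minus_one[OF Z] by linarith
    moreover have "- ln (Zsum c h V g) \<le> inverse (Zsum c h V g)"
      using ln_le_minus_one[of "inverse (Zsum c h V g)"] Z by (simp add: ln_inverse)
    ultimately have "\<bar>ln (Zsum c h V g)\<bar> \<le> Zsum c h V g + exp (- energy c h V g \<sigma>)"
      using Z by (smt (verit) exp_gt_zero)
    then show "\<bar>ln (Zsum c h V g)\<bar> \<le> \<bar>Zsum c h V g + exp (-1 * energy c h V g \<sigma>)\<bar>"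
      by simp
  qed measurable
qed

text \<open>A Gibbs average is a convex combination, so it is bounded by the sum of its entries and the
  denominator does no harm.\<close>

lemma tame_gavg:
  assumes "finite V" and f: "\<And>\<sigma>. \<sigma> \<in> spins V \<Longrightarrow> tame (\<lambda>g. f g \<sigma>)"
  shows "tame (\<lambda>g. gavg c h V g (f g))"
proof (rule tame_bounded_by)
  show "tame (\<lambda>g. \<Sum>\<sigma>\<in>spins V. \<bar>f g \<sigma>\<bar>)"
    by (intro tame_sum tame_abs f)
  have "(\<lambda>g. \<Sum>\<sigma>\<in>spins V. exp (energy c h V g \<sigma>) * f g \<sigma>) \<in> borel_measurable gauss_array"
    by (intro borel_measurable_sum borel_measurable_times tame_measurable[OF f]) measurable
  then show "(\<lambda>g. gavg c h V g (f g)) \<in> borel_measurable gauss_array"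
    unfolding gavg_def wavg_def by measurable
  show "\<bar>gavg c h V g (f g)\<bar> \<le> \<bar>\<Sum>\<sigma>\<in>spins V. \<bar>f g \<sigma>\<bar>\<bar>" for g
  proof -
    have "\<bar>gavg c h V g (f g)\<bar> \<le> (\<Sum>\<sigma>\<in>spins V. \<bar>f g \<sigma>\<bar>)"
      using assms by (intro gavg_abs_le member_le_sum) auto
    then show ?thesis by linarith
  qed
qed

lemma tame_gavg_const [intro]: "finite V \<Longrightarrow> tame (\<lambda>g. gavg c h V g f)"
  by (intro tame_gavg) auto

lemma DERIV_pair_energy:
  assumes "finite V" "k \<in> V \<times> V"
  shows "((\<lambda>t. pair_energy V (x(k := t)) \<sigma>) has_real_derivative \<sigma> (fst k) * \<sigma> (snd k)) (at t)"
proof -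
  have "((\<lambda>t. pair_energy V (x(k := t)) \<sigma>) has_real_derivative
      (\<Sum>p\<in>V \<times> V. (if p = k then 1 else 0) * (\<sigma> (fst p) * \<sigma> (snd p)))) (at t)"
    unfolding pair_energy_def
    by (intro DERIV_sum DERIV_cmult_right) (auto simp: fun_upd_def)
  also have "(\<Sum>p\<in>V \<times> V. (if p = k then 1 else 0) * (\<sigma> (fst p) * \<sigma> (snd p))) = \<sigma> (fst k) * \<sigma> (snd k)"
    using assms by (simp add: if_distrib[of "\<lambda>x. x * _"] cong: if_cong)
  finally show ?thesis .
qed

lemma DERIV_gavg:
  assumes V: "finite V" and k: "k \<in> V \<times> V"
    and f: "\<And>\<sigma>. \<sigma> \<in> spins V \<Longrightarrow> ((\<lambda>t. f (x(k := t)) \<sigma>) has_real_derivative f' \<sigma>) (at t)"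
  shows "((\<lambda>t. gavg c h V (x(k := t)) (f (x(k := t)))) has_real_derivative
      (let y = x(k := t); s = (\<lambda>\<sigma>. \<sigma> (fst k) * \<sigma> (snd k)) in
        gavg c h V y f' + c * (gavg c h V y (\<lambda>\<sigma>. f y \<sigma> * s \<sigma>) - gavg c h V y (f y) * gavg c h V y s))) (at t)"
proof -
  have e: "((\<lambda>t. energy c h V (x(k := t)) \<sigma>) has_real_derivative c * (\<sigma> (fst k) * \<sigma> (snd k))) (at t)" for \<sigma>
    unfolding energy_def
    using DERIV_add[OF DERIV_cmult[OF DERIV_pair_energy[OF V k], of c x \<sigma> t] DERIV_const] by simp

  show ?thesis
    using DERIV_wavg[OF gibbs_weights[OF V] e f]
    unfolding Let_def gavg_def[symmetric]
    by (simp add: gavg_linear mult.left_commute[of _ c] right_diff_distrib add_diff_eq)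
qed

section \<open>The energy per site\<close>

lemma coupling_power: "n > 0 \<Longrightarrow> (\<beta> / sqrt (2 * n))\<^sup>2 = \<beta>\<^sup>2 / (2 * n)"
  by (simp add: power_divide)

lemma sum_gavg_bonds_square:
  assumes "n \<noteq> 0"
  shows "(\<Sum>k\<in>V \<times> V. gavg c h V g (\<lambda>\<sigma>. f \<sigma> * (\<sigma> (fst k) * \<sigma> (snd k))) * gavg c h V g (\<lambda>\<sigma>. \<sigma> (fst k) * \<sigma> (snd k)))
    = n\<^sup>2 * gavg c h V g (\<lambda>\<sigma>. gavg c h V g (\<lambda>\<tau>. f \<sigma> * (olap n V \<sigma> \<tau>)\<^sup>2))"
proof -
  let ?s = "\<lambda>k \<sigma>. \<sigma> (fst k) * \<sigma> (snd k) :: real"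
  have "(\<Sum>k\<in>V \<times> V. gavg c h V g (\<lambda>\<sigma>. f \<sigma> * ?s k \<sigma>) * gavg c h V g (?s k))
      = (\<Sum>k\<in>V \<times> V. gavg c h V g (\<lambda>\<sigma>. gavg c h V g (\<lambda>\<tau>. (f \<sigma> * ?s k \<sigma>) * ?s k \<tau>)))"
    by (simp only: gavg_def wavg_product)
  also have "\<dots> = gavg c h V g (\<lambda>\<sigma>. gavg c h V g (\<lambda>\<tau>. \<Sum>k\<in>V \<times> V. (f \<sigma> * ?s k \<sigma>) * ?s k \<tau>))"
    by (simp only: gavg_sum)
  also have "\<dots> = gavg c h V g (\<lambda>\<sigma>. gavg c h V g (\<lambda>\<tau>. n\<^sup>2 * (f \<sigma> * (olap n V \<sigma> \<tau>)\<^sup>2)))"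
    using assms by (intro gavg_cong) (simp add: olap_square, simp add: sum_distrib_left mult_ac)
  finally show ?thesis
    by (simp only: gavg_linear)
qed

lemma gavg_bond_square: "finite V \<Longrightarrow> k \<in> V \<times> V \<Longrightarrow>
    gavg c h V g (\<lambda>\<sigma>. (\<sigma> (fst k) * \<sigma> (snd k)) * (\<sigma> (fst k) * \<sigma> (snd k))) = 1"
proof -
  assume *: "finite V" "k \<in> V \<times> V"
  have "gavg c h V g (\<lambda>\<sigma>. (\<sigma> (fst k) * \<sigma> (snd k)) * (\<sigma> (fst k) * \<sigma> (snd k))) = gavg c h V g (\<lambda>_. 1)"
  proof (rule gavg_cong)
    fix \<sigma> assume "\<sigma> \<in> spins V"
    then have "\<sigma> (fst k) * \<sigma> (fst k) = 1" "\<sigma> (snd k) * \<sigma> (snd k) = 1"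
      using * spins_square[of \<sigma> V] by (auto simp: mem_Times_iff)
    then show "(\<sigma> (fst k) * \<sigma> (snd k)) * (\<sigma> (fst k) * \<sigma> (snd k)) = 1"
      by (metis mult.assoc mult.left_commute mult.right_neutral)
  qed
  then show ?thesis using * by (simp add: gavg_const)
qed

text \<open>The Gaussian part of the energy only; the external field enters later through the
  magnetizations.\<close>

definition site_energy :: "real \<Rightarrow> real \<Rightarrow> real \<Rightarrow> nat set \<Rightarrow> (nat \<times> nat \<Rightarrow> real) \<Rightarrow> real" where
  "site_energy n \<beta> h V g = gavg (\<beta> / sqrt (2 * n)) h V g (\<lambda>\<sigma>. \<beta> / sqrt (2 * n) * pair_energy V g \<sigma> / n)"

lemma tame_site_energy [intro]: "finite V \<Longrightarrow> tame (\<lambda>g. site_energy n \<beta> h V g)"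
  unfolding site_energy_def by (intro tame_gavg tame_divide_const tame_mult tame_pair_energy tame_const)

text \<open>Gaussian integration by parts: each \<open>g\<^sub>k\<close> in the energy is traded for a derivative of the Gibbs
  average, and the resulting bond correlations add up to squared overlaps.\<close>

lemma site_energy_moments:
  fixes V :: "nat set" and n \<beta> h :: real
  assumes V: "finite V" and n: "n > 0"
  defines "c \<equiv> \<beta> / sqrt (2 * n)"
  defines "W \<equiv> \<lambda>g. site_energy n \<beta> h V g"
    and "\<Lambda> \<equiv> \<lambda>g. gavg c h V g (\<lambda>\<sigma>. gavg c h V g (\<lambda>\<tau>. (olap n V \<sigma> \<tau>)\<^sup>2))"
    and "T \<equiv> \<lambda>g. gavg c h V g (\<lambda>\<sigma>. gavg c h V g (\<lambda>\<tau>. (c * pair_energy V g \<sigma> / n) * (olap n V \<sigma> \<tau>)\<^sup>2))"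
  shows "(\<integral>g. W g \<partial>gauss_array) = \<beta>\<^sup>2 / 2 * (\<integral>g. ((real (card V) / n)\<^sup>2 - \<Lambda> g) \<partial>gauss_array)" (is ?first)
    and "(\<integral>g. (W g)\<^sup>2 \<partial>gauss_array) =
      \<beta>\<^sup>2 / 2 * (\<integral>g. (((real (card V) / n)\<^sup>2 - \<Lambda> g) * W g + \<Lambda> g / n + T g - W g * \<Lambda> g) \<partial>gauss_array)" (is ?second)
proof -
  let ?s = "\<lambda>k \<sigma>. \<sigma> (fst k) * \<sigma> (snd k) :: real"
  let ?A = "\<lambda>k g. gavg c h V g (?s k)"
  let ?H = "\<lambda>g \<sigma>. c * pair_energy V g \<sigma>"
  let ?U = "\<lambda>g. gavg c h V g (?H g)"
  let ?X = "\<lambda>k g. gavg c h V g (\<lambda>\<sigma>. ?H g \<sigma> * ?s k \<sigma>)"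
  have WU: "W g = ?U g / n" for g
    unfolding W_def site_energy_def c_def[symmetric] by (simp add: gavg_linear)
  have UA: "?U g = (\<Sum>k\<in>V \<times> V. c * (g k * ?A k g))" for g
  proof -
    have "?U g = gavg c h V g (\<lambda>\<sigma>. \<Sum>k\<in>V \<times> V. (c * g k) * ?s k \<sigma>)"
      unfolding pair_energy_def by (simp add: sum_distrib_left mult_ac)
    also have "\<dots> = (\<Sum>k\<in>V \<times> V. (c * g k) * ?A k g)"
      by (simp only: gavg_sum gavg_linear)
    finally show ?thesis by (simp add: mult_ac)
  qed
  have tA: "tame (?A k)" for k using V by auto
  have tU: "tame ?U" using V by (intro tame_gavg tame_mult tame_const tame_pair_energy)
  have tX: "tame (?X k)" for k using V by (intro tame_gavg tame_mult tame_const tame_pair_energy)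
  have dA: "((\<lambda>t. ?A k (x(k := t))) has_real_derivative c * (1 - ?A k (x(k := t)) * ?A k (x(k := t)))) (at t)"
    if k: "k \<in> V \<times> V" for k x t
    using DERIV_gavg[OF V k, of "\<lambda>_. ?s k" x "\<lambda>_. 0" t c h] gavg_bond_square[OF V k] V
    by (simp add: Let_def gavg_const)
  have dU: "((\<lambda>t. ?U (x(k := t))) has_real_derivative
      (c * ?A k (x(k := t)) + c * (?X k (x(k := t)) - ?U (x(k := t)) * ?A k (x(k := t))))) (at t)"
    if k: "k \<in> V \<times> V" for k x t
    using DERIV_gavg[OF V k, of ?H x "\<lambda>\<sigma>. c * ?s k \<sigma>" t c h] DERIV_cmult[OF DERIV_pair_energy[OF V k], of c]
    by (simp add: Let_def gavg_linear)
  have cA: "isCont (\<lambda>t. ?A k (x(k := t))) t" if "k \<in> V \<times> V" for k x t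
    by (rule DERIV_isCont[OF dA[OF that]])
  have cU: "isCont (\<lambda>t. ?U (x(k := t))) t" if "k \<in> V \<times> V" for k x t
    by (rule DERIV_isCont[OF dU[OF that]])
  have cX: "isCont (\<lambda>t. ?X k (x(k := t))) t" if k: "k \<in> V \<times> V" for k x t
    by (rule DERIV_isCont, rule DERIV_gavg[OF V k])
       (rule DERIV_cmult_right[OF DERIV_cmult[OF DERIV_pair_energy[OF V k]]])
  have ibpA: "(\<integral>g. g k * ?A k g \<partial>gauss_array) = (\<integral>g. c * (1 - ?A k g * ?A k g) \<partial>gauss_array)"
    if k: "k \<in> V \<times> V" for k
    by (rule gauss_array_integration_by_parts[OF _ _ dA[OF k]])
       (intro tame_mult tame_diff tame_const tA continuous_intros cA[OF k])+
  let ?D = "\<lambda>k g. c * (1 - ?A k g * ?A k g) * ?U g + (c * ?A k g + c * (?X k g - ?U g * ?A k g)) * ?A k g"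
  have tD: "tame (?D k)" for k
    by (intro tame_add tame_mult tame_diff tame_const tA tU tX)
  have ibpU: "(\<integral>g. g k * (?A k g * ?U g) \<partial>gauss_array) = (\<integral>g. ?D k g \<partial>gauss_array)"
    if k: "k \<in> V \<times> V" for k
    by (rule gauss_array_integration_by_parts[OF _ tD DERIV_mult[OF dA[OF k] dU[OF k]]])
       (intro tame_mult tA tU continuous_intros cA[OF k] cX[OF k] cU[OF k])+
  have c2: "c\<^sup>2 * n = \<beta>\<^sup>2 / 2"
    using n by (simp add: c_def coupling_power)
  have sumA: "(\<Sum>k\<in>V \<times> V. ?A k g * ?A k g) = n\<^sup>2 * \<Lambda> g" for g
    using sum_gavg_bonds_square[where f = "\<lambda>_. 1" and n = n and V = V and c = c and h = h and g = g] n by (simp add: \<Lambda>_def)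
  have sumX: "(\<Sum>k\<in>V \<times> V. ?X k g * ?A k g) = n ^ 3 * T g" for g
    using sum_gavg_bonds_square[where f = "?H g" and n = n and V = V and c = c and h = h and g = g] n
    by (simp add: T_def gavg_linear power3_eq_cube power2_eq_square)
  have "(\<integral>g. ?U g \<partial>gauss_array) = (\<Sum>k\<in>V \<times> V. c * (\<integral>g. g k * ?A k g \<partial>gauss_array))"
    unfolding UA by (simp add: tame_integrable tame_mult tA)
  also have "\<dots> = (\<Sum>k\<in>V \<times> V. c * (\<integral>g. c * (1 - ?A k g * ?A k g) \<partial>gauss_array))"
    using ibpA by simp
  also have "\<dots> = (\<integral>g. (\<Sum>k\<in>V \<times> V. c * (c * (1 - ?A k g * ?A k g))) \<partial>gauss_array)"
    by (simp add: tame_integrable tame_mult tA tame_diff)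
  also have "\<dots> = (\<integral>g. n * (\<beta>\<^sup>2 / 2 * ((real (card V) / n)\<^sup>2 - \<Lambda> g)) \<partial>gauss_array)"
  proof (rule Bochner_Integration.integral_cong[OF refl])
    fix g
    have "(\<Sum>k\<in>V \<times> V. c * (c * (1 - ?A k g * ?A k g))) = c\<^sup>2 * ((real (card V))\<^sup>2 - n\<^sup>2 * \<Lambda> g)"
      using sumA[of g] by (simp add: sum_distrib_left[symmetric] sum_subtractf power2_eq_square card_cartesian_product)
    also have "\<dots> = (c\<^sup>2 * n) * n * ((real (card V) / n)\<^sup>2 - \<Lambda> g)"
      using n by (simp add: field_simps power2_eq_square)
    finally show "(\<Sum>k\<in>V \<times> V. c * (c * (1 - ?A k g * ?A k g)))
        = n * (\<beta>\<^sup>2 / 2 * ((real (card V) / n)\<^sup>2 - \<Lambda> g))" unfolding c2 by simp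
  qed
  finally show ?first
    unfolding WU using n by simp
  have "(\<integral>g. (?U g)\<^sup>2 \<partial>gauss_array) = (\<integral>g. (\<Sum>k\<in>V \<times> V. c * (g k * (?A k g * ?U g))) \<partial>gauss_array)"
  proof (rule Bochner_Integration.integral_cong[OF refl])
    fix g
    have "(?U g)\<^sup>2 = (\<Sum>k\<in>V \<times> V. c * (g k * ?A k g)) * ?U g"
      unfolding power2_eq_square by (subst (1) UA) simp
    also have "\<dots> = (\<Sum>k\<in>V \<times> V. c * (g k * (?A k g * ?U g)))"
      by (simp only: sum_distrib_right mult.assoc)
    finally show "(?U g)\<^sup>2 = (\<Sum>k\<in>V \<times> V. c * (g k * (?A k g * ?U g)))" .
  qed
  also have "\<dots> = (\<Sum>k\<in>V \<times> V. c * (\<integral>g. g k * (?A k g * ?U g) \<partial>gauss_array))"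
    by (simp add: tame_integrable tame_mult tA tU)
  also have "\<dots> = (\<Sum>k\<in>V \<times> V. c * (\<integral>g. ?D k g \<partial>gauss_array))"
    using ibpU by (intro sum.cong refl) simp
  also have "\<dots> = (\<integral>g. (\<Sum>k\<in>V \<times> V. c * ?D k g) \<partial>gauss_array)"
    by (subst Bochner_Integration.integral_sum)
       (rule tame_integrable, rule tame_mult[OF tame_const tD], simp)
  also have "\<dots> = (\<integral>g. n\<^sup>2 * (\<beta>\<^sup>2 / 2 * (((real (card V) / n)\<^sup>2 - \<Lambda> g) * W g + \<Lambda> g / n + T g - W g * \<Lambda> g)) \<partial>gauss_array)"
  proof (rule Bochner_Integration.integral_cong[OF refl])
    fix g
    have e1: "(\<Sum>k\<in>V \<times> V. 1 - ?A k g * ?A k g) = (real (card V))\<^sup>2 - n\<^sup>2 * \<Lambda> g"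
      using sumA[of g] by (simp add: sum_subtractf power2_eq_square card_cartesian_product)
    have eU: "?U g = n * W g" using n WU by simp
    have "(\<Sum>k\<in>V \<times> V. c * ?D k g)
        = (\<Sum>k\<in>V \<times> V. c\<^sup>2 * ((1 - ?A k g * ?A k g) * ?U g + ?A k g * ?A k g
            + ?X k g * ?A k g - ?U g * (?A k g * ?A k g)))"
      by (intro sum.cong refl) (simp add: power2_eq_square algebra_simps)
    also have "\<dots> = c\<^sup>2 * ((\<Sum>k\<in>V \<times> V. 1 - ?A k g * ?A k g) * ?U g + (\<Sum>k\<in>V \<times> V. ?A k g * ?A k g)
           + (\<Sum>k\<in>V \<times> V. ?X k g * ?A k g) - ?U g * (\<Sum>k\<in>V \<times> V. ?A k g * ?A k g))"
      by (simp only: sum_distrib_left[symmetric] sum_distrib_right[symmetric] sum.distrib sum_subtractf)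
    also have "\<dots> = c\<^sup>2 * (((real (card V))\<^sup>2 - n\<^sup>2 * \<Lambda> g) * (n * W g) + n\<^sup>2 * \<Lambda> g
           + n ^ 3 * T g - n * W g * (n\<^sup>2 * \<Lambda> g))"
      unfolding e1 sumA sumX unfolding eU ..
    also have "\<dots> = (c\<^sup>2 * n) * n\<^sup>2 * (((real (card V) / n)\<^sup>2 - \<Lambda> g) * W g + \<Lambda> g / n + T g - W g * \<Lambda> g)"
      using n by (simp add: field_simps power2_eq_square power3_eq_cube)
    finally show "(\<Sum>k\<in>V \<times> V. c * ?D k g)
      = n\<^sup>2 * (\<beta>\<^sup>2 / 2 * (((real (card V) / n)\<^sup>2 - \<Lambda> g) * W g + \<Lambda> g / n + T g - W g * \<Lambda> g))"
      unfolding c2 by (simp add: mult_ac)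
  qed
  also have "\<dots> = n\<^sup>2 * (\<beta>\<^sup>2 / 2 * (\<integral>g. ((real (card V) / n)\<^sup>2 - \<Lambda> g) * W g + \<Lambda> g / n + T g - W g * \<Lambda> g \<partial>gauss_array))"
    by simp
  finally show ?second
    unfolding WU using n by (simp add: power_divide)
qed

lemma measure_gauss_array_UNIV [simp]: "measure (gauss_array :: ('k \<Rightarrow> real) measure) UNIV = 1"
  using gauss.prob_space[where 'k = 'k] by simp

lemma gauss_expectation_const: "(\<integral>x. a \<partial>gauss_array) = (a :: real)"
  by simp

lemma expectation_mono:
  assumes "tame F" "tame G" "\<And>x. F x \<le> G x"
  shows "(\<integral>x. F x \<partial>gauss_array) \<le> (\<integral>x. G x \<partial>gauss_array)"
  by (intro integral_mono tame_integrable assms)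

lemma abs_mult_le_weighted:
  fixes x y s :: real
  assumes "s > 0" shows "\<bar>x * y\<bar> \<le> s * x\<^sup>2 / 2 + y\<^sup>2 / (2 * s)"
proof -
  have "0 \<le> (s * \<bar>x\<bar> - \<bar>y\<bar>)\<^sup>2" by simp
  then have "2 * s * \<bar>x * y\<bar> \<le> s\<^sup>2 * x\<^sup>2 + y\<^sup>2"
    by (simp add: power2_diff power_mult_distrib abs_mult)
  then have "\<bar>x * y\<bar> \<le> (s\<^sup>2 * x\<^sup>2 + y\<^sup>2) / (2 * s)"
    using assms by (simp add: pos_le_divide_eq mult_ac)
  also have "\<dots> = s * x\<^sup>2 / 2 + y\<^sup>2 / (2 * s)"
    using assms by (simp add: add_divide_distrib power2_eq_square)
  finally show ?thesis .
qed

definition energy_bound :: "real \<Rightarrow> real" where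
  "energy_bound \<beta> = (1 + \<beta>\<^sup>2)\<^sup>2 / 2 + 4"

text \<open>The maximum of the energy over all configurations is of order \<open>n\<close>: its exponential is at most
  the sum of the exponentials, whose mean is explicit.\<close>

lemma energy_second_moment:
  assumes V: "finite V" and n: "n \<ge> 1" "real (card V) \<le> n"
  shows "(\<integral>g. gavg (\<beta> / sqrt (2 * n)) h V g (\<lambda>\<sigma>. (\<beta> / sqrt (2 * n) * pair_energy V g \<sigma> / n)\<^sup>2) \<partial>gauss_array)
     \<le> energy_bound \<beta>"
proof -
  let ?c = "\<beta> / sqrt (2 * n)"
  let ?H = "\<lambda>g \<sigma>. ?c * pair_energy V g \<sigma>"
  \<comment> \<open>The mean of \<open>?P\<close> is at most \<open>2 * ?a\<^sup>2\<close>: at most \<open>2 * 2 powr n\<close> terms, each of mean at most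
    \<open>exp (\<beta>\<^sup>2 * n)\<close>, and \<open>2 \<le> exp 1\<close>.\<close>
  let ?a = "exp (n * (1 + \<beta>\<^sup>2) / 2)"
  let ?P = "\<lambda>g. \<Sum>\<sigma>\<in>spins V. exp (2 * energy ?c 0 V g \<sigma>) + exp (-2 * energy ?c 0 V g \<sigma>)"
  have a2: "?a\<^sup>2 = exp n * exp (\<beta>\<^sup>2 * n)"
    by (simp add: power2_eq_square exp_add[symmetric] field_simps)
  have tP: "tame ?P" by (intro tame_sum tame_add tame_exp_energy V)
  have path: "gavg ?c h V g (\<lambda>\<sigma>. (?H g \<sigma> / n)\<^sup>2) \<le> (n\<^sup>2 * (1 + \<beta>\<^sup>2)\<^sup>2 / 2 + 2 * ?P g / ?a\<^sup>2) / n\<^sup>2" for g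
  proof (rule gavg_le[OF V])
    fix \<sigma> assume \<sigma>: "\<sigma> \<in> spins V"
    let ?x = "exp \<bar>?H g \<sigma>\<bar> / ?a"
    have "\<bar>?H g \<sigma>\<bar> - n * (1 + \<beta>\<^sup>2) / 2 = ln ?x"
      by (simp add: ln_div)
    also have "\<dots> \<le> ?x - 1" by (rule ln_le_minus_one) simp
    finally have "\<bar>?H g \<sigma>\<bar> \<le> n * (1 + \<beta>\<^sup>2) / 2 + ?x" by simp
    then have "\<bar>?H g \<sigma>\<bar>\<^sup>2 \<le> (n * (1 + \<beta>\<^sup>2) / 2 + ?x)\<^sup>2"
      by (intro power_mono) auto
    also have "\<dots> \<le> 2 * (n * (1 + \<beta>\<^sup>2) / 2)\<^sup>2 + 2 * ?x\<^sup>2"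
      using zero_le_power2[of "n * (1 + \<beta>\<^sup>2) / 2 - ?x"] by (simp add: power2_diff power2_sum)
    also have "2 * (n * (1 + \<beta>\<^sup>2) / 2)\<^sup>2 = n\<^sup>2 * (1 + \<beta>\<^sup>2)\<^sup>2 / 2"
      by (simp add: power_divide power_mult_distrib)
    also have "?x\<^sup>2 = exp (2 * \<bar>?H g \<sigma>\<bar>) / ?a\<^sup>2"
      by (simp only: power_divide exp_double)
    also have "exp (2 * \<bar>?H g \<sigma>\<bar>) \<le> exp (2 * ?H g \<sigma>) + exp (-2 * ?H g \<sigma>)"
      by (cases "?H g \<sigma> \<ge> 0") (simp_all add: abs_if del: times_divide_eq_left)
    also have "\<dots> \<le> ?P g"
      using \<sigma> V by (intro order_trans[OF _ member_le_sum[of \<sigma>]]) (auto simp: energy_def)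
    finally have "\<bar>?H g \<sigma>\<bar>\<^sup>2 \<le> n\<^sup>2 * (1 + \<beta>\<^sup>2)\<^sup>2 / 2 + 2 * (?P g / ?a\<^sup>2)"
      by (simp add: divide_right_mono)
    then have "(?H g \<sigma>)\<^sup>2 \<le> n\<^sup>2 * (1 + \<beta>\<^sup>2)\<^sup>2 / 2 + 2 * ?P g / ?a\<^sup>2"
      by (simp only: power2_abs times_divide_eq_right)
    then show "(?H g \<sigma> / n)\<^sup>2 \<le> (n\<^sup>2 * (1 + \<beta>\<^sup>2)\<^sup>2 / 2 + 2 * ?P g / ?a\<^sup>2) / n\<^sup>2"
      unfolding power_divide by (intro divide_right_mono) auto
  qed
  have mgf: "(\<integral>g. exp (a * energy ?c 0 V g \<sigma>) \<partial>gauss_array) \<le> exp (\<beta>\<^sup>2 * n)"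
    if \<sigma>: "\<sigma> \<in> spins V" and a: "a\<^sup>2 = 4" for \<sigma> a
  proof -
    have "a * energy ?c 0 V g \<sigma> = (\<Sum>k\<in>V \<times> V. (a * ?c * (\<sigma> (fst k) * \<sigma> (snd k))) * g k)" for g
      unfolding energy_def pair_energy_def by (simp add: sum_distrib_left mult_ac)
    then have "(\<integral>g. exp (a * energy ?c 0 V g \<sigma>) \<partial>gauss_array)
        = exp ((\<Sum>k\<in>V \<times> V. (a * ?c * (\<sigma> (fst k) * \<sigma> (snd k)))\<^sup>2) / 2)"
      using gauss_array_mgf[of "V \<times> V" "\<lambda>k. a * ?c * (\<sigma> (fst k) * \<sigma> (snd k))"] V
      by (simp only: finite_cartesian_product)
    also have "(\<Sum>k\<in>V \<times> V. (a * ?c * (\<sigma> (fst k) * \<sigma> (snd k)))\<^sup>2) = (\<Sum>k\<in>V \<times> V. a\<^sup>2 * ?c\<^sup>2)"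
    proof (intro sum.cong refl)
      fix k assume "k \<in> V \<times> V"
      then have "(\<sigma> (fst k))\<^sup>2 = 1" "(\<sigma> (snd k))\<^sup>2 = 1"
        using \<sigma> by (auto simp: power2_eq_square spins_square mem_Times_iff)
      then show "(a * ?c * (\<sigma> (fst k) * \<sigma> (snd k)))\<^sup>2 = a\<^sup>2 * ?c\<^sup>2"
        by (simp only: power_mult_distrib mult_1_right)
    qed
    also have "\<dots> = 4 * (\<beta>\<^sup>2 / (2 * n)) * (real (card V) * real (card V))"
      using n by (simp add: a coupling_power card_cartesian_product del: power_divide)
    also have "\<dots> \<le> 4 * (\<beta>\<^sup>2 / (2 * n)) * (n * n)"
      using n by (intro mult_left_mono mult_mono) auto
    also have "4 * (\<beta>\<^sup>2 / (2 * n)) * (n * n) = 2 * (\<beta>\<^sup>2 * n)"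
      using n by (simp add: field_simps)
    finally show ?thesis by simp
  qed
  have "(\<integral>g. ?P g \<partial>gauss_array) = (\<Sum>\<sigma>\<in>spins V. (\<integral>g. exp (2 * energy ?c 0 V g \<sigma>) \<partial>gauss_array)
      + (\<integral>g. exp (-2 * energy ?c 0 V g \<sigma>) \<partial>gauss_array))"
    using V by (simp only: Bochner_Integration.integral_sum Bochner_Integration.integral_add
      Bochner_Integration.integrable_add tame_integrable tame_exp_energy)
  also have "\<dots> \<le> (\<Sum>\<sigma>\<in>spins V. exp (\<beta>\<^sup>2 * n) + exp (\<beta>\<^sup>2 * n))"
    by (intro sum_mono add_mono mgf) auto
  also have "\<dots> = 2 * (2 ^ card V * exp (\<beta>\<^sup>2 * n))"
    using V by (simp add: card_spins)
  also have "\<dots> \<le> 2 * (exp n * exp (\<beta>\<^sup>2 * n))"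
  proof -
    have "(2::real) ^ card V \<le> exp 1 ^ card V"
      using exp_ge_add_one_self[of 1] by (intro power_mono) auto
    also have "\<dots> = exp (real (card V))" by (simp add: exp_of_nat_mult[symmetric])
    also have "\<dots> \<le> exp n" using n by simp
    finally show ?thesis by simp
  qed
  finally have P: "(\<integral>g. ?P g \<partial>gauss_array) \<le> 2 * ?a\<^sup>2" unfolding a2 .
  have "(\<integral>g. gavg ?c h V g (\<lambda>\<sigma>. (?H g \<sigma> / n)\<^sup>2) \<partial>gauss_array)
      \<le> (\<integral>g. (n\<^sup>2 * (1 + \<beta>\<^sup>2)\<^sup>2 / 2 + 2 * ?P g / ?a\<^sup>2) / n\<^sup>2 \<partial>gauss_array)"
  proof (rule expectation_mono[OF _ _ path])
    show "tame (\<lambda>g. gavg ?c h V g (\<lambda>\<sigma>. (?H g \<sigma> / n)\<^sup>2))"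
      by (intro tame_gavg V tame_power tame_divide_const tame_mult tame_const tame_pair_energy)
    show "tame (\<lambda>g. (n\<^sup>2 * (1 + \<beta>\<^sup>2)\<^sup>2 / 2 + 2 * ?P g / ?a\<^sup>2) / n\<^sup>2)"
      by (intro tame_divide_const tame_add tame_const tame_mult tP)
  qed
  also have "\<dots> = (n\<^sup>2 * (1 + \<beta>\<^sup>2)\<^sup>2 / 2 + 2 * (\<integral>g. ?P g \<partial>gauss_array) / ?a\<^sup>2) / n\<^sup>2"
  proof -
    have "integrable gauss_array (\<lambda>g. 2 * ?P g / ?a\<^sup>2)"
      by (intro tame_integrable tame_divide_const tame_mult tame_const tP)
    then show ?thesis
      by (simp only: Bochner_Integration.integral_divide_zero Bochner_Integration.integral_add
          gauss.integrable_const Bochner_Integration.integral_mult_right_zero gauss_expectation_const)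
  qed
  also have "\<dots> \<le> (n\<^sup>2 * (1 + \<beta>\<^sup>2)\<^sup>2 / 2 + 2 * (2 * ?a\<^sup>2) / ?a\<^sup>2) / n\<^sup>2"
    by (intro divide_right_mono add_left_mono mult_left_mono P) auto
  also have "\<dots> = (1 + \<beta>\<^sup>2)\<^sup>2 / 2 + 4 / n\<^sup>2"
    using n by (simp add: field_simps)
  also have "\<dots> \<le> energy_bound \<beta>"
    using n power_mono[of 1 n 2] unfolding energy_bound_def by (simp add: field_simps)
  finally show ?thesis .
qed

definition overlap_dev :: "real \<Rightarrow> real \<Rightarrow> real \<Rightarrow> nat set \<Rightarrow> real \<Rightarrow> (nat \<times> nat \<Rightarrow> real) \<Rightarrow> real" where
  "overlap_dev n \<beta> h V q g =
     gavg (\<beta> / sqrt (2 * n)) h V g (\<lambda>\<sigma>. gavg (\<beta> / sqrt (2 * n)) h V g (\<lambda>\<tau>. (olap n V \<sigma> \<tau> - q)\<^sup>2))"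

lemma tame_overlap_dev [intro]: "finite V \<Longrightarrow> tame (\<lambda>g. overlap_dev n \<beta> h V q g)"
  unfolding overlap_dev_def by (intro tame_gavg tame_gavg_const)

lemma overlap_dev_nonneg: "finite V \<Longrightarrow> 0 \<le> overlap_dev n \<beta> h V q g"
  unfolding overlap_dev_def by (intro gavg_ge) auto

definition energy_rate :: "real \<Rightarrow> real" where
  "energy_rate \<beta> = \<beta>\<^sup>2 / 2 * (4 * energy_bound \<beta> + 9 + 5 * (\<beta>\<^sup>2 / 2))"

text \<open>Integrating by parts once gives the mean of the energy \<open>W\<close> per site, and twice its second moment.
  When squared overlaps are replaced by \<open>q\<^sup>2\<close>, the terms with a third replica cancel and the second
  moment becomes the limit times the mean. Hence overlap concentration at the given parameters alone
  makes \<open>W\<close> concentrate.\<close>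

lemma site_energy_concentration:
  assumes V: "finite V" and n: "n \<ge> 1" "real (card V) \<le> n" "n \<le> real (card V) + 1" and q: "0 \<le> q" "q \<le> 1"
  shows "(\<integral>g. (site_energy n \<beta> h V g - \<beta>\<^sup>2 / 2 * (1 - q\<^sup>2))\<^sup>2 \<partial>gauss_array)
    \<le> energy_rate \<beta> * (sqrt (\<integral>g. overlap_dev n \<beta> h V q g \<partial>gauss_array) + 1 / n)"
proof -
  let ?c = "\<beta> / sqrt (2 * n)" and ?b = "\<beta>\<^sup>2 / 2"
  let ?A = "\<lambda>g. gavg ?c h V g" and ?AA = "\<lambda>g f. gavg ?c h V g (\<lambda>\<sigma>. gavg ?c h V g (f \<sigma>))"
  let ?H = "\<lambda>g \<sigma>. ?c * pair_energy V g \<sigma> / n"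
  let ?W = "\<lambda>g. site_energy n \<beta> h V g"
  let ?\<Lambda> = "\<lambda>g. ?AA g (\<lambda>\<sigma> \<tau>. (olap n V \<sigma> \<tau>)\<^sup>2)"
  let ?T = "\<lambda>g. ?AA g (\<lambda>\<sigma> \<tau>. ?H g \<sigma> * (olap n V \<sigma> \<tau>)\<^sup>2)"
  let ?B = "\<lambda>g. ?A g (\<lambda>\<sigma>. (?H g \<sigma>)\<^sup>2)"
  let ?\<Delta> = "\<lambda>g. ?AA g (\<lambda>\<sigma> \<tau>. ((olap n V \<sigma> \<tau>)\<^sup>2 - q\<^sup>2)\<^sup>2)"
  let ?\<rho> = "(real (card V) / n)\<^sup>2"
  let ?w = "?b * (1 - q\<^sup>2)"
  let ?\<delta> = "\<integral>g. overlap_dev n \<beta> h V q g \<partial>gauss_array"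
  \<comment> \<open>The weight in the inequality between arithmetic and geometric mean. It balances \<open>?s\<close> against
    \<open>?\<delta> / ?s \<le> ?s\<close>; the term \<open>1 / n\<close> keeps it positive and covers the errors of order \<open>1 / n\<close>.\<close>
  let ?s = "sqrt ?\<delta> + 1 / n"
  let ?Y = "\<lambda>g. (?\<rho> - ?\<Lambda> g) * ?W g + ?\<Lambda> g / n + ?T g - ?W g * ?\<Lambda> g - (1 - q\<^sup>2) * ?W g
      + ?w * ((1 - q\<^sup>2) - (?\<rho> - ?\<Lambda> g))"
  let ?D = "\<lambda>g. 2 / n * (1 + ?B g) + 3 * (?s * ?B g / 2 + ?\<Delta> g / (2 * ?s)) + 1 / n + ?w * (2 / n)
      + ?w * (?s / 2 + ?\<Delta> g / (2 * ?s))"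
  have \<delta>: "?\<delta> \<ge> 0" by (intro Bochner_Integration.integral_nonneg overlap_dev_nonneg V)
  have s: "?s > 0" using n \<delta> by (intro add_nonneg_pos) auto
  have q2: "q\<^sup>2 \<le> 1" using q by (simp add: power_le_one)
  have w: "0 \<le> ?w" "?w \<le> ?b" using q2 by (auto simp: mult_left_le)
  have tW: "tame ?W" and t\<Lambda>: "tame ?\<Lambda>" and t\<Delta>: "tame ?\<Delta>"
    using V by (auto intro: tame_gavg)
  have tT: "tame ?T"
    by (intro tame_gavg V tame_mult tame_divide_const tame_const tame_pair_energy)
  have tB: "tame ?B"
    by (intro tame_gavg V tame_mult tame_divide_const tame_const tame_pair_energy tame_power)
  have tY: "tame ?Y"
    by (intro tame_add tame_mult tame_diff tame_const tame_divide_const tW t\<Lambda> tT)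
  have tD: "tame ?D"
    by (intro tame_add tame_mult tame_divide_const tame_const tB t\<Delta>)
  note i = tame_integrable[OF tW] tame_integrable[OF t\<Lambda>] tame_integrable[OF tT]
    tame_integrable[OF tame_mult[OF tW t\<Lambda>]] tame_integrable[OF tame_mult[OF tW tW]]
    tame_integrable[OF tB] tame_integrable[OF t\<Delta>]
  have split: "?Y g = (?\<rho> - 1) * ?W g - 2 * ((?\<Lambda> g - q\<^sup>2) * ?W g) + ?\<Lambda> g / n
      + ?AA g (\<lambda>\<sigma> \<tau>. ?H g \<sigma> * ((olap n V \<sigma> \<tau>)\<^sup>2 - q\<^sup>2)) + ?w * (1 - ?\<rho>) + ?w * (?\<Lambda> g - q\<^sup>2)" for g
  proof -
    have "?AA g (\<lambda>\<sigma> \<tau>. ?H g \<sigma> * ((olap n V \<sigma> \<tau>)\<^sup>2 - q\<^sup>2)) = ?T g - q\<^sup>2 * ?W g"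
    proof -
      have "?AA g (\<lambda>\<sigma> \<tau>. ?H g \<sigma> * ((olap n V \<sigma> \<tau>)\<^sup>2 - q\<^sup>2))
          = ?AA g (\<lambda>\<sigma> \<tau>. ?H g \<sigma> * (olap n V \<sigma> \<tau>)\<^sup>2 - ?H g \<sigma> * q\<^sup>2)"
        by (simp only: right_diff_distrib)
      also have "\<dots> = ?A g (\<lambda>\<sigma>. ?A g (\<lambda>\<tau>. ?H g \<sigma> * (olap n V \<sigma> \<tau>)\<^sup>2) - ?H g \<sigma> * q\<^sup>2)"
        using gavg_const[OF V] by (simp only: gavg_linear(2))
      also have "\<dots> = ?T g - ?A g (?H g) * q\<^sup>2"
        by (simp only: gavg_linear(2,4))
      finally show ?thesis by (simp only: site_energy_def mult.commute)
    qed
    moreover have "(\<rho> - \<Lambda>) * W + \<Lambda> / n + T - W * \<Lambda> - (1 - q\<^sup>2) * W + w * ((1 - q\<^sup>2) - (\<rho> - \<Lambda>))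
        = (\<rho> - 1) * W - 2 * ((\<Lambda> - q\<^sup>2) * W) + \<Lambda> / n + (T - q\<^sup>2 * W) + w * (1 - \<rho>) + w * (\<Lambda> - q\<^sup>2)"
      for \<rho> \<Lambda> W T w :: real
      by (simp add: algebra_simps)
    ultimately show ?thesis by (simp only:)
  qed
  have path: "?Y g \<le> ?D g" for g
  proof -
    have W2: "(?W g)\<^sup>2 \<le> ?B g"
      unfolding site_energy_def by (rule gavg_square_le[OF V])
    have \<Lambda>\<Delta>: "(?\<Lambda> g - q\<^sup>2)\<^sup>2 \<le> ?\<Delta> g"
    proof -
      have "?\<Lambda> g - q\<^sup>2 = ?AA g (\<lambda>\<sigma> \<tau>. (olap n V \<sigma> \<tau>)\<^sup>2 - q\<^sup>2)"
        using gavg_const[OF V] by (simp only: gavg_linear(2))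
      then have "(?\<Lambda> g - q\<^sup>2)\<^sup>2 \<le> ?A g (\<lambda>\<sigma>. (?A g (\<lambda>\<tau>. (olap n V \<sigma> \<tau>)\<^sup>2 - q\<^sup>2))\<^sup>2)"
        by (simp only: gavg_square_le[OF V])
      also have "\<dots> \<le> ?\<Delta> g" by (intro gavg_mono V gavg_square_le)
      finally show ?thesis .
    qed
    have \<rho>: "0 \<le> 1 - ?\<rho>" "1 - ?\<rho> \<le> 2 / n"
    proof -
      have "1 - real (card V) / n = (n - real (card V)) / n" using n by (simp add: diff_divide_distrib)
      also have "\<dots> \<le> 1 / n" using n by (intro divide_right_mono) auto
      finally have r: "0 \<le> real (card V) / n" "real (card V) / n \<le> 1" "1 - real (card V) / n \<le> 1 / n"
        using n by auto
      then show "0 \<le> 1 - ?\<rho>" by (simp add: power_le_one)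
      have "1 - ?\<rho> = (1 - real (card V) / n) * (1 + real (card V) / n)"
        by (simp add: algebra_simps power2_eq_square)
      also have "\<dots> \<le> 1 / n * 2" using r n by (intro mult_mono) auto
      finally show "1 - ?\<rho> \<le> 2 / n" by simp
    qed
    have absW: "\<bar>?W g\<bar> \<le> 1 + ?B g"
      using abs_mult_le_weighted[of 1 "?W g" 1] W2 by simp
    have "\<bar>(?\<rho> - 1) * ?W g\<bar> = (1 - ?\<rho>) * \<bar>?W g\<bar>" using \<rho> by (simp add: abs_mult)
    also have "\<dots> \<le> 2 / n * (1 + ?B g)"
      using \<rho> absW n by (intro mult_mono) auto
    finally have 1: "(?\<rho> - 1) * ?W g \<le> 2 / n * (1 + ?B g)" by linarith
    have 2: "\<bar>(?\<Lambda> g - q\<^sup>2) * ?W g\<bar> \<le> ?s * ?B g / 2 + ?\<Delta> g / (2 * ?s)"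
    proof -
      have "\<bar>?W g * (?\<Lambda> g - q\<^sup>2)\<bar> \<le> ?s * (?W g)\<^sup>2 / 2 + (?\<Lambda> g - q\<^sup>2)\<^sup>2 / (2 * ?s)"
        by (rule abs_mult_le_weighted[OF s])
      also have "\<dots> \<le> ?s * ?B g / 2 + ?\<Delta> g / (2 * ?s)"
        using s W2 \<Lambda>\<Delta> by (intro add_mono divide_right_mono mult_left_mono) auto
      finally show ?thesis by (simp only: mult.commute)
    qed
    have 3: "?\<Lambda> g / n \<le> 1 / n"
      using n V by (intro divide_right_mono gavg_le) (auto simp: abs_square_le_1 abs_olap_le)
    have 4: "?AA g (\<lambda>\<sigma> \<tau>. ?H g \<sigma> * ((olap n V \<sigma> \<tau>)\<^sup>2 - q\<^sup>2)) \<le> ?s * ?B g / 2 + ?\<Delta> g / (2 * ?s)"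
    proof -
      have "?AA g (\<lambda>\<sigma> \<tau>. ?H g \<sigma> * ((olap n V \<sigma> \<tau>)\<^sup>2 - q\<^sup>2))
          \<le> ?AA g (\<lambda>\<sigma> \<tau>. ?s * (?H g \<sigma>)\<^sup>2 / 2 + ((olap n V \<sigma> \<tau>)\<^sup>2 - q\<^sup>2)\<^sup>2 / (2 * ?s))"
        by (intro gavg_mono V order_trans[OF abs_ge_self abs_mult_le_weighted[OF s]])
      also have "\<dots> = ?s * ?B g / 2 + ?\<Delta> g / (2 * ?s)"
        by (simp only: gavg_linear(1,3,5) gavg_const[OF V])
      finally show ?thesis .
    qed
    have 5: "?w * (1 - ?\<rho>) \<le> ?w * (2 / n)" using \<rho> w by (intro mult_left_mono) auto
    have 6: "?w * (?\<Lambda> g - q\<^sup>2) \<le> ?w * (?s / 2 + ?\<Delta> g / (2 * ?s))"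
    proof (intro mult_left_mono w)
      have "\<bar>1 * (?\<Lambda> g - q\<^sup>2)\<bar> \<le> ?s * 1\<^sup>2 / 2 + (?\<Lambda> g - q\<^sup>2)\<^sup>2 / (2 * ?s)"
        by (rule abs_mult_le_weighted[OF s])
      also have "\<dots> \<le> ?s / 2 + ?\<Delta> g / (2 * ?s)"
        using s \<Lambda>\<Delta> by (intro add_mono divide_right_mono) auto
      finally show "?\<Lambda> g - q\<^sup>2 \<le> ?s / 2 + ?\<Delta> g / (2 * ?s)"
        unfolding mult_1_left by (rule order_trans[OF abs_ge_self])
    qed
    have "x1 - 2 * x2 + x3 + x4 + x5 + x6 \<le> d1 + 3 * e + d2 + d3 + d4"
      if "x1 \<le> d1" "\<bar>x2\<bar> \<le> e" "x3 \<le> d2" "x4 \<le> e" "x5 \<le> d3" "x6 \<le> d4" for x1 x2 x3 x4 x5 x6 d1 d2 d3 d4 e :: real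
      using that by linarith
    from this[OF 1 2 3 4 5 6] show ?thesis unfolding split .
  qed
  have Evar: "(\<integral>g. (?W g - ?w)\<^sup>2 \<partial>gauss_array) = ?b * (\<integral>g. ?Y g \<partial>gauss_array)"
  proof -
    have m: "(\<integral>g. ?W g \<partial>gauss_array) = ?b * (\<integral>g. (?\<rho> - ?\<Lambda> g) \<partial>gauss_array)"
      "(\<integral>g. (?W g)\<^sup>2 \<partial>gauss_array) =
        ?b * (\<integral>g. ((?\<rho> - ?\<Lambda> g) * ?W g + ?\<Lambda> g / n + ?T g - ?W g * ?\<Lambda> g) \<partial>gauss_array)"
      using site_energy_moments[OF V, of n \<beta> h] n by simp_all
    have W2: "integrable gauss_array (\<lambda>g. (?W g)\<^sup>2)" by (intro tame_integrable tame_power tW)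
    have "(\<integral>g. (?W g - ?w)\<^sup>2 \<partial>gauss_array) = (\<integral>g. (?W g)\<^sup>2 - (2 * ?w) * ?W g + ?w\<^sup>2 \<partial>gauss_array)"
      by (intro Bochner_Integration.integral_cong refl) (simp add: power2_diff mult_ac)
    also have "\<dots> = (\<integral>g. (?W g)\<^sup>2 \<partial>gauss_array) - (2 * ?w) * (\<integral>g. ?W g \<partial>gauss_array) + ?w\<^sup>2"
      using W2 i(1) by (simp add: gauss_expectation_const)
    also have "\<dots> = ?b * ((\<integral>g. ((?\<rho> - ?\<Lambda> g) * ?W g + ?\<Lambda> g / n + ?T g - ?W g * ?\<Lambda> g) \<partial>gauss_array)
        - (1 - q\<^sup>2) * (\<integral>g. ?W g \<partial>gauss_array) + ?w * ((1 - q\<^sup>2) - (\<integral>g. (?\<rho> - ?\<Lambda> g) \<partial>gauss_array)))"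
    proof -
      have "b * X - 2 * (b * u) * EW + (b * u)\<^sup>2 = b * (X - u * EW + b * u * (u - R))"
        if "EW = b * R" for b X u EW R :: real
        unfolding that by (simp add: algebra_simps power2_eq_square)
      from this[OF m(1)] show ?thesis unfolding m(2) .
    qed
    also have "\<dots> = ?b * (\<integral>g. ?Y g \<partial>gauss_array)"
    proof -
      have i1: "integrable gauss_array (\<lambda>g. ((?\<rho> - ?\<Lambda> g) * ?W g + ?\<Lambda> g / n + ?T g - ?W g * ?\<Lambda> g))"
        by (intro tame_integrable tame_add tame_mult tame_diff tame_const tame_divide_const tW t\<Lambda> tT)
      have i2: "integrable gauss_array (\<lambda>g. ?\<rho> - ?\<Lambda> g)"
        by (intro tame_integrable tame_diff tame_const t\<Lambda>)
      have lin: "(\<integral>g. X1 g - u * X2 g + v * (u - X3 g) \<partial>gauss_array)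
          = (\<integral>g. X1 g \<partial>gauss_array) - u * (\<integral>g. X2 g \<partial>gauss_array) + v * (u - (\<integral>g. X3 g \<partial>gauss_array))"
        if "integrable gauss_array X1" "integrable gauss_array X2" "integrable gauss_array X3"
        for X1 X2 X3 :: "(nat \<times> nat \<Rightarrow> real) \<Rightarrow> real" and u v :: real
        using that by simp
      have "(\<integral>g. ?Y g \<partial>gauss_array)
        = (\<integral>g. ((?\<rho> - ?\<Lambda> g) * ?W g + ?\<Lambda> g / n + ?T g - ?W g * ?\<Lambda> g) \<partial>gauss_array)
          - (1 - q\<^sup>2) * (\<integral>g. ?W g \<partial>gauss_array) + ?w * ((1 - q\<^sup>2) - (\<integral>g. (?\<rho> - ?\<Lambda> g) \<partial>gauss_array))"
        by (rule lin[OF i1 i(1) i2])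
      then show ?thesis by (simp only:)
    qed
    finally show ?thesis .
  qed
  have E\<Delta>: "(\<integral>g. ?\<Delta> g \<partial>gauss_array) \<le> 4 * ?\<delta>"
  proof -
    have "?\<Delta> g \<le> 4 * overlap_dev n \<beta> h V q g" for g
    proof -
      have "?\<Delta> g \<le> ?AA g (\<lambda>\<sigma> \<tau>. 4 * (olap n V \<sigma> \<tau> - q)\<^sup>2)"
      proof (intro gavg_mono V)
        fix \<sigma> \<tau> assume "\<sigma> \<in> spins V" "\<tau> \<in> spins V"
        then have "\<bar>olap n V \<sigma> \<tau>\<bar> \<le> 1" using abs_olap_le[OF V] n by simp
        then have "\<bar>olap n V \<sigma> \<tau> + q\<bar>\<^sup>2 \<le> 2\<^sup>2" using q by (intro power_mono) auto
        then have "(olap n V \<sigma> \<tau> + q)\<^sup>2 * (olap n V \<sigma> \<tau> - q)\<^sup>2 \<le> 4 * (olap n V \<sigma> \<tau> - q)\<^sup>2"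
          by (intro mult_right_mono) auto
        then show "((olap n V \<sigma> \<tau>)\<^sup>2 - q\<^sup>2)\<^sup>2 \<le> 4 * (olap n V \<sigma> \<tau> - q)\<^sup>2"
          by (simp add: power_mult_distrib[symmetric] square_diff_square_factored[symmetric] power2_eq_square[symmetric])
      qed
      then show ?thesis unfolding overlap_dev_def by (simp only: gavg_linear(3))
    qed
    then have "(\<integral>g. ?\<Delta> g \<partial>gauss_array) \<le> (\<integral>g. 4 * overlap_dev n \<beta> h V q g \<partial>gauss_array)"
      using V by (intro expectation_mono t\<Delta> tame_mult tame_const tame_overlap_dev) auto
    then show ?thesis by simp
  qed
  have EB: "(\<integral>g. ?B g \<partial>gauss_array) \<le> energy_bound \<beta>"
    using energy_second_moment[OF V n(1,2)] by simp
  have "(\<integral>g. ?D g \<partial>gauss_array) = 2 / n * (1 + (\<integral>g. ?B g \<partial>gauss_array))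
      + 3 * (?s * (\<integral>g. ?B g \<partial>gauss_array) / 2 + (\<integral>g. ?\<Delta> g \<partial>gauss_array) / (2 * ?s)) + 1 / n + ?w * (2 / n)
      + ?w * (?s / 2 + (\<integral>g. ?\<Delta> g \<partial>gauss_array) / (2 * ?s))"
    using i(6,7) by (simp add: gauss_expectation_const)
  also have "\<dots> \<le> (4 * energy_bound \<beta> + 9 + 5 * ?b) * ?s"
  proof -
    have arith: "2 / n * (1 + B) + 3 * (s * B / 2 + D / (2 * s)) + 1 / n + w * (2 / n) + w * (s / 2 + D / (2 * s))
        \<le> (4 * K + 9 + 5 * b) * s"
      if s: "s > 0" and ns: "1 / n \<le> s" and B: "0 \<le> B" "B \<le> K" and D: "0 \<le> D" "D \<le> 4 * s\<^sup>2" and w: "0 \<le> w" "w \<le> b"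
      for s B D w K b :: real
    proof -
      have "D / (2 * s) \<le> 4 * s\<^sup>2 / (2 * s)" using D s by (intro divide_right_mono) auto
      also have "\<dots> = 2 * s" using s by (simp add: power2_eq_square)
      finally have D': "D / (2 * s) \<le> 2 * s" "0 \<le> D / (2 * s)" using D s by auto
      have ns2: "2 / n \<le> 2 * s" "0 \<le> 2 / n" using ns n by auto
      have 1: "2 / n * (1 + B) \<le> 2 * s * (1 + K)" using ns2 B s by (intro mult_mono) auto
      have 2: "s * B \<le> s * K" using s B by (intro mult_left_mono) auto
      have 3: "w * (2 / n) \<le> b * (2 * s)" using ns2 w s by (intro mult_mono) auto
      have 4: "w * (s / 2 + D / (2 * s)) \<le> b * (s / 2 + 2 * s)" using D' w s by (intro mult_mono add_mono) auto
      have 5: "0 \<le> s * K" "0 \<le> s * b" using s B w by auto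
      have "2 * s * (1 + K) + 3 * (s * K / 2 + 2 * s) + s + b * (2 * s) + b * (s / 2 + 2 * s) \<le> (4 * K + 9 + 5 * b) * s"
        using 5 by (simp add: algebra_simps)
      moreover have "x1 + 3 * (x2 / 2 + x3) + x4 + x5 + x6 \<le> y1 + 3 * (y2 / 2 + y3) + y4 + y5 + y6"
        if "x1 \<le> y1" "x2 \<le> y2" "x3 \<le> y3" "x4 \<le> y4" "x5 \<le> y5" "x6 \<le> y6"
        for x1 x2 x3 x4 x5 x6 y1 y2 y3 y4 y5 y6 :: real
        using that by (intro add_mono mult_left_mono divide_right_mono) auto
      from this[OF 1 2 D'(1) ns 3 4] calculation show ?thesis by (rule order_trans)
    qed
    have "?\<delta> = (sqrt ?\<delta>)\<^sup>2" using \<delta> by simp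
    also have "\<dots> \<le> ?s\<^sup>2" using \<delta> n by (intro power_mono) auto
    finally have D: "(\<integral>g. ?\<Delta> g \<partial>gauss_array) \<le> 4 * ?s\<^sup>2" using E\<Delta> by linarith
    have "1 / n \<le> ?s" using \<delta> by simp
    moreover have "0 \<le> (\<integral>g. ?\<Delta> g \<partial>gauss_array)" "0 \<le> (\<integral>g. ?B g \<partial>gauss_array)"
      using V by (auto intro!: Bochner_Integration.integral_nonneg gavg_ge)
    ultimately show ?thesis by (intro arith s EB D w)
  qed
  finally have "(\<integral>g. ?D g \<partial>gauss_array) \<le> (4 * energy_bound \<beta> + 9 + 5 * ?b) * ?s" .
  then have "(\<integral>g. ?Y g \<partial>gauss_array) \<le> (4 * energy_bound \<beta> + 9 + 5 * ?b) * ?s"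
    using expectation_mono[OF tY tD path] by linarith
  then show ?thesis
    unfolding Evar energy_rate_def by (simp only: mult.assoc) (intro mult_left_mono; simp)
qed

section \<open>Averages of exponentials of a Gaussian field\<close>

lemma abs_exp_minus_one_le: "\<bar>exp x - 1\<bar> \<le> \<bar>x\<bar> * exp \<bar>x\<bar>" for x :: real
proof (cases "x \<ge> 0")
  case True
  have "exp x * (1 - x) \<le> exp x * exp (- x)"
    using exp_ge_add_one_self[of "- x"] by (intro mult_left_mono) auto
  then have "exp x - 1 \<le> x * exp x" by (simp add: exp_add[symmetric] algebra_simps)
  then show ?thesis using True by simp
next
  case False
  have "1 - exp x \<le> - x" using exp_ge_add_one_self[of x] by linarith
  also have "\<dots> \<le> \<bar>x\<bar> * exp \<bar>x\<bar>"
    using False mult_left_mono[of 1 "exp (- x)" "- x"] by simp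
  finally show ?thesis using False by simp
qed

lemma abs_ln_le:
  fixes r d :: real
  assumes "exp (- d) \<le> r" "d \<ge> 0"
  shows "\<bar>ln r\<bar> \<le> exp d * \<bar>r - 1\<bar>"
proof -
  have r: "r > 0" using assms(1) by (rule less_le_trans[OF exp_gt_zero])
  show ?thesis
  proof (cases "r \<ge> 1")
    case True
    have "ln r \<le> 1 * (r - 1)" using ln_le_minus_one[OF r] by simp
    also have "\<dots> \<le> exp d * (r - 1)" using True assms(2) by (intro mult_right_mono) auto
    finally show ?thesis using True by simp
  next
    case False
    have "inverse r \<le> exp d"
      using assms(1) le_imp_inverse_le[of "exp (- d)" r] by (simp add: exp_minus)
    have "- ln r \<le> inverse r - 1"
      using ln_le_minus_one[of "inverse r"] r by (simp add: ln_inverse)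
    also have "\<dots> = inverse r * (1 - r)" using r by (simp add: field_simps)
    also have "\<dots> \<le> exp d * (1 - r)"
      using False \<open>inverse r \<le> exp d\<close> by (intro mult_right_mono) auto
    finally show ?thesis using False r by simp
  qed
qed

text \<open>Makes the law of a centered Gaussian variable continuous in its variance, also at variance \<open>0\<close>.\<close>

lemma sqrt_diff_square_le:
  fixes x y :: real
  assumes "x \<ge> 0" "y \<ge> 0" shows "(sqrt x - sqrt y)\<^sup>2 \<le> \<bar>x - y\<bar>"
proof -
  have "(sqrt x - sqrt y)\<^sup>2 = \<bar>sqrt x - sqrt y\<bar> * \<bar>sqrt x - sqrt y\<bar>"
    by (simp add: power2_eq_square)
  also have "\<dots> \<le> \<bar>sqrt x - sqrt y\<bar> * (sqrt x + sqrt y)"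
    using real_sqrt_ge_zero[OF assms(1)] real_sqrt_ge_zero[OF assms(2)]
    by (intro mult_left_mono) (auto simp: abs_le_iff)
  also have "\<dots> = \<bar>(sqrt x - sqrt y) * (sqrt x + sqrt y)\<bar>"
    using assms by (simp add: abs_mult)
  also have "\<dots> = \<bar>x - y\<bar>"
    using assms by (simp add: algebra_simps)
  finally show ?thesis .
qed

lemma tame_linear_form [intro]: "tame (\<lambda>y. \<Sum>k\<in>J. a k * y k)"
  by (intro tame_sum tame_mult tame_const tame_coordinate)

lemma tame_exp_linear_form: "finite J \<Longrightarrow> tame (\<lambda>y. exp (\<Sum>k\<in>J. a k * y k))"
  using tame_exp_linear[of J 0 a] by simp

text \<open>A Gaussian field on a finite set of configurations, given by the coefficient vectors of its linear
  forms. The average over configurations is independent of the Gaussian variables. The numbers \<open>b\<close> and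
  \<open>b * q\<close> are the target values of the variance and of the covariance of two typical
  configurations; \<open>spread\<close> measures the distance from them.\<close>

locale gaussian_field = positive_weights S p for S :: "'s set" and p :: "'s \<Rightarrow> real" +
  fixes J :: "'k set" and a :: "'s \<Rightarrow> 'k \<Rightarrow> real" and b q v :: real
  assumes J: "finite J" and q: "0 \<le> q" "q \<le> 1"
    and self: "\<And>\<sigma>. \<sigma> \<in> S \<Longrightarrow> (\<Sum>k\<in>J. a \<sigma> k * a \<sigma> k) = v"
    and cov_le: "\<And>\<sigma> \<tau>. \<sigma> \<in> S \<Longrightarrow> \<tau> \<in> S \<Longrightarrow> \<bar>\<Sum>k\<in>J. a \<sigma> k * a \<tau> k\<bar> \<le> b"
begin

abbreviation "av \<equiv> wavg S p"

definition cov :: "'s \<Rightarrow> 's \<Rightarrow> real" where "cov \<sigma> \<tau> = (\<Sum>k\<in>J. a \<sigma> k * a \<tau> k)"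

definition center :: "'k \<Rightarrow> real" where "center k = av (\<lambda>\<sigma>. a \<sigma> k)"

definition field :: "('k \<Rightarrow> real) \<Rightarrow> 's \<Rightarrow> real" where "field y \<sigma> = (\<Sum>k\<in>J. a \<sigma> k * y k)"

definition mean_field :: "('k \<Rightarrow> real) \<Rightarrow> real" where "mean_field y = av (field y)"

definition mean_cov :: real where "mean_cov = av (\<lambda>\<sigma>. av (\<lambda>\<tau>. cov \<sigma> \<tau>))"

definition spread :: real where "spread = av (\<lambda>\<sigma>. av (\<lambda>\<tau>. \<bar>cov \<sigma> \<tau> - b * q\<bar>)) + \<bar>v - b\<bar>"

lemma b_nonneg: "0 \<le> b"
  using ne cov_le by (metis abs_ge_zero ex_in_conv order_trans)

lemma bq: "0 \<le> b * q" "b * q \<le> b"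
  using b_nonneg q by (auto simp: mult_left_le)

lemma abs_cov: "\<sigma> \<in> S \<Longrightarrow> \<tau> \<in> S \<Longrightarrow> \<bar>cov \<sigma> \<tau>\<bar> \<le> b"
  unfolding cov_def by (rule cov_le)

lemma v_bounds: "0 \<le> v" "v \<le> b"
proof -
  obtain \<sigma> where \<sigma>: "\<sigma> \<in> S" using ne by blast
  then have v: "v = (\<Sum>k\<in>J. (a \<sigma> k)\<^sup>2)" using self[of \<sigma>] by (simp add: power2_eq_square)
  show "0 \<le> v" unfolding v by (intro sum_nonneg) auto
  show "v \<le> b" using cov_le[OF \<sigma> \<sigma>] self[OF \<sigma>] by linarith
qed

lemma mean_field_linear: "mean_field y = (\<Sum>k\<in>J. center k * y k)"
  unfolding mean_field_def field_def center_def by (simp add: wavg_sum wavg_multc)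

lemma cov_center: "(\<Sum>k\<in>J. a \<sigma> k * center k) = av (cov \<sigma>)"
proof -
  have "av (cov \<sigma>) = av (\<lambda>\<tau>. \<Sum>k\<in>J. a \<sigma> k * a \<tau> k)" unfolding cov_def ..
  then show ?thesis unfolding center_def by (simp add: wavg_sum wavg_cmult)
qed

lemma center_center: "(\<Sum>k\<in>J. center k * center k) = mean_cov"
proof -
  have "mean_cov = av (\<lambda>\<sigma>. \<Sum>k\<in>J. a \<sigma> k * center k)"
    unfolding mean_cov_def cov_center ..
  then show ?thesis unfolding center_def by (simp add: wavg_sum wavg_multc)
qed

lemma mean_cov_nonneg: "0 \<le> mean_cov"
  unfolding center_center[symmetric] by (intro sum_nonneg) simp

lemma av_cov_dev: "\<bar>av (cov \<sigma>) - b * q\<bar> \<le> av (\<lambda>\<tau>. \<bar>cov \<sigma> \<tau> - b * q\<bar>)"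
  using wavg_abs[of "\<lambda>\<tau>. cov \<sigma> \<tau> - b * q"] by (simp add: wavg_diff wavg_const)

lemma mean_cov_dev_le: "\<bar>mean_cov - b * q\<bar> \<le> av (\<lambda>\<sigma>. av (\<lambda>\<tau>. \<bar>cov \<sigma> \<tau> - b * q\<bar>))"
proof -
  have "\<bar>mean_cov - b * q\<bar> \<le> av (\<lambda>\<sigma>. \<bar>av (cov \<sigma>) - b * q\<bar>)"
    using wavg_abs[of "\<lambda>\<sigma>. av (cov \<sigma>) - b * q"] by (simp add: wavg_diff wavg_const mean_cov_def)
  also have "\<dots> \<le> av (\<lambda>\<sigma>. av (\<lambda>\<tau>. \<bar>cov \<sigma> \<tau> - b * q\<bar>))"
    by (intro wavg_mono av_cov_dev)
  finally show ?thesis .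
qed

lemma mean_cov_dev: "\<bar>mean_cov - b * q\<bar> \<le> spread"
  using mean_cov_dev_le unfolding spread_def by simp

text \<open>If \<open>spread\<close> is small, most pairs of configurations have covariance close to \<open>b * q\<close>, so the field is nearly its
  mean plus independent noise of variance \<open>b * (1 - q)\<close> at each configuration, and the average of
  its exponential self-averages.\<close>

definition exp_ratio :: "('k \<Rightarrow> real) \<Rightarrow> real" where
  "exp_ratio y = av (\<lambda>\<sigma>. exp (field y \<sigma>)) * exp (- mean_field y - b * (1 - q) / 2)"

text \<open>Both moments of the ratio are averages of exponentials of quadratic forms, whose exponents vanish
  when all covariances take their target values.\<close>

lemma exp_ratio_second_moment: "(\<integral>y. (exp_ratio y - 1)\<^sup>2 \<partial>gauss_array) \<le> 11 * exp (15 * b) * spread"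
proof -
  let ?c = "b * (1 - q) / 2"
  define e1 where "e1 \<sigma> = (v - b) / 2 - (av (cov \<sigma>) - b * q) + (mean_cov - b * q) / 2" for \<sigma>
  define e2 where "e2 \<sigma> \<tau> = (v - b) + (cov \<sigma> \<tau> - b * q) - 2 * (av (cov \<sigma>) - b * q)
      - 2 * (av (cov \<tau>) - b * q) + 2 * (mean_cov - b * q)" for \<sigma> \<tau>
  let ?l1 = "\<lambda>\<sigma> k. a \<sigma> k - center k" and ?l2 = "\<lambda>\<sigma> \<tau> k. a \<sigma> k + a \<tau> k - 2 * center k"
  have f1: "exp_ratio y = av (\<lambda>\<sigma>. exp (- ?c) * exp (\<Sum>k\<in>J. ?l1 \<sigma> k * y k))" for y
    unfolding exp_ratio_def wavg_multc[symmetric] mean_field_linear field_def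
    by (intro wavg_cong) (simp add: exp_add[symmetric] sum_subtractf left_diff_distrib)
  have f2: "(exp_ratio y)\<^sup>2 = av (\<lambda>\<sigma>. av (\<lambda>\<tau>. exp (- 2 * ?c) * exp (\<Sum>k\<in>J. ?l2 \<sigma> \<tau> k * y k)))" for y
    unfolding power2_eq_square f1 wavg_product
    by (intro wavg_cong)
       (simp add: exp_add[symmetric] sum_subtractf left_diff_distrib sum.distrib distrib_right sum_distrib_left mult.assoc sum_negf)
  have t1: "tame (\<lambda>y. exp (- ?c) * exp (\<Sum>k\<in>J. ?l1 \<sigma> k * y k))" for \<sigma>
    by (intro tame_mult tame_const tame_exp_linear_form J)
  have t2: "tame (\<lambda>y. exp (- 2 * ?c) * exp (\<Sum>k\<in>J. ?l2 \<sigma> \<tau> k * y k))" for \<sigma> \<tau>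
    by (intro tame_mult tame_const tame_exp_linear_form J)
  have tame_av: "tame (\<lambda>y. av (\<lambda>\<sigma>. f y \<sigma>))" if "\<And>\<sigma>. tame (\<lambda>y. f y \<sigma>)" for f :: "('k \<Rightarrow> real) \<Rightarrow> 's \<Rightarrow> real"
    unfolding wavg_def by (intro tame_divide_const tame_sum tame_mult tame_const that)
  have E_av: "(\<integral>y. av (\<lambda>\<sigma>. f y \<sigma>) \<partial>gauss_array) = av (\<lambda>\<sigma>. \<integral>y. f y \<sigma> \<partial>gauss_array)"
    if "\<And>\<sigma>. tame (\<lambda>y. f y \<sigma>)" for f :: "('k \<Rightarrow> real) \<Rightarrow> 's \<Rightarrow> real"
    unfolding wavg_def by (simp add: tame_integrable[OF that] tame_integrable[OF tame_mult[OF tame_const that]])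
  have s1: "(\<Sum>k\<in>J. (?l1 \<sigma> k)\<^sup>2) / 2 - ?c = e1 \<sigma>" if "\<sigma> \<in> S" for \<sigma>
  proof -
    have "(\<Sum>k\<in>J. (?l1 \<sigma> k)\<^sup>2) = (\<Sum>k\<in>J. a \<sigma> k * a \<sigma> k) - 2 * (\<Sum>k\<in>J. a \<sigma> k * center k) + (\<Sum>k\<in>J. center k * center k)"
      unfolding sum_distrib_left sum.distrib[symmetric] sum_subtractf[symmetric]
      by (intro sum.cong refl) (simp add: power2_eq_square algebra_simps)
    then show ?thesis
      unfolding self[OF that] cov_center center_center e1_def by (simp add: field_simps)
  qed
  have s2: "(\<Sum>k\<in>J. (?l2 \<sigma> \<tau> k)\<^sup>2) / 2 - 2 * ?c = e2 \<sigma> \<tau>" if "\<sigma> \<in> S" "\<tau> \<in> S" for \<sigma> \<tau>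
  proof -
    have "(\<Sum>k\<in>J. (?l2 \<sigma> \<tau> k)\<^sup>2) = (\<Sum>k\<in>J. a \<sigma> k * a \<sigma> k) + (\<Sum>k\<in>J. a \<tau> k * a \<tau> k) + 2 * cov \<sigma> \<tau>
       - 4 * (\<Sum>k\<in>J. a \<sigma> k * center k) - 4 * (\<Sum>k\<in>J. a \<tau> k * center k) + 4 * (\<Sum>k\<in>J. center k * center k)"
      unfolding cov_def sum_distrib_left sum.distrib[symmetric] sum_subtractf[symmetric]
      by (intro sum.cong refl) (simp add: power2_eq_square algebra_simps)
    then show ?thesis
      unfolding self[OF that(1)] self[OF that(2)] cov_center center_center e2_def by (simp add: field_simps)
  qed
  have E1: "(\<integral>y. exp_ratio y \<partial>gauss_array) = av (\<lambda>\<sigma>. exp (e1 \<sigma>))"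
    unfolding f1 E_av[OF t1]
    by (intro wavg_cong)
       (simp only: Bochner_Integration.integral_mult_right_zero gauss_array_mgf[OF J] s1[symmetric],
        simp add: exp_add[symmetric])
  have E2: "(\<integral>y. (exp_ratio y)\<^sup>2 \<partial>gauss_array) = av (\<lambda>\<sigma>. av (\<lambda>\<tau>. exp (e2 \<sigma> \<tau>)))"
    unfolding f2 E_av[OF tame_av[OF t2]] E_av[OF t2]
    by (intro wavg_cong)
       (simp only: Bochner_Integration.integral_mult_right_zero gauss_array_mgf[OF J] s2[symmetric],
        simp add: exp_add[symmetric])
  have avc: "\<bar>av (cov \<sigma>)\<bar> \<le> b" if "\<sigma> \<in> S" for \<sigma>
    by (intro wavg_abs_le abs_cov that)
  have mc: "\<bar>mean_cov\<bar> \<le> b" unfolding mean_cov_def by (intro wavg_abs_le avc)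
  \<comment> \<open>All covariances lie in \<open>[-b, b]\<close>, so the exponents are bounded and \<open>exp\<close> is Lipschitz there.\<close>
  have be1: "\<bar>e1 \<sigma>\<bar> \<le> 15 * b" if "\<sigma> \<in> S" for \<sigma>
    unfolding e1_def using avc[OF that] mc bq v_bounds b_nonneg by (simp add: abs_le_iff field_simps)
  have be2: "\<bar>e2 \<sigma> \<tau>\<bar> \<le> 15 * b" if "\<sigma> \<in> S" "\<tau> \<in> S" for \<sigma> \<tau>
    unfolding e2_def using avc[OF that(1)] avc[OF that(2)] abs_cov[OF that] mc bq v_bounds b_nonneg
    by (simp add: abs_le_iff field_simps)
  have ex: "\<bar>exp x - 1\<bar> \<le> exp (15 * b) * \<bar>x\<bar>" if "\<bar>x\<bar> \<le> 15 * b" for x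
  proof -
    have "\<bar>x\<bar> * exp \<bar>x\<bar> \<le> \<bar>x\<bar> * exp (15 * b)" using that by (intro mult_left_mono) auto
    then show ?thesis using abs_exp_minus_one_le[of x] by (simp add: mult.commute)
  qed
  let ?d = "av (\<lambda>\<sigma>. av (\<lambda>\<tau>. \<bar>cov \<sigma> \<tau> - b * q\<bar>))"
  let ?G = "\<lambda>\<sigma>. av (\<lambda>\<tau>. \<bar>cov \<sigma> \<tau> - b * q\<bar>)"
  have tri1: "\<bar>x / 2 - y + z / 2\<bar> \<le> \<bar>x\<bar> / 2 + G + D / 2" if "\<bar>y\<bar> \<le> G" "\<bar>z\<bar> \<le> D" for x y z G D :: real
    using that by linarith
  have tri2: "\<bar>x + u - 2 * y1 - 2 * y2 + 2 * z\<bar> \<le> \<bar>x\<bar> + \<bar>u\<bar> + 2 * G1 + 2 * G2 + 2 * D"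
    if "\<bar>y1\<bar> \<le> G1" "\<bar>y2\<bar> \<le> G2" "\<bar>z\<bar> \<le> D" for x u y1 y2 z G1 G2 D :: real
    using that by linarith
  have tri3: "\<bar>x\<bar> / 2 + D + D / 2 \<le> 2 * (D + \<bar>x\<bar>)" if "0 \<le> D" for x D :: real
    using that by argo
  have tri4: "\<bar>x\<bar> + D + 2 * D + 2 * D + 2 * D \<le> 7 * (D + \<bar>x\<bar>)" if "0 \<le> D" for x D :: real
    using that by argo
  have d0: "0 \<le> ?d" by (intro wavg_ge) auto
  have d1: "av (\<lambda>\<sigma>. \<bar>e1 \<sigma>\<bar>) \<le> 2 * spread"
  proof -
    have "av (\<lambda>\<sigma>. \<bar>e1 \<sigma>\<bar>) \<le> av (\<lambda>\<sigma>. \<bar>v - b\<bar> / 2 + ?G \<sigma> + ?d / 2)"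
    proof (intro wavg_mono)
      fix \<sigma>
      show "\<bar>e1 \<sigma>\<bar> \<le> \<bar>v - b\<bar> / 2 + ?G \<sigma> + ?d / 2"
        unfolding e1_def by (rule tri1[OF av_cov_dev mean_cov_dev_le])
    qed
    also have "\<dots> = \<bar>v - b\<bar> / 2 + ?d + ?d / 2" by (simp only: wavg_add wavg_const)
    also have "\<dots> \<le> 2 * spread" unfolding spread_def by (rule tri3[OF d0])
    finally show ?thesis .
  qed
  have d2: "av (\<lambda>\<sigma>. av (\<lambda>\<tau>. \<bar>e2 \<sigma> \<tau>\<bar>)) \<le> 7 * spread"
  proof -
    have "av (\<lambda>\<sigma>. av (\<lambda>\<tau>. \<bar>e2 \<sigma> \<tau>\<bar>)) \<le> av (\<lambda>\<sigma>. av (\<lambda>\<tau>. \<bar>v - b\<bar> + \<bar>cov \<sigma> \<tau> - b * q\<bar> + 2 * ?G \<sigma> + 2 * ?G \<tau> + 2 * ?d))"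
    proof (intro wavg_mono)
      fix \<sigma> \<tau>
      show "\<bar>e2 \<sigma> \<tau>\<bar> \<le> \<bar>v - b\<bar> + \<bar>cov \<sigma> \<tau> - b * q\<bar> + 2 * ?G \<sigma> + 2 * ?G \<tau> + 2 * ?d"
        unfolding e2_def by (rule tri2[OF av_cov_dev av_cov_dev mean_cov_dev_le])
    qed
    also have "\<dots> = \<bar>v - b\<bar> + ?d + 2 * ?d + 2 * ?d + 2 * ?d" by (simp only: wavg_add wavg_const wavg_cmult)
    also have "\<dots> \<le> 7 * spread" unfolding spread_def by (rule tri4[OF d0])
    finally show ?thesis .
  qed
  have "\<bar>av (\<lambda>\<sigma>. exp (e1 \<sigma>)) - 1\<bar> \<le> av (\<lambda>\<sigma>. \<bar>exp (e1 \<sigma>) - 1\<bar>)"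
    using wavg_abs[of "\<lambda>\<sigma>. exp (e1 \<sigma>) - 1"] by (simp add: wavg_diff wavg_const)
  also have "\<dots> \<le> av (\<lambda>\<sigma>. exp (15 * b) * \<bar>e1 \<sigma>\<bar>)" by (intro wavg_mono ex be1)
  also have "\<dots> \<le> exp (15 * b) * (2 * spread)" unfolding wavg_cmult by (intro mult_left_mono d1) auto
  finally have 1: "\<bar>av (\<lambda>\<sigma>. exp (e1 \<sigma>)) - 1\<bar> \<le> exp (15 * b) * (2 * spread)" .
  have "av (\<lambda>\<sigma>. av (\<lambda>\<tau>. exp (e2 \<sigma> \<tau>))) - 1 = av (\<lambda>\<sigma>. av (\<lambda>\<tau>. exp (e2 \<sigma> \<tau>) - 1))"
    by (simp add: wavg_diff wavg_const)
  also have "\<dots> \<le> av (\<lambda>\<sigma>. av (\<lambda>\<tau>. exp (15 * b) * \<bar>e2 \<sigma> \<tau>\<bar>))"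
    by (intro wavg_mono order_trans[OF abs_ge_self ex] be2)
  also have "\<dots> \<le> exp (15 * b) * (7 * spread)" unfolding wavg_cmult by (intro mult_left_mono d2) auto
  finally have 2: "av (\<lambda>\<sigma>. av (\<lambda>\<tau>. exp (e2 \<sigma> \<tau>))) - 1 \<le> exp (15 * b) * (7 * spread)" .
  have i: "integrable gauss_array exp_ratio" "integrable gauss_array (\<lambda>y. (exp_ratio y)\<^sup>2)"
  proof -
    have "exp_ratio = (\<lambda>y. av (\<lambda>\<sigma>. exp (- ?c) * exp (\<Sum>k\<in>J. ?l1 \<sigma> k * y k)))" by (intro ext f1)
    moreover have "tame (\<lambda>y. av (\<lambda>\<sigma>. exp (- ?c) * exp (\<Sum>k\<in>J. ?l1 \<sigma> k * y k)))" by (intro tame_av t1)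
    ultimately show "integrable gauss_array exp_ratio" using tame_integrable by metis
    show "integrable gauss_array (\<lambda>y. (exp_ratio y)\<^sup>2)"
      unfolding f2 by (intro tame_integrable tame_av t2)
  qed
  have "(\<integral>y. (exp_ratio y - 1)\<^sup>2 \<partial>gauss_array) = (\<integral>y. (exp_ratio y)\<^sup>2 - 2 * exp_ratio y + 1 \<partial>gauss_array)"
    by (simp add: power2_diff algebra_simps)
  also have "\<dots> = (\<integral>y. (exp_ratio y)\<^sup>2 \<partial>gauss_array) - 2 * (\<integral>y. exp_ratio y \<partial>gauss_array) + 1"
    using i by simp
  also have "\<dots> \<le> exp (15 * b) * (7 * spread) + 2 * (exp (15 * b) * (2 * spread))"
    unfolding E1 E2 using 1 2 by linarith
  finally show ?thesis by (simp add: algebra_simps)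
qed

lemma tame_exp_av: "tame (\<lambda>y. av (\<lambda>\<sigma>. exp (field y \<sigma>)))"
  unfolding wavg_def field_def by (intro tame_divide_const tame_sum tame_mult tame_const tame_exp_linear_form J)

lemma tame_mean_field: "tame mean_field"
proof -
  have "mean_field = (\<lambda>y. \<Sum>k\<in>J. center k * y k)" by (auto simp: mean_field_linear)
  then show ?thesis using tame_linear_form[of center J] by simp
qed

lemma exp_av_ge: "exp (mean_field y) \<le> av (\<lambda>\<sigma>. exp (field y \<sigma>))"
  unfolding mean_field_def by (rule exp_wavg_le)

lemma tame_ln_exp_av: "tame (\<lambda>y. ln (av (\<lambda>\<sigma>. exp (field y \<sigma>))))"
proof (rule tame_bounded_by)
  show "tame (\<lambda>y. \<bar>mean_field y\<bar> + av (\<lambda>\<sigma>. exp (field y \<sigma>)))"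
    by (intro tame_add tame_abs tame_mean_field tame_exp_av)
  show "(\<lambda>y. ln (av (\<lambda>\<sigma>. exp (field y \<sigma>)))) \<in> borel_measurable gauss_array"
    using tame_measurable[OF tame_exp_av] by measurable
  fix y
  let ?u = "av (\<lambda>\<sigma>. exp (field y \<sigma>))"
  have u: "?u > 0" using exp_av_ge[of y] by (rule less_le_trans[OF exp_gt_zero])
  then have "mean_field y \<le> ln ?u" using exp_av_ge[of y] by (simp add: ln_ge_iff)
  moreover have "ln ?u \<le> ?u" using ln_le_minus_one[OF u] by linarith
  ultimately show "\<bar>ln ?u\<bar> \<le> \<bar>\<bar>mean_field y\<bar> + ?u\<bar>" using u by linarith
qed

text \<open>The logarithm of \<open>exp_ratio\<close>.\<close>

definition log_error :: "('k \<Rightarrow> real) \<Rightarrow> real" where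
  "log_error y = ln (av (\<lambda>\<sigma>. exp (field y \<sigma>))) - mean_field y - b * (1 - q) / 2"

lemma tame_log_error: "tame log_error"
proof -
  have "tame (\<lambda>y. ln (av (\<lambda>\<sigma>. exp (field y \<sigma>))) - mean_field y - b * (1 - q) / 2)"
    by (intro tame_diff tame_ln_exp_av tame_mean_field tame_const)
  then show ?thesis by (simp only: log_error_def[symmetric])
qed

text \<open>Jensen's inequality bounds the ratio below by \<open>exp (- b * (1 - q) / 2)\<close>, so its logarithm is controlled
  by its distance from \<open>1\<close>.\<close>

lemma log_error_second_moment:
  "(\<integral>y. (log_error y)\<^sup>2 \<partial>gauss_array) \<le> 11 * exp (16 * b) * spread"
proof -
  let ?c = "b * (1 - q) / 2"
  have c: "0 \<le> ?c" "2 * ?c \<le> b" using bq by (auto simp: algebra_simps)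
  have path: "(log_error y)\<^sup>2 \<le> exp b * (exp_ratio y - 1)\<^sup>2" for y
  proof -
    let ?u = "av (\<lambda>\<sigma>. exp (field y \<sigma>))"
    have u: "?u > 0" using exp_av_ge[of y] by (rule less_le_trans[OF exp_gt_zero])
    have "exp (- ?c) = exp (mean_field y) * exp (- mean_field y - ?c)"
      by (simp add: exp_add[symmetric])
    also have "\<dots> \<le> exp_ratio y"
      unfolding exp_ratio_def by (intro mult_right_mono exp_av_ge) auto
    finally have "\<bar>ln (exp_ratio y)\<bar> \<le> exp ?c * \<bar>exp_ratio y - 1\<bar>"
      using c(1) by (rule abs_ln_le)
    then have "\<bar>ln (exp_ratio y)\<bar>\<^sup>2 \<le> (exp ?c * \<bar>exp_ratio y - 1\<bar>)\<^sup>2"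
      by (intro power_mono) auto
    also have "\<dots> = exp (2 * ?c) * (exp_ratio y - 1)\<^sup>2"
      by (simp only: power_mult_distrib power2_abs exp_double)
    also have "\<dots> \<le> exp b * (exp_ratio y - 1)\<^sup>2"
      using c(2) by (intro mult_right_mono) auto
    also have "ln (exp_ratio y) = log_error y"
      unfolding exp_ratio_def log_error_def using u by (simp add: ln_mult)
    finally show ?thesis by simp
  qed
  have te: "tame exp_ratio"
  proof -
    have "tame (\<lambda>y. av (\<lambda>\<sigma>. exp (field y \<sigma>)) * exp (- ?c + (\<Sum>k\<in>J. - center k * y k)))"
      by (intro tame_mult tame_exp_av tame_exp_linear J)
    moreover have "- ?c + (\<Sum>k\<in>J. - center k * y k) = - mean_field y - ?c" for y
      by (simp add: mean_field_linear sum_negf)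
    ultimately show ?thesis
      by (simp only: exp_ratio_def[symmetric])
  qed
  have "(\<integral>y. (log_error y)\<^sup>2 \<partial>gauss_array) \<le> (\<integral>y. exp b * (exp_ratio y - 1)\<^sup>2 \<partial>gauss_array)"
    by (intro expectation_mono path tame_power tame_mult tame_diff tame_const tame_log_error te)
  also have "\<dots> \<le> exp b * (11 * exp (15 * b) * spread)"
    using exp_ratio_second_moment by simp
  also have "\<dots> = 11 * exp (16 * b) * spread"
    by (simp add: exp_add[symmetric])
  finally show ?thesis .
qed

text \<open>The mean field is Gaussian with variance \<open>mean_cov\<close>; only the distance of that number from \<open>b * q\<close>
  matters.\<close>

lemma mean_field_law:
  assumes [measurable]: "F \<in> borel_measurable borel"
    and F: "\<And>s t. \<bar>F s - F t\<bar> \<le> \<alpha> + k * (s - t)\<^sup>2" and k: "k \<ge> 0"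
  shows "\<bar>(\<integral>y. F (mean_field y) \<partial>gauss_array) - (\<integral>t. F (sqrt (b * q) * t) \<partial>std_normal_distribution)\<bar>
     \<le> \<alpha> + k * spread"
proof -
  have sq: "integrable std_normal_distribution (\<lambda>t. t\<^sup>2)" "(\<integral>t. t\<^sup>2 \<partial>std_normal_distribution) = 1"
    using std_normal_distribution_even_moments[of 1] by simp_all
  have int: "integrable std_normal_distribution (\<lambda>t. F (c * t))" for c
  proof (rule Bochner_Integration.integrable_bound)
    show "integrable std_normal_distribution (\<lambda>t. \<bar>F 0\<bar> + \<bar>\<alpha>\<bar> + (k * c\<^sup>2) * t\<^sup>2)"
      using sq(1) by simp
    have "\<bar>F (c * t)\<bar> \<le> \<bar>F 0\<bar> + \<bar>\<alpha>\<bar> + (k * c\<^sup>2) * t\<^sup>2" for t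
      using F[of "c * t" 0] by (simp add: power_mult_distrib mult.assoc)
    then show "AE t in std_normal_distribution. norm (F (c * t)) \<le> norm (\<bar>F 0\<bar> + \<bar>\<alpha>\<bar> + (k * c\<^sup>2) * t\<^sup>2)"
      by (intro AE_I2) (auto intro: order_trans[OF _ abs_ge_self])
  qed simp
  have law: "(\<integral>y. F (mean_field y) \<partial>gauss_array) = (\<integral>t. F (sqrt mean_cov * t) \<partial>std_normal_distribution)"
    using gauss_array_linear_form[OF J assms(1), of center]
    by (simp add: mean_field_linear center_center[symmetric] power2_eq_square)
  let ?d = "(sqrt mean_cov - sqrt (b * q))\<^sup>2"
  have "\<bar>(\<integral>t. F (sqrt mean_cov * t) \<partial>std_normal_distribution) - (\<integral>t. F (sqrt (b * q) * t) \<partial>std_normal_distribution)\<bar>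
      = \<bar>\<integral>t. F (sqrt mean_cov * t) - F (sqrt (b * q) * t) \<partial>std_normal_distribution\<bar>"
    using int by simp
  also have "\<dots> \<le> (\<integral>t. \<bar>F (sqrt mean_cov * t) - F (sqrt (b * q) * t)\<bar> \<partial>std_normal_distribution)"
    by (rule integral_abs_bound)
  also have "\<dots> \<le> (\<integral>t. \<alpha> + (k * ?d) * t\<^sup>2 \<partial>std_normal_distribution)"
  proof (rule integral_mono)
    show "\<bar>F (sqrt mean_cov * t) - F (sqrt (b * q) * t)\<bar> \<le> \<alpha> + (k * ?d) * t\<^sup>2" for t
      using F[of "sqrt mean_cov * t" "sqrt (b * q) * t"]
      by (simp add: left_diff_distrib[symmetric] power_mult_distrib mult.assoc)
  qed (use int sq in auto)
  also have "\<dots> = \<alpha> + k * ?d"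
    using sq std_normal.prob_space by simp
  also have "\<dots> \<le> \<alpha> + k * spread"
    using sqrt_diff_square_le[OF mean_cov_nonneg bq(1)] mean_cov_dev k
    by (intro add_left_mono mult_left_mono) auto
  finally show ?thesis unfolding law .
qed

end

section \<open>Removing one site\<close>

text \<open>The field that the sites of \<open>U\<close> exert on the removed site \<open>i\<close>.\<close>

definition cav_field :: "real \<Rightarrow> nat set \<Rightarrow> nat \<Rightarrow> (nat \<times> nat \<Rightarrow> real) \<Rightarrow> (nat \<Rightarrow> real) \<Rightarrow> real" where
  "cav_field c U i g \<sigma> = c * (\<Sum>j\<in>U. (g (i, j) + g (j, i)) * \<sigma> j)"

definition cross_bonds :: "nat set \<Rightarrow> nat \<Rightarrow> (nat \<times> nat) set" where
  "cross_bonds U i = {i} \<times> U \<union> U \<times> {i}"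

text \<open>The coefficient of bond \<open>k\<close> in the field on \<open>i\<close>: the spin at the end of \<open>k\<close> other than \<open>i\<close>.\<close>

definition cross_coeff :: "real \<Rightarrow> nat \<Rightarrow> (nat \<Rightarrow> real) \<Rightarrow> nat \<times> nat \<Rightarrow> real" where
  "cross_coeff c i \<sigma> k = c * \<sigma> (if fst k = i then snd k else fst k)"

lemma two_cosh: "2 * cosh x = exp x + exp (- x)" for x :: real
  by (simp add: cosh_def)

lemma two_sinh: "2 * sinh x = exp x - exp (- x)" for x :: real
  by (simp add: sinh_def)

lemma sum_spins_insert:
  assumes "finite U" "i \<notin> U"
  shows "(\<Sum>\<sigma>\<in>spins (insert i U). f \<sigma>) = (\<Sum>\<sigma>\<in>spins U. f (\<sigma>(i := 1)) + f (\<sigma>(i := -1)))"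
proof -
  have inj: "inj_on (\<lambda>(y, \<sigma>). \<sigma>(i := y)) ({-1, 1} \<times> spins U)"
    unfolding spins_def by (rule inj_combinator[OF assms(2), of "\<lambda>_. {-1, 1}"])
  have "spins (insert i U) = (\<lambda>(y, \<sigma>). \<sigma>(i := y)) ` ({-1, 1::real} \<times> spins U)"
    unfolding spins_def by (rule PiE_insert_eq)
  then have "(\<Sum>\<sigma>\<in>spins (insert i U). f \<sigma>) = (\<Sum>(y, \<sigma>)\<in>{-1, 1} \<times> spins U. f (\<sigma>(i := y)))"
    by (simp only: sum.reindex[OF inj] comp_def) (simp add: split_beta)
  also have "\<dots> = (\<Sum>y\<in>{-1, 1}. \<Sum>\<sigma>\<in>spins U. f (\<sigma>(i := y)))"
    by (simp only: sum.cartesian_product)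
  finally show ?thesis by (simp add: sum.distrib add.commute)
qed

lemma energy_insert:
  assumes U: "finite U" "i \<notin> U" and e: "e * e = 1"
  shows "energy c h (insert i U) g (\<sigma>(i := e))
    = energy c h U g \<sigma> + c * g (i, i) + e * (h + cav_field c U i g \<sigma>)"
proof -
  have ne: "j \<noteq> i" if "j \<in> U" for j using that U by auto
  have "pair_energy (insert i U) g (\<sigma>(i := e))
      = (\<Sum>j\<in>insert i U. \<Sum>l\<in>insert i U. g (j, l) * ((\<sigma>(i := e)) j * (\<sigma>(i := e)) l))"
    unfolding pair_energy_def by (simp add: sum.cartesian_product split_beta)
  also have "\<dots> = g (i, i) * (e * e) + (\<Sum>l\<in>U. g (i, l) * (e * \<sigma> l))
      + (\<Sum>j\<in>U. g (j, i) * (\<sigma> j * e) + (\<Sum>l\<in>U. g (j, l) * (\<sigma> j * \<sigma> l)))"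
    using U ne by (simp cong: sum.cong)
  also have "\<dots> = pair_energy U g \<sigma> + g (i, i) + e * (\<Sum>j\<in>U. (g (i, j) + g (j, i)) * \<sigma> j)"
    unfolding pair_energy_def e
    by (simp add: sum.cartesian_product split_beta sum.distrib sum_distrib_left distrib_right distrib_left mult_ac)
  finally have p: "pair_energy (insert i U) g (\<sigma>(i := e)) = \<dots>" .
  have s: "(\<Sum>j\<in>insert i U. (\<sigma>(i := e)) j) = e + (\<Sum>j\<in>U. \<sigma> j)"
    using U ne by (simp cong: sum.cong)
  show ?thesis
    unfolding energy_def p s cav_field_def by (simp add: algebra_simps)
qed

lemma gibbs_sum_insert:
  assumes U: "finite U" "i \<notin> U"
  shows "(\<Sum>\<sigma>\<in>spins (insert i U). exp (energy c h (insert i U) g \<sigma>) * F \<sigma>)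
    = exp (c * g (i, i)) * (\<Sum>\<sigma>\<in>spins U. exp (energy c h U g \<sigma>)
        * (exp (h + cav_field c U i g \<sigma>) * F (\<sigma>(i := 1)) + exp (- (h + cav_field c U i g \<sigma>)) * F (\<sigma>(i := -1))))"
proof -
  have "exp (energy c h (insert i U) g (\<sigma>(i := 1))) * F (\<sigma>(i := 1))
      + exp (energy c h (insert i U) g (\<sigma>(i := -1))) * F (\<sigma>(i := -1))
      = exp (c * g (i, i)) * (exp (energy c h U g \<sigma>)
        * (exp (h + cav_field c U i g \<sigma>) * F (\<sigma>(i := 1)) + exp (- (h + cav_field c U i g \<sigma>)) * F (\<sigma>(i := -1))))" for \<sigma>
    using energy_insert[OF U, of 1 c h g \<sigma>] energy_insert[OF U, of "-1" c h g \<sigma>]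
    by (simp only: exp_add mult_1_left mult_minus1 minus_mult_minus) (simp add: exp_add algebra_simps)
  then show ?thesis
    by (simp only: sum_spins_insert[OF U] sum_distrib_left)
qed

lemma Zsum_insert:
  assumes U: "finite U" "i \<notin> U"
  shows "Zsum c h (insert i U) g
    = exp (c * g (i, i)) * Zsum c h U g * gavg c h U g (\<lambda>\<sigma>. 2 * cosh (h + cav_field c U i g \<sigma>))"
proof -
  have "Zsum c h (insert i U) g = exp (c * g (i, i)) * (\<Sum>\<sigma>\<in>spins U. exp (energy c h U g \<sigma>) * (2 * cosh (h + cav_field c U i g \<sigma>)))"
    using gibbs_sum_insert[OF U, of c h g "\<lambda>_. 1"]
    by (simp add: Zsum_def two_cosh)
  then show ?thesis
    using Zsum_pos[OF U(1), of c h g] by (simp add: gavg_def wavg_def Zsum_def)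
qed

lemma gavg_insert:
  assumes U: "finite U" "i \<notin> U"
  shows "gavg c h (insert i U) g F
    = gavg c h U g (\<lambda>\<sigma>. exp (h + cav_field c U i g \<sigma>) * F (\<sigma>(i := 1)) + exp (- (h + cav_field c U i g \<sigma>)) * F (\<sigma>(i := -1)))
      / gavg c h U g (\<lambda>\<sigma>. 2 * cosh (h + cav_field c U i g \<sigma>))"
proof -
  have "gavg c h (insert i U) g F = (\<Sum>\<sigma>\<in>spins (insert i U). exp (energy c h (insert i U) g \<sigma>) * F \<sigma>) / Zsum c h (insert i U) g"
    by (simp add: gavg_def wavg_def Zsum_def)
  then show ?thesis
    unfolding gibbs_sum_insert[OF U] Zsum_insert[OF U]
    using Zsum_pos[OF U(1), of c h g] by (simp add: gavg_def wavg_def Zsum_def)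
qed

lemma gavg_insert_indep:
  assumes U: "finite U" "i \<notin> U" and F: "\<And>\<sigma> e. F (\<sigma>(i := e)) = F \<sigma>"
  shows "gavg c h (insert i U) g F
    = gavg c h U g (\<lambda>\<sigma>. 2 * cosh (h + cav_field c U i g \<sigma>) * F \<sigma>)
      / gavg c h U g (\<lambda>\<sigma>. 2 * cosh (h + cav_field c U i g \<sigma>))"
  unfolding gavg_insert[OF U] F by (simp add: two_cosh distrib_right)

lemma gavg_insert_spin:
  assumes U: "finite U" "i \<notin> U"
  shows "gavg c h (insert i U) g (\<lambda>\<sigma>. \<sigma> i)
    = gavg c h U g (\<lambda>\<sigma>. 2 * sinh (h + cav_field c U i g \<sigma>))
      / gavg c h U g (\<lambda>\<sigma>. 2 * cosh (h + cav_field c U i g \<sigma>))"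
  unfolding gavg_insert[OF U] by (simp add: two_sinh)

lemma cav_field_linear:
  assumes U: "finite U" "i \<notin> U"
  shows "cav_field c U i g \<sigma> = (\<Sum>k\<in>cross_bonds U i. cross_coeff c i \<sigma> k * g k)"
proof -
  have "(\<Sum>k\<in>cross_bonds U i. cross_coeff c i \<sigma> k * g k)
      = (\<Sum>k\<in>{i} \<times> U. cross_coeff c i \<sigma> k * g k) + (\<Sum>k\<in>U \<times> {i}. cross_coeff c i \<sigma> k * g k)"
    unfolding cross_bonds_def using U by (intro sum.union_disjoint) auto
  also have "\<dots> = (\<Sum>j\<in>U. c * \<sigma> j * g (i, j)) + (\<Sum>j\<in>U. c * \<sigma> j * g (j, i))"
  proof -
    have "(\<Sum>k\<in>{i} \<times> U. cross_coeff c i \<sigma> k * g k) = (\<Sum>j\<in>U. cross_coeff c i \<sigma> (i, j) * g (i, j))"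
      by (simp add: sum.cartesian_product')
    moreover have "(\<Sum>k\<in>U \<times> {i}. cross_coeff c i \<sigma> k * g k) = (\<Sum>j\<in>U. cross_coeff c i \<sigma> (j, i) * g (j, i))"
      by (simp add: sum.cartesian_product')
    moreover have "(\<Sum>j\<in>U. cross_coeff c i \<sigma> (j, i) * g (j, i)) = (\<Sum>j\<in>U. c * \<sigma> j * g (j, i))"
      using U by (intro sum.cong refl) (auto simp: cross_coeff_def)
    ultimately show ?thesis by (simp add: cross_coeff_def)
  qed
  finally show ?thesis
    unfolding cav_field_def by (simp add: sum_distrib_left distrib_right sum.distrib[symmetric] distrib_left mult_ac)
qed

lemma cross_coeff_cov:
  assumes U: "finite U" "i \<notin> U" and n: "n > 0"
  shows "(\<Sum>k\<in>cross_bonds U i. cross_coeff (\<beta> / sqrt (2 * n)) i \<sigma> k * cross_coeff (\<beta> / sqrt (2 * n)) i \<tau> k)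
    = \<beta>\<^sup>2 * olap n U \<sigma> \<tau>"
proof -
  let ?c = "\<beta> / sqrt (2 * n)"
  have "(\<Sum>k\<in>cross_bonds U i. cross_coeff ?c i \<sigma> k * cross_coeff ?c i \<tau> k)
      = cav_field ?c U i (cross_coeff ?c i \<tau>) \<sigma>"
    by (rule cav_field_linear[OF U, symmetric])
  also have "\<dots> = ?c * (\<Sum>j\<in>U. (2 * ?c) * (\<sigma> j * \<tau> j))"
    unfolding cav_field_def using U
    by (intro arg_cong[where f = "\<lambda>s. ?c * s"] sum.cong refl) (auto simp: cross_coeff_def field_simps)
  also have "\<dots> = ?c * ((2 * ?c) * (\<Sum>j\<in>U. \<sigma> j * \<tau> j))"
    by (simp only: sum_distrib_left)
  also have "\<dots> = (2 * ?c\<^sup>2) * (\<Sum>j\<in>U. \<sigma> j * \<tau> j)"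
    by (simp only: power2_eq_square mult_ac)
  also have "2 * ?c\<^sup>2 = \<beta>\<^sup>2 / n" using n by (simp add: coupling_power)
  finally show ?thesis by (simp add: olap_def)
qed

text \<open>The smaller system does not see the bonds at \<open>i\<close>, so these may be redrawn.\<close>

lemma gavg_override_cross:
  assumes "i \<notin> U" shows "gavg c h U (override_on x y (cross_bonds U i)) f = gavg c h U x f"
proof -
  have "pair_energy U (override_on x y (cross_bonds U i)) \<sigma> = pair_energy U x \<sigma>" for \<sigma>
    unfolding pair_energy_def using assms
    by (intro sum.cong refl) (auto simp: override_on_def cross_bonds_def)
  then show ?thesis by (simp add: gavg_def energy_def)
qed

lemma cav_field_override_cross:
  "cav_field c U i (override_on x y (cross_bonds U i)) = cav_field c U i y"
  unfolding cav_field_def by (intro ext arg_cong[where f = "\<lambda>s. c * s"] sum.cong refl) (simp add: override_on_def cross_bonds_def)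

text \<open>The cavity field averaged over the Gibbs measure of \<open>U\<close>, and the error in the approximation of
  \<open>ln \<langle>exp (\<plusminus> field)\<rangle>\<close> by its mean plus half of the noise variance \<open>\<beta>\<^sup>2 * (1 - q)\<close>. The sign is \<open>s\<close>.\<close>

definition cav_mean :: "real \<Rightarrow> real \<Rightarrow> real \<Rightarrow> nat set \<Rightarrow> nat \<Rightarrow> (nat \<times> nat \<Rightarrow> real) \<Rightarrow> real" where
  "cav_mean n \<beta> h U i g = gavg (\<beta> / sqrt (2 * n)) h U g (cav_field (\<beta> / sqrt (2 * n)) U i g)"

definition cav_error ::
    "real \<Rightarrow> real \<Rightarrow> real \<Rightarrow> real \<Rightarrow> real \<Rightarrow> nat set \<Rightarrow> nat \<Rightarrow> (nat \<times> nat \<Rightarrow> real) \<Rightarrow> real" where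
  "cav_error s n \<beta> h q U i g =
     ln (gavg (\<beta> / sqrt (2 * n)) h U g (\<lambda>\<sigma>. exp (s * cav_field (\<beta> / sqrt (2 * n)) U i g \<sigma>)))
       - s * cav_mean n \<beta> h U i g - \<beta>\<^sup>2 * (1 - q) / 2"

definition cav_spread :: "real \<Rightarrow> real \<Rightarrow> real \<Rightarrow> real \<Rightarrow> nat set \<Rightarrow> (nat \<times> nat \<Rightarrow> real) \<Rightarrow> real" where
  "cav_spread n \<beta> h q U g = \<beta>\<^sup>2 * gavg (\<beta> / sqrt (2 * n)) h U g (\<lambda>\<sigma>. gavg (\<beta> / sqrt (2 * n)) h U g (\<lambda>\<tau>. \<bar>olap n U \<sigma> \<tau> - q\<bar>))
     + \<beta>\<^sup>2 * (1 - real (card U) / n)"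

lemma tame_cav_field [intro]: "tame (\<lambda>g. cav_field c U i g \<sigma>)"
  unfolding cav_field_def by (intro tame_mult tame_const tame_sum tame_add tame_coordinate)

lemma tame_exp_cav_field:
  assumes U: "finite U" "i \<notin> U" shows "tame (\<lambda>g. exp (s * cav_field c U i g \<sigma>))"
proof -
  have "finite (cross_bonds U i)" using U by (simp add: cross_bonds_def)
  then show ?thesis
    using tame_exp_linear[of "cross_bonds U i" 0 "\<lambda>k. s * cross_coeff c i \<sigma> k"]
    by (simp add: cav_field_linear[OF U] sum_distrib_left mult.assoc)
qed

lemma tame_cav_mean [intro]: "finite U \<Longrightarrow> tame (\<lambda>g. cav_mean n \<beta> h U i g)"
  unfolding cav_mean_def by (intro tame_gavg tame_cav_field)

lemma tame_cav_spread [intro]: "finite U \<Longrightarrow> tame (\<lambda>g. cav_spread n \<beta> h q U g)"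
  unfolding cav_spread_def by (intro tame_add tame_mult tame_const tame_gavg tame_gavg_const)

lemma gavg_pos: "finite V \<Longrightarrow> (\<And>\<sigma>. \<sigma> \<in> spins V \<Longrightarrow> 0 < f \<sigma>) \<Longrightarrow> 0 < gavg c h V g f"
  unfolding gavg_def wavg_def
  by (intro divide_pos_pos sum_pos mult_pos_pos) auto

lemma tame_ln_gavg:
  assumes V: "finite V" and f: "\<And>\<sigma>. \<sigma> \<in> spins V \<Longrightarrow> tame (\<lambda>g. f g \<sigma>)"
    and f': "\<And>\<sigma>. \<sigma> \<in> spins V \<Longrightarrow> tame (\<lambda>g. inverse (f g \<sigma>))"
    and pos: "\<And>g \<sigma>. \<sigma> \<in> spins V \<Longrightarrow> 0 < f g \<sigma>"
  shows "tame (\<lambda>g. ln (gavg c h V g (f g)))"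
proof (rule tame_bounded_by)
  have t: "tame (\<lambda>g. gavg c h V g (f g))" by (intro tame_gavg V f)
  show "tame (\<lambda>g. gavg c h V g (f g) + (\<Sum>\<sigma>\<in>spins V. inverse (f g \<sigma>)))"
    by (intro tame_add t tame_sum f')
  show "(\<lambda>g. ln (gavg c h V g (f g))) \<in> borel_measurable gauss_array"
    using tame_measurable[OF t] by measurable
  fix g
  let ?u = "gavg c h V g (f g)" and ?r = "\<Sum>\<sigma>\<in>spins V. inverse (f g \<sigma>)"
  have u: "0 < ?u" by (intro gavg_pos V pos)
  have r: "0 < ?r" using V pos by (intro sum_pos) auto
  have "inverse ?r \<le> ?u"
  proof (rule gavg_ge[OF V])
    fix \<sigma> assume \<sigma>: "\<sigma> \<in> spins V"
    have "inverse (f g \<sigma>) \<le> ?r" using \<sigma> V pos[of _ g] by (intro member_le_sum) (auto intro: less_imp_le)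
    then have "inverse ?r \<le> inverse (inverse (f g \<sigma>))" using pos[OF \<sigma>, of g] by (intro le_imp_inverse_le) auto
    then show "inverse ?r \<le> f g \<sigma>" by simp
  qed
  then have "inverse ?u \<le> ?r" using le_imp_inverse_le[of "inverse ?r" ?u] r by simp
  then have "- ln ?u \<le> ?r" using ln_le_minus_one[of "inverse ?u"] u by (simp add: ln_inverse)
  moreover have "ln ?u \<le> ?u" using ln_le_minus_one[OF u] by linarith
  ultimately show "\<bar>ln ?u\<bar> \<le> \<bar>?u + ?r\<bar>" using u r by linarith
qed

lemma tame_cav_error:
  assumes U: "finite U" "i \<notin> U" shows "tame (\<lambda>g. cav_error s n \<beta> h q U i g)"
proof -
  have "tame (\<lambda>g. inverse (exp (s * cav_field c U i g \<sigma>)))" for c \<sigma>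
    using tame_exp_cav_field[OF U, of "-s" c \<sigma>] by (simp add: exp_minus)
  then show ?thesis
    unfolding cav_error_def
    by (intro tame_diff tame_mult tame_const tame_cav_mean tame_ln_gavg tame_exp_cav_field U) auto
qed

text \<open>Conditionally on the bonds inside \<open>U\<close>, the cavity field is a Gaussian field whose covariance is
  \<open>\<beta>\<^sup>2\<close> times the overlap.\<close>

lemma cav_gaussian_field:
  assumes U: "finite U" "i \<notin> U" and n: "n > 0" "real (card U) \<le> n" and q: "0 \<le> q" "q \<le> 1" and s: "s * s = 1"
  shows "gaussian_field (spins U) (\<lambda>\<sigma>. exp (energy (\<beta> / sqrt (2 * n)) h U x \<sigma>)) (cross_bonds U i)
    (\<lambda>\<sigma> k. s * cross_coeff (\<beta> / sqrt (2 * n)) i \<sigma> k) (\<beta>\<^sup>2) q (\<beta>\<^sup>2 * (real (card U) / n))"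
proof -
  let ?c = "\<beta> / sqrt (2 * n)"
  interpret positive_weights "spins U" "\<lambda>\<sigma>. exp (energy ?c h U x \<sigma>)" by (rule gibbs_weights[OF U(1)])
  have cov: "(\<Sum>k\<in>cross_bonds U i. s * cross_coeff ?c i \<sigma> k * (s * cross_coeff ?c i \<tau> k)) = \<beta>\<^sup>2 * olap n U \<sigma> \<tau>" for \<sigma> \<tau>
  proof -
    have "s * x * (s * y) = x * y" for x y using s by (metis mult.assoc mult.left_commute mult_1_left)
    then show ?thesis by (simp only: cross_coeff_cov[OF U n(1)])
  qed
  show ?thesis
  proof
    show "finite (cross_bonds U i)" using U by (simp add: cross_bonds_def)
  next
    fix \<sigma> \<tau> assume *: "\<sigma> \<in> spins U" "\<tau> \<in> spins U"
    show "\<bar>\<Sum>k\<in>cross_bonds U i. s * cross_coeff ?c i \<sigma> k * (s * cross_coeff ?c i \<tau> k)\<bar> \<le> \<beta>\<^sup>2"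
      unfolding cov using abs_olap_le[OF U(1) * n] by (simp add: abs_mult mult_left_le)
  qed (use q in \<open>auto simp: cov olap_self\<close>)
qed

lemma
  assumes U: "finite U" "i \<notin> U" and n: "n > 0" "real (card U) \<le> n" and q: "0 \<le> q" "q \<le> 1" and s: "s * s = 1"
  shows cav_error_resampled: "(\<integral>y. (cav_error s n \<beta> h q U i (override_on x y (cross_bonds U i)))\<^sup>2 \<partial>gauss_array)
      \<le> 11 * exp (16 * \<beta>\<^sup>2) * cav_spread n \<beta> h q U x" (is ?first)
    and cav_mean_resampled: "F \<in> borel_measurable borel \<Longrightarrow> (\<And>u t. \<bar>F u - F t\<bar> \<le> \<alpha> + k * (u - t)\<^sup>2) \<Longrightarrow> k \<ge> 0 \<Longrightarrow>
      \<bar>(\<integral>y. F (s * cav_mean n \<beta> h U i (override_on x y (cross_bonds U i))) \<partial>gauss_array)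
        - (\<integral>t. F (sqrt (\<beta>\<^sup>2 * q) * t) \<partial>std_normal_distribution)\<bar> \<le> \<alpha> + k * cav_spread n \<beta> h q U x"
proof -
  let ?c = "\<beta> / sqrt (2 * n)"
  interpret G: gaussian_field "spins U" "\<lambda>\<sigma>. exp (energy ?c h U x \<sigma>)" "cross_bonds U i"
    "\<lambda>\<sigma> k. s * cross_coeff ?c i \<sigma> k" "\<beta>\<^sup>2" q "\<beta>\<^sup>2 * (real (card U) / n)"
    by (rule cav_gaussian_field[OF U n q s])
  have field: "G.field y \<sigma> = s * cav_field ?c U i y \<sigma>" for y \<sigma>
    unfolding G.field_def cav_field_linear[OF U] by (simp add: sum_distrib_left mult.assoc)
  have mean: "G.mean_field y = s * cav_mean n \<beta> h U i (override_on x y (cross_bonds U i))" for y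
    unfolding G.mean_field_def cav_mean_def gavg_override_cross[OF U(2)] cav_field_override_cross
      field[abs_def] unfolding gavg_def wavg_cmult ..
  have err: "G.log_error y = cav_error s n \<beta> h q U i (override_on x y (cross_bonds U i))" for y
    unfolding G.log_error_def cav_error_def mean gavg_override_cross[OF U(2)] cav_field_override_cross field
    unfolding gavg_def ..
  have spread: "G.spread = cav_spread n \<beta> h q U x"
  proof -
    have "G.cov \<sigma> \<tau> = \<beta>\<^sup>2 * olap n U \<sigma> \<tau>" for \<sigma> \<tau>
    proof -
      have "s * x * (s * y) = x * y" for x y using s by (metis mult.assoc mult.left_commute mult_1_left)
      then show ?thesis unfolding G.cov_def by (simp only: cross_coeff_cov[OF U n(1)])
    qed
    then have "\<bar>G.cov \<sigma> \<tau> - \<beta>\<^sup>2 * q\<bar> = \<beta>\<^sup>2 * \<bar>olap n U \<sigma> \<tau> - q\<bar>" for \<sigma> \<tau>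
      by (simp add: right_diff_distrib[symmetric] abs_mult)
    moreover have "\<bar>\<beta>\<^sup>2 * (real (card U) / n) - \<beta>\<^sup>2\<bar> = \<beta>\<^sup>2 * (1 - real (card U) / n)"
    proof -
      have "real (card U) / n \<le> 1" using n by simp
      then have "\<beta>\<^sup>2 * (real (card U) / n) \<le> \<beta>\<^sup>2 * 1" by (intro mult_left_mono) auto
      then show ?thesis by (simp add: right_diff_distrib)
    qed
    ultimately show ?thesis
      unfolding G.spread_def cav_spread_def by (simp add: gavg_def wavg_cmult)
  qed
  show ?first
    using G.log_error_second_moment unfolding err spread .
  show "\<bar>(\<integral>y. F (s * cav_mean n \<beta> h U i (override_on x y (cross_bonds U i))) \<partial>gauss_array)
      - (\<integral>t. F (sqrt (\<beta>\<^sup>2 * q) * t) \<partial>std_normal_distribution)\<bar> \<le> \<alpha> + k * cav_spread n \<beta> h q U x"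
    if "F \<in> borel_measurable borel" "\<And>u t. \<bar>F u - F t\<bar> \<le> \<alpha> + k * (u - t)\<^sup>2" "k \<ge> 0"
    using G.mean_field_law[OF that] unfolding mean spread .
qed

lemma cav_error_second_moment:
  assumes U: "finite U" "i \<notin> U" and n: "n > 0" "real (card U) \<le> n" and q: "0 \<le> q" "q \<le> 1" and s: "s * s = 1"
  shows "(\<integral>g. (cav_error s n \<beta> h q U i g)\<^sup>2 \<partial>gauss_array)
    \<le> 11 * exp (16 * \<beta>\<^sup>2) * (\<integral>g. cav_spread n \<beta> h q U g \<partial>gauss_array)"
proof -
  have "(\<integral>g. (cav_error s n \<beta> h q U i g)\<^sup>2 \<partial>gauss_array) \<le> (\<integral>g. 11 * exp (16 * \<beta>\<^sup>2) * cav_spread n \<beta> h q U g \<partial>gauss_array)"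
    by (rule expectation_resample_le[where J = "cross_bonds U i"])
       (intro tame_power tame_cav_error tame_mult tame_const tame_cav_spread U cav_error_resampled n q s)+
  then show ?thesis by simp
qed

text \<open>The two cavity averages of \<open>exp (\<plusminus> field)\<close> determine both the magnetization of the
  removed site and the ratio of the partition functions.\<close>

lemma gavg_cosh_sinh:
  fixes n \<beta> h q :: real and g :: "nat \<times> nat \<Rightarrow> real" and i :: nat
  assumes U: "finite U"
  defines "c \<equiv> \<beta> / sqrt (2 * n)"
  defines "z \<equiv> h + cav_mean n \<beta> h U i g + (cav_error 1 n \<beta> h q U i g - cav_error (-1) n \<beta> h q U i g) / 2"
    and "e \<equiv> \<beta>\<^sup>2 * (1 - q) / 2 + (cav_error 1 n \<beta> h q U i g + cav_error (-1) n \<beta> h q U i g) / 2"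
  shows "gavg c h U g (\<lambda>\<sigma>. 2 * cosh (h + cav_field c U i g \<sigma>)) = exp e * (2 * cosh z)"
    and "gavg c h U g (\<lambda>\<sigma>. 2 * sinh (h + cav_field c U i g \<sigma>)) = exp e * (2 * sinh z)"
proof -
  let ?f = "cav_field c U i g" and ?m = "cav_mean n \<beta> h U i g"
  let ?p = "cav_error 1 n \<beta> h q U i g" and ?q = "cav_error (-1) n \<beta> h q U i g" and ?d = "\<beta>\<^sup>2 * (1 - q) / 2"
  have u: "gavg c h U g (\<lambda>\<sigma>. exp (?f \<sigma>)) = exp (?p + ?m + ?d)"
    "gavg c h U g (\<lambda>\<sigma>. exp (- ?f \<sigma>)) = exp (?q - ?m + ?d)"
    unfolding cav_error_def c_def[symmetric] using gavg_pos[OF U, of "\<lambda>\<sigma>. exp (?f \<sigma>)" c h g]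
      gavg_pos[OF U, of "\<lambda>\<sigma>. exp (- ?f \<sigma>)" c h g] by simp_all
  have "gavg c h U g (\<lambda>\<sigma>. exp h * exp (?f \<sigma>) + exp (- h) * exp (- ?f \<sigma>))
      = exp h * exp (?p + ?m + ?d) + exp (- h) * exp (?q - ?m + ?d)"
    by (simp only: gavg_linear u)
  also have "\<dots> = exp (e + z) + exp (e - z)"
    by (simp add: e_def z_def exp_add[symmetric] add_divide_distrib diff_divide_distrib algebra_simps)
  also have "\<dots> = exp e * (2 * cosh z)"
    by (simp add: two_cosh distrib_left exp_add[symmetric])
  finally show "gavg c h U g (\<lambda>\<sigma>. 2 * cosh (h + ?f \<sigma>)) = exp e * (2 * cosh z)"
    by (simp add: two_cosh exp_add[symmetric])
  have "gavg c h U g (\<lambda>\<sigma>. exp h * exp (?f \<sigma>) - exp (- h) * exp (- ?f \<sigma>))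
      = exp h * exp (?p + ?m + ?d) - exp (- h) * exp (?q - ?m + ?d)"
    by (simp only: gavg_linear u)
  also have "\<dots> = exp (e + z) - exp (e - z)"
    by (simp add: e_def z_def exp_add[symmetric] add_divide_distrib diff_divide_distrib algebra_simps)
  also have "\<dots> = exp e * (2 * sinh z)"
    by (simp add: two_sinh right_diff_distrib exp_add[symmetric])
  finally show "gavg c h U g (\<lambda>\<sigma>. 2 * sinh (h + ?f \<sigma>)) = exp e * (2 * sinh z)"
    by (simp add: two_sinh exp_add[symmetric])
qed

section \<open>Overlaps after removing a site\<close>

definition cav_weight :: "real \<Rightarrow> real \<Rightarrow> real \<Rightarrow> nat set \<Rightarrow> nat \<Rightarrow> (nat \<times> nat \<Rightarrow> real) \<Rightarrow> real" where
  "cav_weight n \<beta> h U i g =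
     gavg (\<beta> / sqrt (2 * n)) h U g (\<lambda>\<sigma>. 2 * cosh (h + cav_field (\<beta> / sqrt (2 * n)) U i g \<sigma>))"

definition weight_bound :: "real \<Rightarrow> real \<Rightarrow> real" where
  "weight_bound \<beta> h = 8 * (exp (4 * h) + exp (- 4 * h)) * exp (8 * \<beta>\<^sup>2)"

text \<open>The replicas come from the Gibbs measure with site \<open>i\<close>, but only the sites of \<open>U\<close> enter the
  overlap.\<close>

definition old_overlap_dev :: "real \<Rightarrow> real \<Rightarrow> real \<Rightarrow> real \<Rightarrow> nat set \<Rightarrow> nat \<Rightarrow> (nat \<times> nat \<Rightarrow> real) \<Rightarrow> real" where
  "old_overlap_dev n \<beta> h q U i g = (let A = gavg (\<beta> / sqrt (2 * n)) h (insert i U) g in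
     A (\<lambda>\<sigma>. A (\<lambda>\<tau>. \<bar>olap n U \<sigma> \<tau> - q\<bar>)))"

lemma weight_bound_nonneg: "0 \<le> weight_bound \<beta> h"
  unfolding weight_bound_def by (intro mult_nonneg_nonneg add_nonneg_nonneg) auto

lemma cav_weight_ge: "finite U \<Longrightarrow> 2 \<le> cav_weight n \<beta> h U i g"
  unfolding cav_weight_def by (intro gavg_ge) (auto simp: cosh_real_ge_1)

lemma tame_cosh_cav_field:
  assumes U: "finite U" "i \<notin> U" shows "tame (\<lambda>g. 2 * cosh (h + cav_field c U i g \<sigma>))"
proof -
  have "2 * cosh (h + cav_field c U i g \<sigma>)
      = exp h * exp (1 * cav_field c U i g \<sigma>) + exp (- h) * exp (-1 * cav_field c U i g \<sigma>)" for g
    by (simp add: two_cosh exp_add[symmetric])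
  then show ?thesis
    by (simp only:) (intro tame_add tame_mult tame_const tame_exp_cav_field U)
qed

lemma tame_cav_weight:
  assumes U: "finite U" "i \<notin> U" shows "tame (\<lambda>g. cav_weight n \<beta> h U i g)"
  unfolding cav_weight_def by (intro tame_gavg tame_cosh_cav_field U)

lemma tame_old_overlap_dev: "finite U \<Longrightarrow> tame (\<lambda>g. old_overlap_dev n \<beta> h q U i g)"
  unfolding old_overlap_dev_def Let_def by (intro tame_gavg tame_gavg_const) auto

lemma old_overlap_dev_nonneg: "finite U \<Longrightarrow> 0 \<le> old_overlap_dev n \<beta> h q U i g"
  unfolding old_overlap_dev_def Let_def by (intro gavg_ge) auto

lemma cosh_fourth_power_le: "(2 * cosh z) ^ 4 \<le> 8 * (exp (4 * z) + exp (- 4 * z))" for z :: real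
proof -
  have sq: "(x + y)\<^sup>2 \<le> 2 * (x\<^sup>2 + y\<^sup>2)" for x y :: real
    using zero_le_power2[of "x - y"] by (simp add: power2_diff power2_sum)
  have "(2 * cosh z) ^ 4 = ((exp z + exp (- z))\<^sup>2)\<^sup>2"
    by (simp add: two_cosh)
  also have "\<dots> \<le> (2 * ((exp z)\<^sup>2 + (exp (- z))\<^sup>2))\<^sup>2"
    by (intro power_mono sq) auto
  also have "\<dots> = 4 * ((exp z)\<^sup>2 + (exp (- z))\<^sup>2)\<^sup>2" by (simp only: power_mult_distrib) simp
  also have "\<dots> \<le> 4 * (2 * (((exp z)\<^sup>2)\<^sup>2 + ((exp (- z))\<^sup>2)\<^sup>2))"
    by (intro mult_left_mono sq) auto
  also have "\<dots> = 8 * (exp (4 * z) + exp (- 4 * z))"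
    by (simp add: exp_double[symmetric])
  finally show ?thesis .
qed

lemma cav_weight_fourth_moment:
  assumes U: "finite U" "i \<notin> U" and n: "n > 0" "real (card U) \<le> n"
  shows "(\<integral>g. (cav_weight n \<beta> h U i g) ^ 4 \<partial>gauss_array) \<le> weight_bound \<beta> h"
proof -
  let ?c = "\<beta> / sqrt (2 * n)"
  let ?E = "\<lambda>g \<sigma>. 8 * (exp (4 * h) * exp (4 * cav_field ?c U i g \<sigma>) + exp (- 4 * h) * exp (- 4 * cav_field ?c U i g \<sigma>))"
  let ?F = "\<lambda>g. gavg ?c h U g (?E g)"
  have tE: "tame (\<lambda>g. ?E g \<sigma>)" for \<sigma>
    by (intro tame_mult tame_add tame_const tame_exp_cav_field U)
  have path: "(cav_weight n \<beta> h U i g) ^ 4 \<le> ?F g" for g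
  proof -
    let ?C = "\<lambda>\<sigma>. 2 * cosh (h + cav_field ?c U i g \<sigma>)"
    have "(cav_weight n \<beta> h U i g) ^ 4 = ((cav_weight n \<beta> h U i g)\<^sup>2)\<^sup>2" by simp
    also have "\<dots> \<le> (gavg ?c h U g (\<lambda>\<sigma>. (?C \<sigma>)\<^sup>2))\<^sup>2"
      unfolding cav_weight_def by (intro power_mono gavg_square_le U) auto
    also have "\<dots> \<le> gavg ?c h U g (\<lambda>\<sigma>. ((?C \<sigma>)\<^sup>2)\<^sup>2)" by (intro gavg_square_le U)
    also have "\<dots> \<le> gavg ?c h U g (\<lambda>\<sigma>. 8 * (exp (4 * (h + cav_field ?c U i g \<sigma>)) + exp (- 4 * (h + cav_field ?c U i g \<sigma>))))"
    proof (intro gavg_mono U)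
      show "((?C \<sigma>)\<^sup>2)\<^sup>2 \<le> 8 * (exp (4 * (h + cav_field ?c U i g \<sigma>)) + exp (- 4 * (h + cav_field ?c U i g \<sigma>)))" for \<sigma>
        using cosh_fourth_power_le[of "h + cav_field ?c U i g \<sigma>"] by (simp add: power_mult[symmetric])
    qed
    also have "\<dots> = ?F g" by (simp add: exp_add[symmetric] distrib_left)
    finally show ?thesis .
  qed
  have mgf: "(\<integral>y. exp (a * cav_field ?c U i y \<sigma>) \<partial>gauss_array) \<le> exp (8 * \<beta>\<^sup>2)"
    if \<sigma>: "\<sigma> \<in> spins U" and a: "a * a = 16" for a \<sigma>
  proof -
    have fin: "finite (cross_bonds U i)" using U by (simp add: cross_bonds_def)
    have "(\<integral>y. exp (a * cav_field ?c U i y \<sigma>) \<partial>gauss_array)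
        = exp ((\<Sum>k\<in>cross_bonds U i. (a * cross_coeff ?c i \<sigma> k)\<^sup>2) / 2)"
      using gauss_array_mgf[OF fin, of "\<lambda>k. a * cross_coeff ?c i \<sigma> k"]
      by (simp add: cav_field_linear[OF U] sum_distrib_left mult.assoc)
    also have "(\<Sum>k\<in>cross_bonds U i. (a * cross_coeff ?c i \<sigma> k)\<^sup>2)
        = (a * a) * (\<Sum>k\<in>cross_bonds U i. cross_coeff ?c i \<sigma> k * cross_coeff ?c i \<sigma> k)"
      unfolding sum_distrib_left by (intro sum.cong refl) (simp add: power2_eq_square)
    also have "\<dots> = 16 * (\<beta>\<^sup>2 * (real (card U) / n))"
      unfolding a by (simp only: cross_coeff_cov[OF U n(1)] olap_self[OF \<sigma>])
    also have "16 * (\<beta>\<^sup>2 * (real (card U) / n)) / 2 \<le> 8 * \<beta>\<^sup>2"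
    proof -
      have "\<beta>\<^sup>2 * (real (card U) / n) \<le> \<beta>\<^sup>2" using n by (intro mult_left_le) auto
      then have "8 * (\<beta>\<^sup>2 * (real (card U) / n)) \<le> 8 * \<beta>\<^sup>2" by (intro mult_left_mono) auto
      moreover have "16 * x / 2 = 8 * x" for x :: real by simp
      ultimately show ?thesis by (simp only:)
    qed
    finally show ?thesis by simp
  qed
  have "(\<integral>g. (cav_weight n \<beta> h U i g) ^ 4 \<partial>gauss_array) \<le> (\<integral>g. ?F g \<partial>gauss_array)"
    by (intro expectation_mono path tame_power tame_cav_weight tame_gavg tE U)
  also have "\<dots> \<le> (\<integral>g. weight_bound \<beta> h \<partial>(gauss_array :: (nat \<times> nat \<Rightarrow> real) measure))"
  proof (rule expectation_resample_le[where J = "cross_bonds U i"])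
    show "tame ?F" by (intro tame_gavg tE U)
    fix x
    have "(\<integral>y. ?F (override_on x y (cross_bonds U i)) \<partial>gauss_array)
        = (\<integral>y. gavg ?c h U x (?E y) \<partial>gauss_array)"
      by (simp only: gavg_override_cross[OF U(2)] cav_field_override_cross)
    also have "\<dots> = gavg ?c h U x (\<lambda>\<sigma>. \<integral>y. ?E y \<sigma> \<partial>gauss_array)"
      unfolding gavg_def wavg_def
      by (simp only: Bochner_Integration.integral_divide_zero Bochner_Integration.integral_sum
          Bochner_Integration.integral_mult_right_zero tame_integrable[OF tE] integrable_mult_right)
    also have "\<dots> \<le> weight_bound \<beta> h"
    proof (rule gavg_le[OF U(1)])
      fix \<sigma> assume \<sigma>: "\<sigma> \<in> spins U"
      have "(\<integral>y. ?E y \<sigma> \<partial>gauss_array) = 8 * (exp (4 * h) * (\<integral>y. exp (4 * cav_field ?c U i y \<sigma>) \<partial>gauss_array)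
          + exp (- 4 * h) * (\<integral>y. exp (- 4 * cav_field ?c U i y \<sigma>) \<partial>gauss_array))"
        using tame_integrable[OF tame_exp_cav_field[OF U, of 4 ?c \<sigma>]] tame_integrable[OF tame_exp_cav_field[OF U, of "-4" ?c \<sigma>]]
        by (simp only: Bochner_Integration.integral_mult_right_zero Bochner_Integration.integral_add integrable_mult_right)
      also have "\<dots> \<le> 8 * (exp (4 * h) * exp (8 * \<beta>\<^sup>2) + exp (- 4 * h) * exp (8 * \<beta>\<^sup>2))"
        by (intro mult_left_mono add_mono mgf \<sigma>) auto
      finally show "(\<integral>y. ?E y \<sigma> \<partial>gauss_array) \<le> weight_bound \<beta> h"
        unfolding weight_bound_def by (simp add: algebra_simps)
    qed
    finally show "(\<integral>y. ?F (override_on x y (cross_bonds U i)) \<partial>gauss_array) \<le> weight_bound \<beta> h" .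
  qed auto
  finally show ?thesis by simp
qed

lemma olap_update: "i \<notin> U \<Longrightarrow> olap n U (\<sigma>(i := e)) \<tau> = olap n U \<sigma> \<tau>" "i \<notin> U \<Longrightarrow> olap n U \<sigma> (\<tau>(i := e)) = olap n U \<sigma> \<tau>"
  unfolding olap_def by (auto intro!: arg_cong[where f = "\<lambda>s. s / n"] sum.cong)

text \<open>Since the cavity weights are at least \<open>2\<close>, averages of nonnegative functions over the smaller
  system are controlled by averages over the larger one.\<close>

lemma gavg_le_gavg_insert:
  assumes U: "finite U" "i \<notin> U" and F: "\<And>\<sigma> e. F (\<sigma>(i := e)) = F \<sigma>" and pos: "\<And>\<sigma>. 0 \<le> F \<sigma>"
  shows "gavg (\<beta> / sqrt (2 * n)) h U g F
    \<le> gavg (\<beta> / sqrt (2 * n)) h (insert i U) g F * (cav_weight n \<beta> h U i g / 2)"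
proof -
  let ?c = "\<beta> / sqrt (2 * n)"
  let ?C = "\<lambda>\<sigma>. 2 * cosh (h + cav_field ?c U i g \<sigma>)"
  have W: "0 < cav_weight n \<beta> h U i g" using cav_weight_ge[OF U(1), of n \<beta> h i g] by linarith
  have "gavg ?c h U g F \<le> gavg ?c h U g (\<lambda>\<sigma>. ?C \<sigma> * F \<sigma> / 2)"
  proof (intro gavg_mono U)
    fix \<sigma>
    have "1 * F \<sigma> \<le> cosh (h + cav_field ?c U i g \<sigma>) * F \<sigma>"
      using pos by (intro mult_right_mono cosh_real_ge_1)
    then show "F \<sigma> \<le> ?C \<sigma> * F \<sigma> / 2" by simp
  qed
  also have "\<dots> = gavg ?c h U g (\<lambda>\<sigma>. ?C \<sigma> * F \<sigma>) / 2" by (simp only: gavg_linear)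
  also have "\<dots> = gavg ?c h (insert i U) g F * (cav_weight n \<beta> h U i g / 2)"
    unfolding gavg_insert_indep[OF U F] cav_weight_def[symmetric] using W by simp
  finally show ?thesis .
qed

lemma overlap_transfer:
  fixes n \<beta> h q :: real and g :: "nat \<times> nat \<Rightarrow> real"
  assumes U: "finite U" "i \<notin> U"
  defines "A \<equiv> gavg (\<beta> / sqrt (2 * n)) h U g" and "B \<equiv> gavg (\<beta> / sqrt (2 * n)) h (insert i U) g"
    and "W \<equiv> cav_weight n \<beta> h U i g" and "D \<equiv> old_overlap_dev n \<beta> h q U i g"
  shows "A (\<lambda>\<sigma>. A (\<lambda>\<tau>. \<bar>olap n U \<sigma> \<tau> - q\<bar>)) \<le> D * W\<^sup>2 / 4"
    and "B (\<lambda>\<sigma>. A (\<lambda>\<tau>. \<bar>olap n U \<sigma> \<tau> - q\<bar>)) \<le> D * W\<^sup>2 / 4"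
    and "D \<le> D * W\<^sup>2 / 4"
proof -
  let ?f = "\<lambda>\<sigma> \<tau>. \<bar>olap n U \<sigma> \<tau> - q\<bar>"
  have V: "finite (insert i U)" using U by simp
  have W: "2 \<le> W" unfolding W_def by (rule cav_weight_ge[OF U(1)])
  have D0: "0 \<le> D" unfolding D_def by (rule old_overlap_dev_nonneg[OF U(1)])
  have D: "D = B (\<lambda>\<sigma>. B (\<lambda>\<tau>. ?f \<sigma> \<tau>))" unfolding D_def B_def old_overlap_dev_def Let_def ..
  have W4: "W / 2 \<le> W\<^sup>2 / 4" "1 \<le> W\<^sup>2 / 4"
    using W mult_left_mono[of 2 W W] power_mono[of 2 W 2] by (auto simp: power2_eq_square)
  have in1: "A (\<lambda>\<tau>. ?f \<sigma> \<tau>) \<le> B (\<lambda>\<tau>. ?f \<sigma> \<tau>) * (W / 2)" for \<sigma>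
    unfolding A_def B_def W_def by (rule gavg_le_gavg_insert[OF U]) (auto simp: olap_update[OF U(2)])
  have "B (\<lambda>\<sigma>. A (\<lambda>\<tau>. ?f \<sigma> \<tau>)) \<le> B (\<lambda>\<sigma>. B (\<lambda>\<tau>. ?f \<sigma> \<tau>) * (W / 2))"
    unfolding B_def by (intro gavg_mono V) (use in1 in \<open>simp add: B_def\<close>)
  also have "\<dots> = D * (W / 2)" unfolding D unfolding B_def by (simp only: gavg_linear)
  finally have BA: "B (\<lambda>\<sigma>. A (\<lambda>\<tau>. ?f \<sigma> \<tau>)) \<le> D * (W / 2)" .
  also have "\<dots> \<le> D * (W\<^sup>2 / 4)" by (intro mult_left_mono W4 D0)
  finally show "B (\<lambda>\<sigma>. A (\<lambda>\<tau>. ?f \<sigma> \<tau>)) \<le> D * W\<^sup>2 / 4" by simp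
  have "A (\<lambda>\<sigma>. A (\<lambda>\<tau>. ?f \<sigma> \<tau>)) \<le> B (\<lambda>\<sigma>. A (\<lambda>\<tau>. ?f \<sigma> \<tau>)) * (W / 2)"
    unfolding A_def B_def W_def
    by (rule gavg_le_gavg_insert[OF U]) (auto simp: olap_update[OF U(2)] intro!: gavg_ge U)
  also have "\<dots> \<le> D * (W / 2) * (W / 2)" using W by (intro mult_right_mono BA) auto
  finally show "A (\<lambda>\<sigma>. A (\<lambda>\<tau>. ?f \<sigma> \<tau>)) \<le> D * W\<^sup>2 / 4" by (simp add: power2_eq_square)
  show "D \<le> D * W\<^sup>2 / 4" using mult_left_mono[OF W4(2) D0] by simp
qed

text \<open>The distance between the two magnetization vectors is a combination of three overlaps: of two
  replicas of the larger system, of the smaller one, and of one replica of each. All are close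
  to \<open>q\<close>.\<close>

lemma magnetization_transfer:
  fixes n \<beta> h q :: real and g :: "nat \<times> nat \<Rightarrow> real"
  assumes U: "finite U" "i \<notin> U"
  defines "A \<equiv> gavg (\<beta> / sqrt (2 * n)) h U g" and "B \<equiv> gavg (\<beta> / sqrt (2 * n)) h (insert i U) g"
  shows "(\<Sum>j\<in>U. (B (\<lambda>\<sigma>. \<sigma> j) - A (\<lambda>\<sigma>. \<sigma> j))\<^sup>2) / n
    \<le> old_overlap_dev n \<beta> h q U i g * (cav_weight n \<beta> h U i g)\<^sup>2"
proof -
  let ?o = "\<lambda>\<sigma> \<tau>. olap n U \<sigma> \<tau>"
  have V: "finite (insert i U)" using U by simp
  have prod: "(\<Sum>j\<in>U. gavg c h X g (\<lambda>\<sigma>. \<sigma> j) * gavg c' h' Y g (\<lambda>\<sigma>. \<sigma> j)) / n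
      = gavg c h X g (\<lambda>\<sigma>. gavg c' h' Y g (\<lambda>\<tau>. ?o \<sigma> \<tau>))" for X Y c h c' h'
    unfolding gavg_def olap_def by (simp add: wavg_product wavg_divide wavg_sum)
  have dev: "gavg c h X g (\<lambda>\<sigma>. gavg c' h' Y g (\<lambda>\<tau>. ?o \<sigma> \<tau>)) - q
      = gavg c h X g (\<lambda>\<sigma>. gavg c' h' Y g (\<lambda>\<tau>. ?o \<sigma> \<tau> - q))" if "finite X" "finite Y" for X Y c h c' h'
    using that by (simp add: gavg_linear(2) gavg_const)
  have abs: "\<bar>gavg c h X g (\<lambda>\<sigma>. gavg c' h' Y g (\<lambda>\<tau>. ?o \<sigma> \<tau>)) - q\<bar>
      \<le> gavg c h X g (\<lambda>\<sigma>. gavg c' h' Y g (\<lambda>\<tau>. \<bar>?o \<sigma> \<tau> - q\<bar>))" if "finite X" "finite Y" for X Y c h c' h'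
    unfolding dev[OF that]
    by (rule order_trans[OF gavg_abs[OF that(1)]]) (intro gavg_mono that gavg_abs)
  let ?E = "old_overlap_dev n \<beta> h q U i g * (cav_weight n \<beta> h U i g)\<^sup>2 / 4"
  have "(\<Sum>j\<in>U. (B (\<lambda>\<sigma>. \<sigma> j) - A (\<lambda>\<sigma>. \<sigma> j))\<^sup>2) / n
      = (\<Sum>j\<in>U. B (\<lambda>\<sigma>. \<sigma> j) * B (\<lambda>\<sigma>. \<sigma> j)) / n - 2 * ((\<Sum>j\<in>U. B (\<lambda>\<sigma>. \<sigma> j) * A (\<lambda>\<sigma>. \<sigma> j)) / n)
        + (\<Sum>j\<in>U. A (\<lambda>\<sigma>. \<sigma> j) * A (\<lambda>\<sigma>. \<sigma> j)) / n"
  proof -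
    have "(\<Sum>j\<in>U. (B (\<lambda>\<sigma>. \<sigma> j) - A (\<lambda>\<sigma>. \<sigma> j))\<^sup>2)
        = (\<Sum>j\<in>U. B (\<lambda>\<sigma>. \<sigma> j) * B (\<lambda>\<sigma>. \<sigma> j) - 2 * (B (\<lambda>\<sigma>. \<sigma> j) * A (\<lambda>\<sigma>. \<sigma> j)) + A (\<lambda>\<sigma>. \<sigma> j) * A (\<lambda>\<sigma>. \<sigma> j))"
      by (intro sum.cong refl) (simp add: power2_eq_square algebra_simps)
    then show ?thesis
      by (simp only: sum.distrib sum_subtractf sum_distrib_left[symmetric] add_divide_distrib diff_divide_distrib
          times_divide_eq_right)
  qed
  also have "\<dots> = (B (\<lambda>\<sigma>. B (\<lambda>\<tau>. ?o \<sigma> \<tau>)) - q) - 2 * (B (\<lambda>\<sigma>. A (\<lambda>\<tau>. ?o \<sigma> \<tau>)) - q) + (A (\<lambda>\<sigma>. A (\<lambda>\<tau>. ?o \<sigma> \<tau>)) - q)"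
    unfolding A_def B_def prod by simp
  also have "\<dots> \<le> ?E + 2 * ?E + ?E"
  proof -
    have "\<bar>B (\<lambda>\<sigma>. B (\<lambda>\<tau>. ?o \<sigma> \<tau>)) - q\<bar> \<le> old_overlap_dev n \<beta> h q U i g"
      unfolding A_def B_def old_overlap_dev_def Let_def by (rule abs[OF V V])
    then have 1: "\<bar>B (\<lambda>\<sigma>. B (\<lambda>\<tau>. ?o \<sigma> \<tau>)) - q\<bar> \<le> ?E" using overlap_transfer(3)[OF U] by (rule order_trans)
    have 2: "\<bar>B (\<lambda>\<sigma>. A (\<lambda>\<tau>. ?o \<sigma> \<tau>)) - q\<bar> \<le> ?E"
      unfolding A_def B_def by (rule order_trans[OF abs[OF V U(1)] overlap_transfer(2)[OF U]])
    have 3: "\<bar>A (\<lambda>\<sigma>. A (\<lambda>\<tau>. ?o \<sigma> \<tau>)) - q\<bar> \<le> ?E"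
      unfolding A_def B_def by (rule order_trans[OF abs[OF U(1) U(1)] overlap_transfer(1)[OF U]])
    have "x - 2 * y + z \<le> e + 2 * e + e" if "\<bar>x\<bar> \<le> e" "\<bar>y\<bar> \<le> e" "\<bar>z\<bar> \<le> e" for x y z e :: real
      using that by linarith
    from this[OF 1 2 3] show ?thesis .
  qed
  finally show ?thesis by simp
qed

lemma old_overlap_dev_square_le:
  assumes U: "finite U" "i \<notin> U" and n: "n > 0"
  shows "(old_overlap_dev n \<beta> h q U i g)\<^sup>2 \<le> 2 * overlap_dev n \<beta> h (insert i U) q g + 2 / n\<^sup>2"
proof -
  let ?B = "gavg (\<beta> / sqrt (2 * n)) h (insert i U) g"
  have V: "finite (insert i U)" using U by simp
  have "(old_overlap_dev n \<beta> h q U i g)\<^sup>2 \<le> ?B (\<lambda>\<sigma>. (?B (\<lambda>\<tau>. \<bar>olap n U \<sigma> \<tau> - q\<bar>))\<^sup>2)"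
    unfolding old_overlap_dev_def Let_def by (rule gavg_square_le[OF V])
  also have "\<dots> \<le> ?B (\<lambda>\<sigma>. ?B (\<lambda>\<tau>. \<bar>olap n U \<sigma> \<tau> - q\<bar>\<^sup>2))"
    by (intro gavg_mono V gavg_square_le)
  also have "\<dots> \<le> ?B (\<lambda>\<sigma>. ?B (\<lambda>\<tau>. 2 * (olap n (insert i U) \<sigma> \<tau> - q)\<^sup>2 + 2 / n\<^sup>2))"
  proof (intro gavg_mono V)
    fix \<sigma> \<tau> assume *: "\<sigma> \<in> spins (insert i U)" "\<tau> \<in> spins (insert i U)"
    let ?x = "olap n (insert i U) \<sigma> \<tau> - q" and ?y = "\<sigma> i * \<tau> i / n"
    have x: "olap n U \<sigma> \<tau> - q = ?x - ?y"
      using U unfolding olap_def by (simp add: add_divide_distrib)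
    have "(\<sigma> i * \<tau> i)\<^sup>2 = (\<sigma> i * \<sigma> i) * (\<tau> i * \<tau> i)" by (simp add: power2_eq_square)
    then have "?y\<^sup>2 = 1 / n\<^sup>2"
      using * by (simp add: power_divide spins_square)
    moreover have "(?x - ?y)\<^sup>2 \<le> 2 * ?x\<^sup>2 + 2 * ?y\<^sup>2"
    proof -
      have "(x - y)\<^sup>2 \<le> 2 * x\<^sup>2 + 2 * y\<^sup>2" for x y :: real
        using zero_le_power2[of "x + y"] unfolding power2_sum power2_diff by linarith
      then show ?thesis .
    qed
    ultimately show "\<bar>olap n U \<sigma> \<tau> - q\<bar>\<^sup>2 \<le> 2 * ?x\<^sup>2 + 2 / n\<^sup>2"
      unfolding power2_abs x by simp
  qed
  also have "\<dots> = 2 * overlap_dev n \<beta> h (insert i U) q g + 2 / n\<^sup>2"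
    unfolding overlap_dev_def by (simp only: gavg_linear gavg_const[OF V])
  finally show ?thesis .
qed

definition cav_dev_rate :: "real \<Rightarrow> real \<Rightarrow> real" where
  "cav_dev_rate \<beta> h = 2 * sqrt (weight_bound \<beta> h)"

text \<open>The transfer to the smaller system costs a factor \<open>cav_weight\<^sup>2\<close>, which depends on the same disorder as
  the overlap. The fourth moment of the weight is bounded, so the Cauchy-Schwarz inequality decouples it.\<close>

lemma weighted_overlap_dev_le:
  fixes n \<beta> h q :: real
  assumes U: "finite U" "i \<notin> U" and n: "n \<ge> 1" "real (card U) \<le> n"
  defines "s \<equiv> sqrt (\<integral>g. overlap_dev n \<beta> h (insert i U) q g \<partial>gauss_array) + 1 / n"
  shows "(\<integral>g. old_overlap_dev n \<beta> h q U i g * (cav_weight n \<beta> h U i g)\<^sup>2 \<partial>gauss_array) \<le> cav_dev_rate \<beta> h * s"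
proof -
  let ?D = "\<lambda>g. old_overlap_dev n \<beta> h q U i g" and ?W = "\<lambda>g. cav_weight n \<beta> h U i g"
  let ?\<delta> = "\<integral>g. overlap_dev n \<beta> h (insert i U) q g \<partial>gauss_array"
  have V: "finite (insert i U)" using U by simp
  have tD: "tame ?D" by (rule tame_old_overlap_dev[OF U(1)])
  have tW: "tame ?W" by (rule tame_cav_weight[OF U])
  have \<delta>: "0 \<le> ?\<delta>" by (intro Bochner_Integration.integral_nonneg overlap_dev_nonneg V)
  have s0: "0 \<le> s" unfolding s_def using \<delta> n by simp
  have iD: "integrable gauss_array (\<lambda>g. overlap_dev n \<beta> h (insert i U) q g)"
    by (intro tame_integrable tame_overlap_dev V)
  have "(\<integral>g. (?D g)\<^sup>2 \<partial>gauss_array) \<le> (\<integral>g. 2 * overlap_dev n \<beta> h (insert i U) q g + 2 / n\<^sup>2 \<partial>gauss_array)"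
    using n by (intro expectation_mono old_overlap_dev_square_le U tame_power tD tame_add tame_mult tame_const tame_overlap_dev V) auto
  also have "\<dots> = 2 * ?\<delta> + 2 / n\<^sup>2"
    using iD by simp
  also have "\<dots> \<le> 4 * s\<^sup>2"
  proof -
    have s2: "s\<^sup>2 = ?\<delta> + 2 * (sqrt ?\<delta> * (1 / n)) + 1 / n\<^sup>2"
      unfolding s_def power2_sum using \<delta> by (simp add: power_divide)
    have "2 * d + 2 / n\<^sup>2 \<le> 4 * (d + 2 * x + 1 / n\<^sup>2)" if "0 \<le> d" "0 \<le> x" for d x
    proof -
      have "2 / n\<^sup>2 \<le> 4 * (1 / n\<^sup>2)" by (simp add: divide_right_mono)
      then show ?thesis using that by (simp add: distrib_left)
    qed
    from this[OF \<delta>, of "sqrt ?\<delta> * (1 / n)"] show ?thesis unfolding s2 using \<delta> n by (simp only: zero_le_mult_iff) simp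
  qed
  also have "\<dots> = (2 * s)\<^sup>2" by (simp add: power_mult_distrib)
  finally have "sqrt (\<integral>g. (?D g)\<^sup>2 \<partial>gauss_array) \<le> 2 * s"
    using s0 by (intro real_le_lsqrt) auto
  moreover have "sqrt (\<integral>g. ((?W g)\<^sup>2)\<^sup>2 \<partial>gauss_array) \<le> sqrt (weight_bound \<beta> h)"
    using cav_weight_fourth_moment[OF U, of n \<beta> h] n by simp
  ultimately have "sqrt (\<integral>g. (?D g)\<^sup>2 \<partial>gauss_array) * sqrt (\<integral>g. ((?W g)\<^sup>2)\<^sup>2 \<partial>gauss_array)
      \<le> 2 * s * sqrt (weight_bound \<beta> h)"
    using s0 by (intro mult_mono) auto
  moreover have "\<bar>\<integral>g. ?D g * (?W g)\<^sup>2 \<partial>gauss_array\<bar>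
      \<le> sqrt (\<integral>g. (?D g)\<^sup>2 \<partial>gauss_array) * sqrt (\<integral>g. ((?W g)\<^sup>2)\<^sup>2 \<partial>gauss_array)"
    by (intro gauss_Cauchy_Schwarz tD tame_power tW)
  ultimately show ?thesis unfolding cav_dev_rate_def by (simp add: mult_ac)
qed

lemma tame_weighted_overlap_dev:
  assumes "finite U" "i \<notin> U"
  shows "tame (\<lambda>g. old_overlap_dev n \<beta> h q U i g * (cav_weight n \<beta> h U i g)\<^sup>2)"
  by (intro tame_mult tame_power tame_old_overlap_dev tame_cav_weight assms)

lemma cav_spread_mean_le:
  fixes n \<beta> h q :: real
  assumes U: "finite U" "i \<notin> U" and n: "n = real (card (insert i U))"
  defines "s \<equiv> sqrt (\<integral>g. overlap_dev n \<beta> h (insert i U) q g \<partial>gauss_array) + 1 / n"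
  shows "(\<integral>g. cav_spread n \<beta> h q U g \<partial>gauss_array) \<le> \<beta>\<^sup>2 * (cav_dev_rate \<beta> h + 1) * s"
proof -
  have n1: "n \<ge> 1" "real (card U) \<le> n" and c: "1 - real (card U) / n = 1 / n"
    using U unfolding n by (auto simp: field_simps)
  have "(\<integral>g. cav_spread n \<beta> h q U g \<partial>gauss_array)
      \<le> (\<integral>g. \<beta>\<^sup>2 * (old_overlap_dev n \<beta> h q U i g * (cav_weight n \<beta> h U i g)\<^sup>2 / 4) + \<beta>\<^sup>2 * (1 / n) \<partial>gauss_array)"
    unfolding cav_spread_def c
    using U by (intro expectation_mono tame_add tame_mult[OF tame_const] tame_divide_const tame_weighted_overlap_dev
        tame_const add_right_mono mult_left_mono overlap_transfer(1) tame_gavg tame_gavg_const) auto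
  also have "\<dots> = \<beta>\<^sup>2 * ((\<integral>g. old_overlap_dev n \<beta> h q U i g * (cav_weight n \<beta> h U i g)\<^sup>2 \<partial>gauss_array) / 4) + \<beta>\<^sup>2 * (1 / n)"
    using tame_integrable[OF tame_weighted_overlap_dev[OF U]] by simp
  also have "\<dots> \<le> \<beta>\<^sup>2 * (cav_dev_rate \<beta> h * s / 4) + \<beta>\<^sup>2 * s"
  proof (intro add_mono mult_left_mono divide_right_mono)
    show "(\<integral>g. old_overlap_dev n \<beta> h q U i g * (cav_weight n \<beta> h U i g)\<^sup>2 \<partial>gauss_array) \<le> cav_dev_rate \<beta> h * s"
      unfolding s_def by (rule weighted_overlap_dev_le[OF U n1])
    show "1 / n \<le> s"
      unfolding s_def using U by (auto intro!: Bochner_Integration.integral_nonneg overlap_dev_nonneg)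
  qed auto
  also have "\<dots> \<le> \<beta>\<^sup>2 * (cav_dev_rate \<beta> h + 1) * s"
  proof -
    have "0 \<le> cav_dev_rate \<beta> h" by (simp add: cav_dev_rate_def weight_bound_nonneg)
    moreover have "0 \<le> s" unfolding s_def
      using U n1 by (auto intro!: add_nonneg_nonneg Bochner_Integration.integral_nonneg overlap_dev_nonneg)
    ultimately have "0 \<le> \<beta>\<^sup>2 * (cav_dev_rate \<beta> h * s)" by simp
    then show ?thesis by (simp add: algebra_simps)
  qed
  finally show ?thesis .
qed

lemma overlap_dev_removed_le:
  fixes n \<beta> h q :: real
  assumes U: "finite U" "i \<notin> U" and n: "n = real (card (insert i U))" and q: "0 \<le> q" "q \<le> 1"
  defines "s \<equiv> sqrt (\<integral>g. overlap_dev n \<beta> h (insert i U) q g \<partial>gauss_array) + 1 / n"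
  shows "(\<integral>g. overlap_dev n \<beta> h U q g \<partial>gauss_array) \<le> cav_dev_rate \<beta> h * s"
proof -
  have n1: "n \<ge> 1" "real (card U) \<le> n"
    using U unfolding n by auto
  let ?A = "\<lambda>g. gavg (\<beta> / sqrt (2 * n)) h U g"
  have path: "overlap_dev n \<beta> h U q g \<le> old_overlap_dev n \<beta> h q U i g * (cav_weight n \<beta> h U i g)\<^sup>2" for g
  proof -
    have "overlap_dev n \<beta> h U q g \<le> ?A g (\<lambda>\<sigma>. ?A g (\<lambda>\<tau>. 2 * \<bar>olap n U \<sigma> \<tau> - q\<bar>))"
      unfolding overlap_dev_def
    proof (intro gavg_mono U)
      fix \<sigma> \<tau> assume "\<sigma> \<in> spins U" "\<tau> \<in> spins U"
      then have "\<bar>olap n U \<sigma> \<tau>\<bar> \<le> 1" using U n1 by (intro abs_olap_le) auto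
      then have "\<bar>olap n U \<sigma> \<tau> - q\<bar> \<le> 2" using q by linarith
      then have "\<bar>olap n U \<sigma> \<tau> - q\<bar> * \<bar>olap n U \<sigma> \<tau> - q\<bar> \<le> 2 * \<bar>olap n U \<sigma> \<tau> - q\<bar>"
        by (intro mult_right_mono) auto
      then show "(olap n U \<sigma> \<tau> - q)\<^sup>2 \<le> 2 * \<bar>olap n U \<sigma> \<tau> - q\<bar>" by (simp add: power2_eq_square)
    qed
    also have "\<dots> = 2 * ?A g (\<lambda>\<sigma>. ?A g (\<lambda>\<tau>. \<bar>olap n U \<sigma> \<tau> - q\<bar>))" by (simp only: gavg_linear)
    also have "\<dots> \<le> 2 * (old_overlap_dev n \<beta> h q U i g * (cav_weight n \<beta> h U i g)\<^sup>2 / 4)"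
      by (intro mult_left_mono overlap_transfer(1) U) auto
    also have "\<dots> \<le> old_overlap_dev n \<beta> h q U i g * (cav_weight n \<beta> h U i g)\<^sup>2"
      using old_overlap_dev_nonneg[OF U(1), of n \<beta> h q i g] by simp
    finally show ?thesis .
  qed
  have "(\<integral>g. overlap_dev n \<beta> h U q g \<partial>gauss_array)
      \<le> (\<integral>g. old_overlap_dev n \<beta> h q U i g * (cav_weight n \<beta> h U i g)\<^sup>2 \<partial>gauss_array)"
    using U by (intro expectation_mono path tame_overlap_dev tame_weighted_overlap_dev) auto
  also have "\<dots> \<le> cav_dev_rate \<beta> h * s"
    unfolding s_def by (rule weighted_overlap_dev_le[OF U n1])
  finally show ?thesis .
qed

section \<open>Functions of the magnetizations\<close>

lemma abs_diff_le_of_deriv: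
  fixes f :: "real \<Rightarrow> real"
  assumes "\<And>x. (f has_real_derivative f' x) (at x)" "\<And>x. \<bar>f' x\<bar> \<le> 1"
  shows "\<bar>f x - f y\<bar> \<le> \<bar>x - y\<bar>"
  using field_differentiable_bound[of UNIV f f' 1 x y] assms by auto

lemma tanh_lipschitz: "\<bar>tanh x - tanh y\<bar> \<le> \<bar>x - y\<bar>" for x y :: real
proof (rule abs_diff_le_of_deriv)
  show "(tanh has_real_derivative 1 - (tanh x)\<^sup>2) (at x)" for x :: real
    by (auto intro!: derivative_eq_intros)
  show "\<bar>1 - (tanh x)\<^sup>2\<bar> \<le> 1" for x :: real
    using tanh_real_bounds[of x] by (simp add: abs_le_iff abs_square_le_1)
qed

lemma ln_cosh_lipschitz: "\<bar>ln (2 * cosh x) - ln (2 * cosh y)\<bar> \<le> \<bar>x - y\<bar>" for x y :: real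
proof (rule abs_diff_le_of_deriv)
  show "((\<lambda>x. ln (2 * cosh x)) has_real_derivative tanh x) (at x)" for x :: real
    by (auto intro!: derivative_eq_intros simp: tanh_def)
  show "\<bar>tanh x\<bar> \<le> 1" for x :: real
    using tanh_real_bounds[of x] by (simp add: abs_le_iff)
qed

text \<open>A modulus of continuity that combines well with second moments. Lipschitz functions and
  continuous functions on a compact interval have one for every \<open>a > 0\<close>.\<close>

definition quadratic_modulus :: "(real \<Rightarrow> real) \<Rightarrow> real set \<Rightarrow> real \<Rightarrow> real \<Rightarrow> bool" where
  "quadratic_modulus f S a k \<longleftrightarrow> 0 \<le> a \<and> 0 \<le> k \<and> (\<forall>x\<in>S. \<forall>y\<in>S. \<bar>f x - f y\<bar> \<le> a + k * (x - y)\<^sup>2)"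

lemma quadratic_modulusD: "quadratic_modulus f S a k \<Longrightarrow> x \<in> S \<Longrightarrow> y \<in> S \<Longrightarrow> \<bar>f x - f y\<bar> \<le> a + k * (x - y)\<^sup>2"
  "quadratic_modulus f S a k \<Longrightarrow> 0 \<le> a" "quadratic_modulus f S a k \<Longrightarrow> 0 \<le> k"
  unfolding quadratic_modulus_def by auto

lemma continuous_bounded_on_interval:
  fixes f :: "real \<Rightarrow> real"
  assumes "continuous_on {-1..1} f"
  shows "\<exists>B. \<forall>x\<in>{-1..1}. \<bar>f x\<bar> \<le> B"
proof -
  have "bounded (f ` {-1..1})"
    by (intro compact_imp_bounded compact_continuous_image assms compact_Icc)
  then show ?thesis unfolding bounded_iff by auto
qed

lemma quadratic_modulus_of_continuous:
  assumes cont: "continuous_on {-1..1} f" and a: "a > 0"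
  shows "\<exists>k. quadratic_modulus f {-1..1} a k"
proof -
  obtain B where B: "\<And>x. x \<in> {-1..1} \<Longrightarrow> \<bar>f x\<bar> \<le> B"
    using continuous_bounded_on_interval[OF cont] by blast
  have "uniformly_continuous_on {-1..1} f" by (rule compact_uniformly_continuous[OF cont compact_Icc])
  then obtain d where d: "d > 0" "\<And>x y. x \<in> {-1..1} \<Longrightarrow> y \<in> {-1..1} \<Longrightarrow> dist x y < d \<Longrightarrow> dist (f x) (f y) < a"
    using a unfolding uniformly_continuous_on_def by blast
  have B0: "0 \<le> B" using B[of 0] by auto
  have "\<bar>f x - f y\<bar> \<le> a + 2 * B / d\<^sup>2 * (x - y)\<^sup>2" if "x \<in> {-1..1}" "y \<in> {-1..1}" for x y
  proof (cases "\<bar>x - y\<bar> < d")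
    case True
    then have "\<bar>f x - f y\<bar> \<le> a" using d(2)[of x y] that by (simp add: dist_real_def)
    moreover have "0 \<le> 2 * B / d\<^sup>2 * (x - y)\<^sup>2" using B0 by simp
    ultimately show ?thesis by linarith
  next
    case False
    then have "d\<^sup>2 \<le> (x - y)\<^sup>2" using d(1) power_mono[of d "\<bar>x - y\<bar>" 2] by simp
    then have "2 * B / d\<^sup>2 * d\<^sup>2 \<le> 2 * B / d\<^sup>2 * (x - y)\<^sup>2" using B0 by (intro mult_left_mono) auto
    moreover have "2 * B / d\<^sup>2 * d\<^sup>2 = 2 * B" using d(1) by simp
    moreover have "\<bar>f x - f y\<bar> \<le> 2 * B" using B[OF that(1)] B[OF that(2)] by linarith
    ultimately show ?thesis using a by linarith
  qed
  then show ?thesis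
    using a B0 by (intro exI[of _ "2 * B / d\<^sup>2"]) (auto simp: quadratic_modulus_def)
qed

lemma quadratic_modulus_of_lipschitz:
  assumes "\<And>x y. \<bar>f x - f y\<bar> \<le> \<bar>x - y\<bar>" and a: "a > 0"
  shows "quadratic_modulus f UNIV a (1 / (4 * a))"
proof -
  have "\<bar>f x - f y\<bar> \<le> a + 1 / (4 * a) * (x - y)\<^sup>2" for x y
    using abs_mult_le_weighted[of "2 * a" 1 "x - y"] a assms(1)[of x y] by simp
  then show ?thesis using a by (simp add: quadratic_modulus_def)
qed

lemma expectation_resample_abs_le:
  assumes "tame F" "tame D" "\<And>x. \<bar>\<integral>y. F (override_on x y J) \<partial>gauss_array\<bar> \<le> D x"
  shows "\<bar>\<integral>x. F x \<partial>gauss_array\<bar> \<le> (\<integral>x. D x \<partial>gauss_array)"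
proof (rule abs_leI)
  show "(\<integral>x. F x \<partial>gauss_array) \<le> (\<integral>x. D x \<partial>gauss_array)"
    by (rule expectation_resample_le[OF assms(1,2)]) (rule order_trans[OF abs_ge_self assms(3)])
  have "(\<integral>x. - F x \<partial>gauss_array) \<le> (\<integral>x. D x \<partial>gauss_array)"
  proof (rule expectation_resample_le[OF tame_uminus[OF assms(1)] assms(2)])
    show "(\<integral>y. - F (override_on x y J) \<partial>gauss_array) \<le> D x" for x
      using assms(3)[of x] by simp
  qed
  then show "- (\<integral>x. F x \<partial>gauss_array) \<le> (\<integral>x. D x \<partial>gauss_array)" by simp
qed

text \<open>Given the bonds of the smaller system, the mean cavity field is centered Gaussian with variance
  close to \<open>\<beta>\<^sup>2 * q\<close>; a factor that depends only on those bonds can be taken out.\<close>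

lemma cav_mean_decouple:
  assumes U: "finite U" "i \<notin> U" and n: "n > 0" "real (card U) \<le> n" and q: "0 \<le> q" "q \<le> 1"
    and F: "continuous_on UNIV F" "quadratic_modulus F UNIV a k"
    and tF: "tame (\<lambda>g. F (cav_mean n \<beta> h U i g))"
    and \<Theta>: "tame \<Theta>" "\<And>x y. \<Theta> (override_on x y (cross_bonds U i)) = \<Theta> x"
  shows "\<bar>\<integral>g. \<Theta> g * (F (cav_mean n \<beta> h U i g) - (\<integral>t. F (sqrt (\<beta>\<^sup>2 * q) * t) \<partial>std_normal_distribution)) \<partial>gauss_array\<bar>
    \<le> (\<integral>g. \<bar>\<Theta> g\<bar> * (a + k * cav_spread n \<beta> h q U g) \<partial>gauss_array)"
proof (rule expectation_resample_abs_le[where J = "cross_bonds U i"])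
  let ?s = "\<integral>t. F (sqrt (\<beta>\<^sup>2 * q) * t) \<partial>std_normal_distribution"
  show "tame (\<lambda>g. \<Theta> g * (F (cav_mean n \<beta> h U i g) - ?s))"
    by (intro tame_mult tame_diff tF \<Theta> tame_const)
  show "tame (\<lambda>g. \<bar>\<Theta> g\<bar> * (a + k * cav_spread n \<beta> h q U g))"
    using U by (intro tame_mult tame_abs tame_add \<Theta> tame_const tame_cav_spread)
  fix x
  let ?J = "cross_bonds U i"
  have int: "integrable gauss_array (\<lambda>y. F (cav_mean n \<beta> h U i (override_on x y ?J)))"
    by (intro tame_integrable tame_resample[OF tF])
  have m: "F \<in> borel_measurable borel" using F(1) by (rule borel_measurable_continuous_onI)
  have "(\<integral>y. \<Theta> (override_on x y ?J) * (F (cav_mean n \<beta> h U i (override_on x y ?J)) - ?s) \<partial>gauss_array)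
      = \<Theta> x * ((\<integral>y. F (cav_mean n \<beta> h U i (override_on x y ?J)) \<partial>gauss_array) - ?s)"
    unfolding \<Theta>(2) using int by simp
  also have "\<bar>\<dots>\<bar> \<le> \<bar>\<Theta> x\<bar> * (a + k * cav_spread n \<beta> h q U x)"
    unfolding abs_mult
    using cav_mean_resampled[OF U n q, of 1 F a k \<beta> h x] m quadratic_modulusD[OF F(2)]
    by (intro mult_left_mono) auto
  finally show "\<bar>\<integral>y. \<Theta> (override_on x y ?J) * (F (cav_mean n \<beta> h U i (override_on x y ?J)) - ?s) \<partial>gauss_array\<bar>
    \<le> \<bar>\<Theta> x\<bar> * (a + k * cav_spread n \<beta> h q U x)" .
qed

definition mag :: "real \<Rightarrow> real \<Rightarrow> real \<Rightarrow> nat set \<Rightarrow> (nat \<times> nat \<Rightarrow> real) \<Rightarrow> nat \<Rightarrow> real" where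
  "mag n \<beta> h V g i = gavg (\<beta> / sqrt (2 * n)) h V g (\<lambda>\<sigma>. \<sigma> i)"

text \<open>The average over sites of a function of the magnetization, and its replica symmetric limit: a
  magnetization behaves like \<open>tanh\<close> of a Gaussian field of variance \<open>\<beta>\<^sup>2 * q\<close>.\<close>

definition mag_avg :: "(real \<Rightarrow> real) \<Rightarrow> real \<Rightarrow> real \<Rightarrow> real \<Rightarrow> nat set \<Rightarrow> (nat \<times> nat \<Rightarrow> real) \<Rightarrow> real" where
  "mag_avg \<phi> n \<beta> h V g = (\<Sum>i\<in>V. \<phi> (mag n \<beta> h V g i)) / n"

definition rs_mean :: "(real \<Rightarrow> real) \<Rightarrow> real \<Rightarrow> real \<Rightarrow> real \<Rightarrow> real" where
  "rs_mean \<phi> \<beta> h q = (\<integral>t. \<phi> (tanh (h + sqrt (\<beta>\<^sup>2 * q) * t)) \<partial>std_normal_distribution)"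

lemma mag_bounds: "finite V \<Longrightarrow> i \<in> V \<Longrightarrow> mag n \<beta> h V g i \<in> {-1..1}"
  unfolding mag_def using gavg_abs_le[of V "\<lambda>\<sigma>. \<sigma> i" 1 "\<beta> / sqrt (2 * n)" h g]
  by (auto simp: spins_abs abs_le_iff)

lemma tame_magnetization: "finite V \<Longrightarrow> tame (\<lambda>g. mag n \<beta> h V g i)"
  unfolding mag_def by (rule tame_gavg_const)

text \<open>The two cavity errors shift the argument of \<open>tanh\<close> by half of their difference; the common
  factor cancels.\<close>

lemma mag_insert:
  fixes n \<beta> h q :: real and g :: "nat \<times> nat \<Rightarrow> real"
  assumes U: "finite U" "i \<notin> U"
  shows "mag n \<beta> h (insert i U) g i
    = tanh (h + cav_mean n \<beta> h U i g + (cav_error 1 n \<beta> h q U i g - cav_error (-1) n \<beta> h q U i g) / 2)"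
  unfolding mag_def gavg_insert_spin[OF U] gavg_cosh_sinh(1)[OF U(1), where q = q] gavg_cosh_sinh(2)[OF U(1), where q = q]
  by (simp add: tanh_def)

lemma tanh_in: "tanh x \<in> {-1..1}" for x :: real
  using tanh_real_bounds[of x] by auto

lemma tame_bounded_continuous:
  fixes \<phi> :: "real \<Rightarrow> real"
  assumes \<phi>: "continuous_on {-1..1} \<phi>" and F: "tame F" and bnd: "\<And>g. F g \<in> {-1..1}"
  shows "tame (\<lambda>g. \<phi> (F g))"
proof -
  obtain B where B: "\<And>x. x \<in> {-1..1} \<Longrightarrow> \<bar>\<phi> x\<bar> \<le> B"
    using continuous_bounded_on_interval[OF \<phi>] by blast
  have "continuous_on UNIV (\<lambda>x. \<phi> (max (-1) (min 1 x)))"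
    by (rule continuous_on_compose2[OF \<phi>]) (auto intro!: continuous_intros)
  then have "(\<lambda>x. \<phi> (max (-1) (min 1 x))) \<in> borel_measurable borel"
    by (rule borel_measurable_continuous_onI)
  from measurable_compose[OF tame_measurable[OF F] this]
  have m: "(\<lambda>g. \<phi> (max (-1) (min 1 (F g)))) \<in> borel_measurable gauss_array" .
  have e: "\<phi> (max (-1) (min 1 (F g))) = \<phi> (F g)" for g
    using bnd[of g] by (simp add: min_absorb2)
  show ?thesis
    by (rule tame_bounded_by[OF m[unfolded e] tame_const[of B]], rule order_trans[OF B[OF bnd] abs_ge_self])
qed

locale mag_function =
  fixes \<phi> :: "real \<Rightarrow> real" and B a k :: real
  assumes \<phi>: "continuous_on {-1..1} \<phi>" and B: "\<And>x. x \<in> {-1..1} \<Longrightarrow> \<bar>\<phi> x\<bar> \<le> B"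
    and modulus: "quadratic_modulus \<phi> {-1..1} a k"
begin

lemma nonneg: "0 \<le> B" "0 \<le> a" "0 \<le> k"
  using B[of 0] quadratic_modulusD(2,3)[OF modulus] by auto

lemma tame_mag: "finite V \<Longrightarrow> i \<in> V \<Longrightarrow> tame (\<lambda>g. \<phi> (mag n \<beta> h V g i))"
  by (rule tame_bounded_continuous[OF \<phi> tame_magnetization mag_bounds])

lemma tame_mag_avg: "finite V \<Longrightarrow> tame (\<lambda>g. mag_avg \<phi> n \<beta> h V g)"
  unfolding mag_avg_def by (intro tame_divide_const tame_sum tame_mag)

lemma rs_mean_bound: "\<bar>rs_mean \<phi> \<beta> h q\<bar> \<le> B"
proof -
  have "continuous_on UNIV (\<lambda>t. \<phi> (tanh (h + sqrt (\<beta>\<^sup>2 * q) * t)))"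
    by (rule continuous_on_compose2[OF \<phi>]) (auto intro!: continuous_intros tanh_in simp: tanh_in[simplified])
  then have [measurable]: "(\<lambda>t. \<phi> (tanh (h + sqrt (\<beta>\<^sup>2 * q) * t))) \<in> borel_measurable borel"
    by (rule borel_measurable_continuous_onI)
  have int: "integrable std_normal_distribution (\<lambda>t. \<phi> (tanh (h + sqrt (\<beta>\<^sup>2 * q) * t)))"
    by (rule std_normal.integrable_const_bound[where B = B]) (use B[OF tanh_in] in auto)
  have "\<bar>rs_mean \<phi> \<beta> h q\<bar> \<le> (\<integral>t. \<bar>\<phi> (tanh (h + sqrt (\<beta>\<^sup>2 * q) * t))\<bar> \<partial>std_normal_distribution)"
    unfolding rs_mean_def by (rule integral_abs_bound)
  also have "\<dots> \<le> (\<integral>t. B \<partial>std_normal_distribution)"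
    by (intro integral_mono integrable_abs int std_normal.integrable_const B tanh_in)
  also have "\<dots> = B" using std_normal.prob_space by simp
  finally show ?thesis .
qed

text \<open>Replace the magnetization by \<open>tanh\<close> of the mean cavity field, then average over the bonds at \<open>i\<close>.\<close>

lemma mag_decouple:
  fixes n \<beta> h q :: real
  assumes U: "finite U" "i \<notin> U" and n: "n > 0" "real (card U) \<le> n" and q: "0 \<le> q" "q \<le> 1"
    and \<Theta>: "tame \<Theta>" "\<And>x y. \<Theta> (override_on x y (cross_bonds U i)) = \<Theta> x" "\<And>x. \<bar>\<Theta> x\<bar> \<le> T"
  shows "\<bar>\<integral>g. \<Theta> g * (\<phi> (mag n \<beta> h (insert i U) g i) - rs_mean \<phi> \<beta> h q) \<partial>gauss_array\<bar>
    \<le> T * (2 * a + k * (11 * exp (16 * \<beta>\<^sup>2) + 1) * (\<integral>g. cav_spread n \<beta> h q U g \<partial>gauss_array))"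
proof -
  let ?z = "cav_mean n \<beta> h U i" and ?p = "cav_error 1 n \<beta> h q U i" and ?m = "cav_error (-1) n \<beta> h q U i"
  let ?M = "\<lambda>g. mag n \<beta> h (insert i U) g i" and ?F = "\<lambda>u. \<phi> (tanh (h + u))"
  let ?S = "\<integral>g. cav_spread n \<beta> h q U g \<partial>gauss_array"
  have V: "finite (insert i U)" using U by simp
  have T: "0 \<le> T" using \<Theta>(3)[of undefined] by (rule order_trans[OF abs_ge_zero])
  have F: "continuous_on UNIV ?F"
    by (rule continuous_on_compose2[OF \<phi>]) (auto intro!: continuous_intros simp: tanh_in[simplified])
  have Fm: "quadratic_modulus ?F UNIV a k"
  proof -
    have "\<bar>?F u - ?F t\<bar> \<le> a + k * (u - t)\<^sup>2" for u t
    proof -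
      have "\<bar>?F u - ?F t\<bar> \<le> a + k * (tanh (h + u) - tanh (h + t))\<^sup>2"
        by (intro quadratic_modulusD(1)[OF modulus] tanh_in)
      also have "\<dots> \<le> a + k * (u - t)\<^sup>2"
        using tanh_lipschitz[of "h + u" "h + t"] nonneg
        by (intro add_left_mono mult_left_mono) (auto simp: abs_le_square_iff[symmetric])
      finally show ?thesis .
    qed
    then show ?thesis using nonneg by (auto simp: quadratic_modulus_def)
  qed
  have tz: "tame ?z" using U by (intro tame_cav_mean)
  have tF: "tame (\<lambda>g. ?F (?z g))"
  proof (rule tame_bounded_by[OF _ tame_const[of B]])
    show "(\<lambda>g. ?F (?z g)) \<in> borel_measurable gauss_array"
      using measurable_compose[OF tame_measurable[OF tz] borel_measurable_continuous_onI[OF F]] .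
    show "\<bar>?F (?z g)\<bar> \<le> \<bar>B\<bar>" for g using B[OF tanh_in, of "h + ?z g"] by linarith
  qed
  have tM: "tame (\<lambda>g. \<phi> (?M g))" by (rule tame_mag[OF V]) simp
  have tp: "tame ?p" and tm: "tame ?m" by (intro tame_cav_error U)+
  have ts: "tame (\<lambda>g. cav_spread n \<beta> h q U g)" using U by (intro tame_cav_spread)
  have ip: "integrable gauss_array (\<lambda>g. (?p g)\<^sup>2)" "integrable gauss_array (\<lambda>g. (?m g)\<^sup>2)"
    by (intro tame_integrable tame_power tp tm)+
  have 1: "\<bar>\<integral>g. \<Theta> g * (\<phi> (?M g) - ?F (?z g)) \<partial>gauss_array\<bar> \<le> T * (a + k * (11 * exp (16 * \<beta>\<^sup>2) * ?S))"
  proof -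
    have path: "\<bar>\<Theta> g * (\<phi> (?M g) - ?F (?z g))\<bar> \<le> T * (a + k * (((?p g)\<^sup>2 + (?m g)\<^sup>2) / 2))" for g
    proof -
      let ?d = "(?p g - ?m g) / 2"
      have M: "?M g = tanh (h + ?z g + ?d)" by (rule mag_insert[OF U])
      have "\<bar>\<phi> (?M g) - ?F (?z g)\<bar> \<le> a + k * (tanh (h + ?z g + ?d) - tanh (h + ?z g))\<^sup>2"
        unfolding M by (intro quadratic_modulusD(1)[OF modulus] tanh_in)
      also have "(tanh (h + ?z g + ?d) - tanh (h + ?z g))\<^sup>2 \<le> ?d\<^sup>2"
        using tanh_lipschitz[of "h + ?z g + ?d" "h + ?z g"] by (simp add: abs_le_square_iff[symmetric])
      also have "?d\<^sup>2 \<le> ((?p g)\<^sup>2 + (?m g)\<^sup>2) / 2"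
      proof -
        have "((x - y) / 2)\<^sup>2 \<le> (x\<^sup>2 + y\<^sup>2) / 2" for x y :: real
          using zero_le_power2[of "x + y"] unfolding power_divide power2_sum power2_diff by (simp add: field_simps)
        then show ?thesis .
      qed
      finally have "\<bar>\<phi> (?M g) - ?F (?z g)\<bar> \<le> a + k * (((?p g)\<^sup>2 + (?m g)\<^sup>2) / 2)"
        using nonneg by (simp add: mult_left_mono)
      then show ?thesis
        unfolding abs_mult using \<Theta>(3)[of g] T by (intro mult_mono) auto
    qed
    have "\<bar>\<integral>g. \<Theta> g * (\<phi> (?M g) - ?F (?z g)) \<partial>gauss_array\<bar> \<le> (\<integral>g. \<bar>\<Theta> g * (\<phi> (?M g) - ?F (?z g))\<bar> \<partial>gauss_array)"
      by (rule integral_abs_bound)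
    also have "\<dots> \<le> (\<integral>g. T * (a + k * (((?p g)\<^sup>2 + (?m g)\<^sup>2) / 2)) \<partial>gauss_array)"
      by (intro expectation_mono path tame_abs tame_mult tame_diff tame_add tame_const tame_divide_const tame_power \<Theta> tM tF tp tm)
    also have "\<dots> = T * (a + k * (((\<integral>g. (?p g)\<^sup>2 \<partial>gauss_array) + (\<integral>g. (?m g)\<^sup>2 \<partial>gauss_array)) / 2))"
      using ip by simp
    also have "\<dots> \<le> T * (a + k * ((11 * exp (16 * \<beta>\<^sup>2) * ?S + 11 * exp (16 * \<beta>\<^sup>2) * ?S) / 2))"
    proof -
      note mom = cav_error_second_moment[OF U n q, where \<beta> = \<beta> and h = h]
      show ?thesis using mom[of 1] mom[of "-1"] T nonneg
        by (intro mult_left_mono add_left_mono divide_right_mono add_mono) auto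
    qed
    also have "\<dots> = T * (a + k * (11 * exp (16 * \<beta>\<^sup>2) * ?S))"
    proof -
      have "(x + x) / 2 = x" for x :: real by simp
      then show ?thesis by (simp only:)
    qed
    finally show ?thesis .
  qed
  have 2: "\<bar>\<integral>g. \<Theta> g * (?F (?z g) - rs_mean \<phi> \<beta> h q) \<partial>gauss_array\<bar> \<le> T * (a + k * ?S)"
  proof -
    have "\<bar>\<integral>g. \<Theta> g * (?F (?z g) - rs_mean \<phi> \<beta> h q) \<partial>gauss_array\<bar>
        \<le> (\<integral>g. \<bar>\<Theta> g\<bar> * (a + k * cav_spread n \<beta> h q U g) \<partial>gauss_array)"
      using cav_mean_decouple[OF U n q F Fm tF \<Theta>(1,2)] unfolding rs_mean_def .
    also have "\<dots> \<le> (\<integral>g. T * (a + k * cav_spread n \<beta> h q U g) \<partial>gauss_array)"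
    proof (rule expectation_mono)
      fix g
      have "real (card U) / n \<le> 1" using n by simp
      then have "0 \<le> cav_spread n \<beta> h q U g"
        unfolding cav_spread_def using U by (intro add_nonneg_nonneg mult_nonneg_nonneg gavg_ge) auto
      then show "\<bar>\<Theta> g\<bar> * (a + k * cav_spread n \<beta> h q U g) \<le> T * (a + k * cav_spread n \<beta> h q U g)"
        using nonneg by (intro mult_right_mono \<Theta>(3)) auto
    qed (intro tame_mult tame_abs tame_add tame_const ts \<Theta>)+
    also have "\<dots> = T * (a + k * ?S)" using tame_integrable[OF ts] by simp
    finally show ?thesis .
  qed
  have "(\<integral>g. \<Theta> g * (\<phi> (?M g) - rs_mean \<phi> \<beta> h q) \<partial>gauss_array)
      = (\<integral>g. \<Theta> g * (\<phi> (?M g) - ?F (?z g)) + \<Theta> g * (?F (?z g) - rs_mean \<phi> \<beta> h q) \<partial>gauss_array)"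
    by (simp add: algebra_simps)
  also have "\<dots> = (\<integral>g. \<Theta> g * (\<phi> (?M g) - ?F (?z g)) \<partial>gauss_array) + (\<integral>g. \<Theta> g * (?F (?z g) - rs_mean \<phi> \<beta> h q) \<partial>gauss_array)"
    by (intro Bochner_Integration.integral_add tame_integrable tame_mult tame_diff tame_const \<Theta> tM tF)
  finally have "\<bar>\<integral>g. \<Theta> g * (\<phi> (?M g) - rs_mean \<phi> \<beta> h q) \<partial>gauss_array\<bar>
      \<le> T * (a + k * (11 * exp (16 * \<beta>\<^sup>2) * ?S)) + T * (a + k * ?S)"
    using 1 2 by linarith
  also have "\<dots> = T * (2 * a + k * (11 * exp (16 * \<beta>\<^sup>2) + 1) * ?S)" by (simp add: algebra_simps)
  finally show ?thesis .
qed

text \<open>The variance is a double sum over sites. For each site \<open>i\<close> the other factor hardly changes when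
  \<open>i\<close> is removed, and then it no longer depends on the bonds at \<open>i\<close>.\<close>

lemma mag_avg_concentration:
  fixes n \<beta> h q :: real
  assumes V: "finite V" "V \<noteq> {}" and n: "n = real (card V)" and q: "0 \<le> q" "q \<le> 1"
  defines "s \<equiv> sqrt (\<integral>g. overlap_dev n \<beta> h V q g \<partial>gauss_array) + 1 / n"
  shows "(\<integral>g. (mag_avg \<phi> n \<beta> h V g - rs_mean \<phi> \<beta> h q)\<^sup>2 \<partial>gauss_array)
    \<le> 2 * B * (3 * a + (B + k * cav_dev_rate \<beta> h
         + k * (11 * exp (16 * \<beta>\<^sup>2) + 1) * (\<beta>\<^sup>2 * (cav_dev_rate \<beta> h + 1))) * s)"
proof -
  let ?r = "rs_mean \<phi> \<beta> h q" and ?S = "\<lambda>g. mag_avg \<phi> n \<beta> h V g"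
  let ?C = "11 * exp (16 * \<beta>\<^sup>2) + 1 :: real" and ?R = "\<beta>\<^sup>2 * (cav_dev_rate \<beta> h + 1)"
  have n1: "n \<ge> 1" using V n by (simp add: Suc_le_eq card_gt_0_iff)
  have s: "1 / n \<le> s" "0 \<le> s"
  proof -
    have "0 \<le> (\<integral>g. overlap_dev n \<beta> h V q g \<partial>gauss_array)"
      by (intro Bochner_Integration.integral_nonneg overlap_dev_nonneg V)
    then show "1 / n \<le> s" unfolding s_def by simp
    then show "0 \<le> s" using n1 order_trans[of 0 "1 / n" s] by simp
  qed
  have tS: "tame ?S" by (rule tame_mag_avg[OF V(1)])
  have one: "(\<integral>g. (?S g - ?r) * (\<phi> (mag n \<beta> h V g i) - ?r) \<partial>gauss_array)
      \<le> 2 * B * (3 * a + (B + k * cav_dev_rate \<beta> h + k * ?C * ?R) * s)" if i: "i \<in> V" for i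
  proof -
    define U where "U = V - {i}"
    have U: "finite U" "i \<notin> U" and VU: "V = insert i U" using V i by (auto simp: U_def)
    have cU: "real (card U) \<le> n" using U unfolding n VU by simp
    let ?S' = "\<lambda>g. mag_avg \<phi> n \<beta> h U g"
    let ?f = "\<lambda>g. \<phi> (mag n \<beta> h V g i) - ?r"
    let ?Q = "\<lambda>g. old_overlap_dev n \<beta> h q U i g * (cav_weight n \<beta> h U i g)\<^sup>2"
    have tS': "tame ?S'" by (rule tame_mag_avg[OF U(1)])
    have tf: "tame ?f" by (intro tame_diff tame_mag V i tame_const)
    have tQ: "tame ?Q" by (rule tame_weighted_overlap_dev[OF U])
    have f: "\<bar>?f g\<bar> \<le> 2 * B" for g
      using B[OF mag_bounds[OF V(1) i, of n \<beta> h g]] rs_mean_bound[of \<beta> h q] by linarith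
    have S': "\<bar>?S' g\<bar> \<le> B" for g
    proof -
      have "\<bar>\<Sum>j\<in>U. \<phi> (mag n \<beta> h U g j)\<bar> \<le> (\<Sum>j\<in>U. B)"
        using mag_bounds[OF U(1)] B by (intro order_trans[OF sum_abs] sum_mono) auto
      also have "\<dots> \<le> n * B" using cU nonneg by (simp add: mult_right_mono)
      finally show ?thesis unfolding mag_avg_def using n1 by (simp add: abs_div pos_divide_le_eq mult.commute)
    qed
    have dS: "\<bar>?S g - ?S' g\<bar> \<le> B / n + a + k * ?Q g" for g
    proof -
      let ?m = "mag n \<beta> h V g" and ?m' = "mag n \<beta> h U g"
      have "\<bar>(\<Sum>j\<in>U. \<phi> (?m j) - \<phi> (?m' j))\<bar> \<le> (\<Sum>j\<in>U. a + k * (?m j - ?m' j)\<^sup>2)"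
        using mag_bounds[OF U(1)] mag_bounds[OF V(1)] VU
        by (intro order_trans[OF sum_abs] sum_mono quadratic_modulusD(1)[OF modulus]) auto
      also have "\<dots> = real (card U) * a + k * (\<Sum>j\<in>U. (?m j - ?m' j)\<^sup>2)"
        by (simp add: sum.distrib sum_distrib_left)
      also have "(\<Sum>j\<in>U. (?m j - ?m' j)\<^sup>2) = n * ((\<Sum>j\<in>U. (?m j - ?m' j)\<^sup>2) / n)" using n1 by simp
      also have "(\<Sum>j\<in>U. (?m j - ?m' j)\<^sup>2) / n \<le> ?Q g"
        using magnetization_transfer[OF U, where n = n and \<beta> = \<beta> and h = h and g = g and q = q] unfolding mag_def VU .
      finally have 1: "\<bar>\<Sum>j\<in>U. \<phi> (?m j) - \<phi> (?m' j)\<bar> \<le> n * a + k * (n * ?Q g)"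
        using mult_right_mono[OF cU nonneg(2)] nonneg n1 by (simp add: mult_left_mono)
      have "?S g - ?S' g = (\<phi> (?m i) + (\<Sum>j\<in>U. \<phi> (?m j) - \<phi> (?m' j))) / n"
        unfolding mag_avg_def using U VU by (simp add: sum_subtractf diff_divide_distrib add_divide_distrib)
      also have "\<bar>\<dots>\<bar> \<le> (B + (n * a + k * (n * ?Q g))) / n"
        unfolding abs_divide using 1 B[OF mag_bounds[OF V(1) i, of n \<beta> h g]] n1
        by (intro frac_le) auto
      also have "\<dots> = B / n + a + k * ?Q g" using n1 by (simp add: add_divide_distrib)
      finally show ?thesis .
    qed
    have Q: "(\<integral>g. ?Q g \<partial>gauss_array) \<le> cav_dev_rate \<beta> h * s"
      unfolding s_def VU by (rule weighted_overlap_dev_le[OF U n1 cU])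
    have "(\<integral>g. (?S g - ?S' g) * ?f g \<partial>gauss_array) \<le> (\<integral>g. (B / n + a + k * ?Q g) * (2 * B) \<partial>gauss_array)"
    proof (rule expectation_mono)
      fix g
      have "\<bar>?S g - ?S' g\<bar> * \<bar>?f g\<bar> \<le> (B / n + a + k * ?Q g) * (2 * B)"
        using dS[of g] f[of g] order_trans[OF abs_ge_zero dS[of g]] by (intro mult_mono) auto
      then show "(?S g - ?S' g) * ?f g \<le> (B / n + a + k * ?Q g) * (2 * B)"
        using abs_ge_self[of "(?S g - ?S' g) * ?f g"] by (simp only: abs_mult)
    qed (intro tame_mult tame_diff tame_add tame_const tS tS' tf tQ)+
    also have "\<dots> = (B / n + a + k * (\<integral>g. ?Q g \<partial>gauss_array)) * (2 * B)"
      using tame_integrable[OF tQ] by simp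
    also have "\<dots> \<le> (B * s + a + k * (cav_dev_rate \<beta> h * s)) * (2 * B)"
    proof (intro mult_right_mono add_mono mult_left_mono Q)
      show "B / n \<le> B * s" using s nonneg mult_left_mono[of "1 / n" s B] by simp
    qed (use nonneg in auto)
    finally have 1: "(\<integral>g. (?S g - ?S' g) * ?f g \<partial>gauss_array) \<le> (B * s + a + k * (cav_dev_rate \<beta> h * s)) * (2 * B)" .
    have "\<bar>\<integral>g. (?S' g - ?r) * ?f g \<partial>gauss_array\<bar>
        \<le> 2 * B * (2 * a + k * ?C * (\<integral>g. cav_spread n \<beta> h q U g \<partial>gauss_array))"
      unfolding VU
    proof (rule mag_decouple[OF U _ cU q])
      show "0 < n" using n1 by simp
      show "tame (\<lambda>g. ?S' g - ?r)" by (intro tame_diff tS' tame_const)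
      show "?S' (override_on x y (cross_bonds U i)) - ?r = ?S' x - ?r" for x y
        by (simp add: mag_avg_def mag_def gavg_override_cross[OF U(2)])
      show "\<bar>?S' x - ?r\<bar> \<le> 2 * B" for x using S'[of x] rs_mean_bound[of \<beta> h q] by linarith
    qed
    also have "\<dots> \<le> 2 * B * (2 * a + k * ?C * (?R * s))"
    proof -
      have "(\<integral>g. cav_spread n \<beta> h q U g \<partial>gauss_array) \<le> ?R * s"
        unfolding s_def VU by (rule cav_spread_mean_le[OF U n[unfolded VU]])
      then show ?thesis using nonneg by (intro mult_left_mono add_left_mono) auto
    qed
    finally have 2: "(\<integral>g. (?S' g - ?r) * ?f g \<partial>gauss_array) \<le> 2 * B * (2 * a + k * ?C * (?R * s))"
      by linarith
    have "(\<integral>g. (?S g - ?r) * ?f g \<partial>gauss_array) = (\<integral>g. (?S g - ?S' g) * ?f g + (?S' g - ?r) * ?f g \<partial>gauss_array)"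
      by (intro Bochner_Integration.integral_cong refl) (simp add: left_diff_distrib)
    also have "\<dots> = (\<integral>g. (?S g - ?S' g) * ?f g \<partial>gauss_array) + (\<integral>g. (?S' g - ?r) * ?f g \<partial>gauss_array)"
      by (intro Bochner_Integration.integral_add tame_integrable tame_mult tame_diff tame_const tS tS' tf)
    also have "\<dots> \<le> (B * s + a + k * (cav_dev_rate \<beta> h * s)) * (2 * B) + 2 * B * (2 * a + k * ?C * (?R * s))"
      by (rule add_mono[OF 1 2])
    also have "\<dots> = 2 * B * (3 * a + (B + k * cav_dev_rate \<beta> h + k * ?C * ?R) * s)"
    proof -
      have "(B * s + a + k * (R * s)) * (2 * B) + 2 * B * (2 * a + k * C * (R' * s))
          = 2 * B * (3 * a + (B + k * R + k * C * R') * s)" for R C R' :: real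
        by (simp add: algebra_simps)
      then show ?thesis .
    qed
    finally show ?thesis .
  qed
  have "(\<integral>g. (?S g - ?r)\<^sup>2 \<partial>gauss_array) = (\<integral>g. (\<Sum>i\<in>V. (?S g - ?r) * (\<phi> (mag n \<beta> h V g i) - ?r)) / n \<partial>gauss_array)"
  proof (intro Bochner_Integration.integral_cong refl)
    fix g
    have "(\<Sum>i\<in>V. \<phi> (mag n \<beta> h V g i) - ?r) = n * (?S g - ?r)"
      unfolding mag_avg_def using n n1 by (simp add: sum_subtractf right_diff_distrib)
    then show "(?S g - ?r)\<^sup>2 = (\<Sum>i\<in>V. (?S g - ?r) * (\<phi> (mag n \<beta> h V g i) - ?r)) / n"
      using n1 by (simp only: sum_distrib_left[symmetric]) (simp add: power2_eq_square)
  qed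
  also have "\<dots> = (\<Sum>i\<in>V. \<integral>g. (?S g - ?r) * (\<phi> (mag n \<beta> h V g i) - ?r) \<partial>gauss_array) / n"
  proof -
    have "integrable gauss_array (\<lambda>g. (?S g - ?r) * (\<phi> (mag n \<beta> h V g i) - ?r))" if "i \<in> V" for i
      by (intro tame_integrable tame_mult tame_diff tame_const tS tame_mag V that)
    then show ?thesis by (simp only: Bochner_Integration.integral_divide_zero Bochner_Integration.integral_sum)
  qed
  also have "\<dots> \<le> (\<Sum>i\<in>V. 2 * B * (3 * a + (B + k * cav_dev_rate \<beta> h + k * ?C * ?R) * s)) / n"
    using n1 by (intro divide_right_mono sum_mono one) auto
  also have "\<dots> = 2 * B * (3 * a + (B + k * cav_dev_rate \<beta> h + k * ?C * ?R) * s)"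
    using n n1 by simp
  finally show ?thesis .
qed

end

lemma mag_avg_tendsto:
  fixes \<phi> :: "real \<Rightarrow> real"
  assumes \<phi>: "continuous_on {-1..1} \<phi>" and q: "0 \<le> q" "q \<le> 1"
    and conv: "(\<lambda>N. \<integral>g. overlap_dev (real N) \<beta> h {1..N} q g \<partial>gauss_array) \<longlonglongrightarrow> 0"
  shows "(\<lambda>N. \<integral>g. (mag_avg \<phi> (real N) \<beta> h {1..N} g - rs_mean \<phi> \<beta> h q)\<^sup>2 \<partial>gauss_array) \<longlonglongrightarrow> 0"
proof -
  obtain B where B: "\<And>x. x \<in> {-1..1} \<Longrightarrow> \<bar>\<phi> x\<bar> \<le> B"
    using continuous_bounded_on_interval[OF \<phi>] by blast
  have B0: "0 \<le> B" using B[of 0] by auto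
  let ?s = "\<lambda>N. sqrt (\<integral>g. overlap_dev (real N) \<beta> h {1..N} q g \<partial>gauss_array) + 1 / real N"
  have "(\<lambda>N. sqrt (\<integral>g. overlap_dev (real N) \<beta> h {1..N} q g \<partial>gauss_array)) \<longlonglongrightarrow> sqrt 0"
    by (rule tendsto_real_sqrt[OF conv])
  from tendsto_add[OF this lim_1_over_n] have s: "?s \<longlonglongrightarrow> 0" by simp
  show ?thesis
  proof (rule LIMSEQ_I)
    fix e :: real assume e: "e > 0"
    \<comment> \<open>The bound of the preceding lemma contains \<open>6 * B * a\<close>, which is to be at most \<open>e / 2\<close>.\<close>
    define a where "a = e / (12 * (B + 1))"
    have a: "a > 0" unfolding a_def using e B0 by simp
    obtain k where k: "quadratic_modulus \<phi> {-1..1} a k"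
      using quadratic_modulus_of_continuous[OF \<phi> a] by blast
    interpret mag_function \<phi> B a k by unfold_locales (use \<phi> B k in auto)
    define K where "K = 2 * B * (B + k * cav_dev_rate \<beta> h
         + k * (11 * exp (16 * \<beta>\<^sup>2) + 1) * (\<beta>\<^sup>2 * (cav_dev_rate \<beta> h + 1)))"
    have "(\<lambda>N. K * ?s N) \<longlonglongrightarrow> K * 0" by (intro tendsto_mult tendsto_const s)
    then have "\<forall>\<^sub>F N in sequentially. K * ?s N < e / 2"
      using e by (intro order_tendstoD(2)) auto
    moreover have "\<forall>\<^sub>F N in sequentially. (1::nat) \<le> N" by (rule eventually_ge_at_top)
    ultimately have "\<forall>\<^sub>F N in sequentially.
        norm ((\<integral>g. (mag_avg \<phi> (real N) \<beta> h {1..N} g - rs_mean \<phi> \<beta> h q)\<^sup>2 \<partial>gauss_array) - 0) < e"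
    proof eventually_elim
      case (elim N)
      have "(\<integral>g. (mag_avg \<phi> (real N) \<beta> h {1..N} g - rs_mean \<phi> \<beta> h q)\<^sup>2 \<partial>gauss_array) \<le> 6 * B * a + K * ?s N"
        using mag_avg_concentration[of "{1..N}" "real N" q \<beta> h] elim q unfolding K_def
        by (simp add: algebra_simps)
      moreover have "6 * B * a \<le> e / 2"
      proof -
        have "6 * B * a \<le> 6 * (B + 1) * a" using a by simp
        also have "\<dots> = e / 2" unfolding a_def using B0 by (simp add: field_simps)
        finally show ?thesis .
      qed
      moreover have "0 \<le> (\<integral>g. (mag_avg \<phi> (real N) \<beta> h {1..N} g - rs_mean \<phi> \<beta> h q)\<^sup>2 \<partial>gauss_array)"
        by simp
      moreover have "norm (x - 0) < e" if "x \<le> y + z" "y \<le> e / 2" "0 \<le> x" "z < e / 2" for x y z :: real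
        using that by simp
      ultimately show ?case using elim(1) by blast
    qed
    then show "\<exists>no. \<forall>N\<ge>no. norm ((\<integral>g. (mag_avg \<phi> (real N) \<beta> h {1..N} g - rs_mean \<phi> \<beta> h q)\<^sup>2 \<partial>gauss_array) - 0) < e"
      unfolding eventually_sequentially .
  qed
qed

section \<open>The free energy\<close>

definition L2 :: "(('k \<Rightarrow> real) \<Rightarrow> real) \<Rightarrow> real" where
  "L2 F = sqrt (\<integral>x. (F x)\<^sup>2 \<partial>gauss_array)"

lemma L2_nonneg: "0 \<le> L2 F"
  unfolding L2_def by simp

lemma L2_square: "(L2 F)\<^sup>2 = (\<integral>x. (F x)\<^sup>2 \<partial>gauss_array)"
  unfolding L2_def by simp

lemma L2_const: "L2 (\<lambda>_ :: 'k \<Rightarrow> real. a) = \<bar>a\<bar>"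
  unfolding L2_def by simp

lemma L2_cmult: "L2 (\<lambda>x. a * F x) = \<bar>a\<bar> * L2 F"
  unfolding L2_def by (simp add: power_mult_distrib real_sqrt_mult)

lemma L2_Cauchy_Schwarz: "tame F \<Longrightarrow> tame G \<Longrightarrow> \<bar>\<integral>x. F x * G x \<partial>gauss_array\<bar> \<le> L2 F * L2 G"
  unfolding L2_def by (rule gauss_Cauchy_Schwarz)

lemma L2_mono: "tame F \<Longrightarrow> tame G \<Longrightarrow> (\<And>x. \<bar>F x\<bar> \<le> G x) \<Longrightarrow> L2 F \<le> L2 G"
  unfolding L2_def
  by (intro real_sqrt_le_mono expectation_mono tame_power)
     (auto simp: abs_le_square_iff[symmetric] intro: order_trans[OF _ abs_ge_self])

lemma expectation_square_add:
  assumes F: "tame F" and G: "tame G"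
  shows "(\<integral>x. (F x + G x)\<^sup>2 \<partial>gauss_array)
    = (\<integral>x. (F x)\<^sup>2 \<partial>gauss_array) + 2 * (\<integral>x. F x * G x \<partial>gauss_array) + (\<integral>x. (G x)\<^sup>2 \<partial>gauss_array)"
proof -
  have "(\<integral>x. (F x + G x)\<^sup>2 \<partial>gauss_array) = (\<integral>x. (F x)\<^sup>2 + 2 * (F x * G x) + (G x)\<^sup>2 \<partial>gauss_array)"
    by (simp add: power2_eq_square algebra_simps)
  also have "\<dots> = (\<integral>x. (F x)\<^sup>2 \<partial>gauss_array) + 2 * (\<integral>x. F x * G x \<partial>gauss_array) + (\<integral>x. (G x)\<^sup>2 \<partial>gauss_array)"
    using tame_integrable[OF tame_power[OF F, of 2]] tame_integrable[OF tame_power[OF G, of 2]]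
      tame_integrable[OF tame_mult[OF F G]] by simp
  finally show ?thesis .
qed

lemma L2_triangle:
  assumes F: "tame F" and G: "tame G" shows "L2 (\<lambda>x. F x + G x) \<le> L2 F + L2 G"
proof -
  have "(\<integral>x. (F x + G x)\<^sup>2 \<partial>gauss_array) \<le> (L2 F)\<^sup>2 + 2 * (L2 F * L2 G) + (L2 G)\<^sup>2"
    unfolding expectation_square_add[OF F G] L2_square
    using order_trans[OF abs_ge_self L2_Cauchy_Schwarz[OF F G]] by simp
  also have "\<dots> = (L2 F + L2 G)\<^sup>2" by (simp add: power2_sum)
  finally have "(\<integral>x. (F x + G x)\<^sup>2 \<partial>gauss_array) \<le> (L2 F + L2 G)\<^sup>2" .
  then show ?thesis
    unfolding L2_def[of "\<lambda>x. F x + G x"] by (intro real_le_lsqrt add_nonneg_nonneg L2_nonneg)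
qed

lemma L2_triangle_diff: "tame F \<Longrightarrow> tame G \<Longrightarrow> L2 (\<lambda>x. F x - G x) \<le> L2 F + L2 G"
  using L2_triangle[of F "\<lambda>x. - G x"] by (auto simp: L2_def[of "\<lambda>x. - G x"] L2_def[of G])

lemma L2_coordinate: "L2 (\<lambda>x. x k) = 1"
  using expectation_coordinate[of "\<lambda>t. t\<^sup>2" k] std_normal_distribution_even_moments(1)[of 1]
  unfolding L2_def by simp

text \<open>For increments of bounded norm that are nearly uncorrelated with the past, squared norms add up
  as for a martingale, to order \<open>N\<close>. A drift of size \<open>r\<close> adds at most \<open>2 * r * N\<close> to the norm.\<close>

lemma sublinear_of_square_recursion:
  fixes v :: "nat \<Rightarrow> real"
  assumes v: "\<And>N. 0 \<le> v N"
    and rec: "\<And>r. r > 0 \<Longrightarrow> \<forall>\<^sub>F N in sequentially. (v (Suc N))\<^sup>2 \<le> (v N + r)\<^sup>2 + K\<^sup>2"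
  shows "(\<lambda>N. v N / real N) \<longlonglongrightarrow> 0"
proof (rule LIMSEQ_I)
  fix e :: real assume e: "e > 0"
  define r where "r = e / 4"
  have r: "r > 0" using e by (simp add: r_def)
  obtain N0 where N0: "\<And>N. N \<ge> N0 \<Longrightarrow> (v (Suc N))\<^sup>2 \<le> (v N + r)\<^sup>2 + K\<^sup>2"
    using rec[OF r] unfolding eventually_sequentially by blast
  \<comment> \<open>With this offset the extra slope \<open>r\<close> of the bound absorbs \<open>K\<^sup>2\<close> in every step.\<close>
  define M where "M = v N0 + K\<^sup>2 / (2 * r)"
  have M: "v N0 \<le> M" "K\<^sup>2 \<le> 2 * r * M" "0 \<le> M"
    using r v[of N0] by (auto simp: M_def distrib_left)
  have bound: "v (N0 + j) \<le> M + 2 * r * real j" for j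
  proof (induction j)
    case 0
    then show ?case using M by simp
  next
    case (Suc j)
    let ?x = "M + 2 * r * real j"
    have x: "0 \<le> ?x" using M r by simp
    have "(v (N0 + Suc j))\<^sup>2 \<le> (v (N0 + j) + r)\<^sup>2 + K\<^sup>2" using N0[of "N0 + j"] by simp
    also have "\<dots> \<le> (?x + r)\<^sup>2 + 2 * r * M"
      using Suc v[of "N0 + j"] r M by (intro add_mono power_mono) auto
    also have "\<dots> \<le> (?x + 2 * r)\<^sup>2"
    proof -
      have "2 * r * M \<le> 2 * r * ?x" using r by (intro mult_left_mono) auto
      moreover have "0 \<le> 3 * r\<^sup>2" by simp
      ultimately have "2 * r * M \<le> 2 * r * ?x + 3 * r\<^sup>2" by linarith
      also have "\<dots> = (?x + 2 * r)\<^sup>2 - (?x + r)\<^sup>2" by (simp add: power2_eq_square algebra_simps)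
      finally show ?thesis by simp
    qed
    finally have "v (N0 + Suc j) \<le> ?x + 2 * r" using x r by (intro power2_le_imp_le[of "v (N0 + Suc j)"]) auto
    then show ?case by (simp add: algebra_simps)
  qed
  have "(\<lambda>N. M / real N) \<longlonglongrightarrow> 0" by (rule lim_const_over_n)
  then have "\<forall>\<^sub>F N in sequentially. M / real N < e / 2" using e by (intro order_tendstoD(2)) auto
  moreover have "\<forall>\<^sub>F N in sequentially. max 1 N0 \<le> N" by (rule eventually_ge_at_top)
  ultimately have "\<forall>\<^sub>F N in sequentially. norm (v N / real N - 0) < e"
  proof eventually_elim
    case (elim N)
    have "v N \<le> M + 2 * r * real (N - N0)" using bound[of "N - N0"] elim(2) by simp
    also have "\<dots> \<le> M + 2 * r * real N" using r by (intro add_left_mono mult_left_mono) auto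
    finally have "v N / real N \<le> (M + 2 * r * real N) / real N" by (intro divide_right_mono) auto
    also have "\<dots> = M / real N + e / 2" using elim(2) by (simp add: add_divide_distrib r_def)
    finally have "v N / real N < e" using elim(1) by linarith
    then show ?case using v[of N] by simp
  qed
  then show "\<exists>no. \<forall>N\<ge>no. norm (v N / real N - 0) < e" unfolding eventually_sequentially .
qed

lemma ln_Zsum_diff_ge:
  assumes V: "finite V"
  shows "(c' - c) * gavg c h V g (pair_energy V g) \<le> ln (Zsum c' h V g) - ln (Zsum c h V g)"
proof -
  have "exp (gavg c h V g (\<lambda>\<sigma>. (c' - c) * pair_energy V g \<sigma>)) \<le> gavg c h V g (\<lambda>\<sigma>. exp ((c' - c) * pair_energy V g \<sigma>))"
    unfolding gavg_def by (rule positive_weights.exp_wavg_le[OF gibbs_weights[OF V]])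
  also have "\<dots> = Zsum c' h V g / Zsum c h V g"
    unfolding gavg_def wavg_def Zsum_def energy_def by (simp add: exp_add[symmetric] algebra_simps)
  finally have "ln (exp (gavg c h V g (\<lambda>\<sigma>. (c' - c) * pair_energy V g \<sigma>))) \<le> ln (Zsum c' h V g / Zsum c h V g)"
    using Zsum_pos[OF V] by (intro ln_mono) auto
  then show ?thesis
    using Zsum_pos[OF V, of c h g] Zsum_pos[OF V, of c' h g] by (simp add: ln_div gavg_linear)
qed

lemma site_energy_eq: "n \<noteq> 0 \<Longrightarrow> \<beta> / sqrt (2 * n) * gavg (\<beta> / sqrt (2 * n)) h V g (pair_energy V g) = n * site_energy n \<beta> h V g"
  unfolding site_energy_def by (simp only: gavg_linear) simp

text \<open>The convexity of \<open>ln Z\<close> in the coupling brackets the effect of changing the normalization from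
  \<open>N + 1\<close> to \<open>N\<close> between two derivatives, both of which are energies per site.\<close>

lemma renormalization_bracket:
  fixes \<beta> h :: real and N :: nat
  assumes N: "N \<ge> 1"
  defines "c \<equiv> \<beta> / sqrt (2 * real (Suc N))" and "c' \<equiv> \<beta> / sqrt (2 * real N)"
  shows "(sqrt (real (Suc N) / real N) - 1) * real (Suc N) * site_energy (real (Suc N)) \<beta> h {1..N} g
      \<le> ln (Zsum c' h {1..N} g) - ln (Zsum c h {1..N} g)" (is ?first)
    and "ln (Zsum c' h {1..N} g) - ln (Zsum c h {1..N} g)
      \<le> (1 - sqrt (real N / real (Suc N))) * real N * site_energy (real N) \<beta> h {1..N} g" (is ?second)
proof -
  have N': "real N > 0" using N by simp
  have "sqrt (real (Suc N) / real N) * c = c'" "sqrt (real N / real (Suc N)) * c' = c"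
    using N' by (simp_all add: c_def c'_def real_sqrt_divide real_sqrt_mult del: of_nat_Suc)
  then have c1: "c' - c = (sqrt (real (Suc N) / real N) - 1) * c"
    and c2: "c' - c = (1 - sqrt (real N / real (Suc N))) * c'"
    by (simp_all only: left_diff_distrib mult_1_left)
  have e1: "c * gavg c h {1..N} g (pair_energy {1..N} g) = real (Suc N) * site_energy (real (Suc N)) \<beta> h {1..N} g"
    unfolding c_def by (rule site_energy_eq) simp
  have e2: "c' * gavg c' h {1..N} g (pair_energy {1..N} g) = real N * site_energy (real N) \<beta> h {1..N} g"
    unfolding c'_def using N by (intro site_energy_eq) simp
  have "(c' - c) * gavg c h {1..N} g (pair_energy {1..N} g) \<le> ln (Zsum c' h {1..N} g) - ln (Zsum c h {1..N} g)"
    by (rule ln_Zsum_diff_ge) simp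
  then show ?first unfolding c1 mult.assoc e1 .
  have "(c - c') * gavg c' h {1..N} g (pair_energy {1..N} g) \<le> ln (Zsum c h {1..N} g) - ln (Zsum c' h {1..N} g)"
    by (rule ln_Zsum_diff_ge) simp
  then have "ln (Zsum c' h {1..N} g) - ln (Zsum c h {1..N} g) \<le> (c' - c) * gavg c' h {1..N} g (pair_energy {1..N} g)"
    by (simp add: left_diff_distrib)
  then show ?second unfolding c2 mult.assoc e2 .
qed

lemma renormalization_factors:
  "(\<lambda>N::nat. (sqrt (real (Suc N) / real N) - 1) * real (Suc N)) \<longlonglongrightarrow> 1 / 2"
  "(\<lambda>N::nat. (1 - sqrt (real N / real (Suc N))) * real N) \<longlonglongrightarrow> 1 / 2"
proof -
  have "(\<lambda>N. (real (Suc N) / real N) / (sqrt (real (Suc N) / real N) + 1)) \<longlonglongrightarrow> 1 / (sqrt 1 + 1)"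
    by (intro tendsto_intros LIMSEQ_Suc_n_over_n) simp
  then have 1: "(\<lambda>N. (real (Suc N) / real N) / (sqrt (real (Suc N) / real N) + 1)) \<longlonglongrightarrow> 1 / 2" by simp
  show "(\<lambda>N::nat. (sqrt (real (Suc N) / real N) - 1) * real (Suc N)) \<longlonglongrightarrow> 1 / 2"
  proof (rule Lim_transform_eventually[OF 1])
    show "\<forall>\<^sub>F N in sequentially. (real (Suc N) / real N) / (sqrt (real (Suc N) / real N) + 1)
        = (sqrt (real (Suc N) / real N) - 1) * real (Suc N)"
      using eventually_ge_at_top[of 1]
    proof eventually_elim
      case (elim N)
      let ?x = "real (Suc N) / real N"
      have "(sqrt ?x - 1) * (sqrt ?x + 1) = ?x - 1" by (simp add: algebra_simps)
      also have "\<dots> = 1 / real N" using elim by (simp add: field_simps)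
      finally have "(sqrt ?x - 1) * (sqrt ?x + 1) * real (Suc N) = ?x" by simp
      then have eq: "(sqrt ?x - 1) * real (Suc N) * (sqrt ?x + 1) = ?x" by (simp only: mult_ac)
      have "0 < sqrt ?x + 1" by (intro add_nonneg_pos) auto
      then show ?case by (intro nonzero_divide_eq_eq[THEN iffD2, OF _ eq[symmetric]]) simp
    qed
  qed
  have "(\<lambda>N. (real N / real (Suc N)) / (1 + sqrt (real N / real (Suc N)))) \<longlonglongrightarrow> 1 / (1 + sqrt 1)"
    by (intro tendsto_intros LIMSEQ_n_over_Suc_n) simp
  then have 2: "(\<lambda>N. (real N / real (Suc N)) / (1 + sqrt (real N / real (Suc N)))) \<longlonglongrightarrow> 1 / 2" by simp
  show "(\<lambda>N::nat. (1 - sqrt (real N / real (Suc N))) * real N) \<longlonglongrightarrow> 1 / 2"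
  proof (rule Lim_transform_eventually[OF 2], intro always_eventually allI)
    fix N
    let ?x = "real N / real (Suc N)"
    have "(1 - sqrt ?x) * (1 + sqrt ?x) = 1 - ?x" by (simp add: algebra_simps)
    also have "\<dots> = 1 / real (Suc N)" by (simp add: field_simps)
    finally have "(1 - sqrt ?x) * (1 + sqrt ?x) * real N = ?x" by simp
    then have eq: "(1 - sqrt ?x) * real N * (1 + sqrt ?x) = ?x" by (simp only: mult_ac)
    have "0 < 1 + sqrt ?x" by (intro add_pos_nonneg) auto
    then show "?x / (1 + sqrt ?x) = (1 - sqrt ?x) * real N"
      by (intro nonzero_divide_eq_eq[THEN iffD2, OF _ eq[symmetric]]) simp
  qed
qed

text \<open>The hypothesis on the overlap, for the product measure.\<close>

locale overlap_concentration =
  fixes \<beta> h q :: real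
  assumes q: "0 \<le> q" "q \<le> 1"
    and conv: "(\<lambda>N. \<integral>g. overlap_dev (real N) \<beta> h {1..N} q g \<partial>gauss_array) \<longlonglongrightarrow> 0"
begin

text \<open>All errors below are controlled by this quantity.\<close>

definition rate :: "nat \<Rightarrow> real" where
  "rate N = sqrt (\<integral>g. overlap_dev (real N) \<beta> h {1..N} q g \<partial>gauss_array) + 1 / real N"

lemma rate_tendsto: "rate \<longlonglongrightarrow> 0"
  unfolding rate_def[abs_def]
  using tendsto_add[OF tendsto_real_sqrt[OF conv] lim_1_over_n] by simp

definition energy_limit :: real where "energy_limit = \<beta>\<^sup>2 / 2 * (1 - q\<^sup>2)"

lemma site_energy_L2:
  "(\<lambda>N. L2 (\<lambda>g. site_energy (real N) \<beta> h {1..N} g - energy_limit)) \<longlonglongrightarrow> 0"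
  "(\<lambda>N. L2 (\<lambda>g. site_energy (real (Suc N)) \<beta> h {1..N} g - energy_limit)) \<longlonglongrightarrow> 0"
proof -
  have r: "(\<lambda>N. sqrt (energy_rate \<beta> * rate N)) \<longlonglongrightarrow> sqrt (energy_rate \<beta> * 0)"
    by (intro tendsto_real_sqrt tendsto_mult tendsto_const rate_tendsto)
  show "(\<lambda>N. L2 (\<lambda>g. site_energy (real N) \<beta> h {1..N} g - energy_limit)) \<longlonglongrightarrow> 0"
  proof (rule tendsto_sandwich[OF _ _ tendsto_const])
    show "\<forall>\<^sub>F N in sequentially. L2 (\<lambda>g. site_energy (real N) \<beta> h {1..N} g - energy_limit) \<le> sqrt (energy_rate \<beta> * rate N)"
      using eventually_ge_at_top[of 1]
    proof eventually_elim
      case (elim N)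
      then show ?case
        unfolding L2_def energy_limit_def rate_def
        by (intro real_sqrt_le_mono site_energy_concentration q) auto
    qed
    show "(\<lambda>N. sqrt (energy_rate \<beta> * rate N)) \<longlonglongrightarrow> 0" using r by simp
  qed (simp add: L2_nonneg)
  have r': "(\<lambda>N. sqrt (energy_rate \<beta> * (sqrt (cav_dev_rate \<beta> h * rate (Suc N)) + 1 / real (Suc N))))
      \<longlonglongrightarrow> sqrt (energy_rate \<beta> * (sqrt (cav_dev_rate \<beta> h * 0) + 0))"
    by (intro tendsto_real_sqrt tendsto_mult tendsto_add tendsto_const LIMSEQ_Suc[OF rate_tendsto] LIMSEQ_Suc[OF lim_1_over_n])
  show "(\<lambda>N. L2 (\<lambda>g. site_energy (real (Suc N)) \<beta> h {1..N} g - energy_limit)) \<longlonglongrightarrow> 0"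
  proof (rule tendsto_sandwich[OF _ _ tendsto_const])
    have "L2 (\<lambda>g. site_energy (real (Suc N)) \<beta> h {1..N} g - energy_limit)
        \<le> sqrt (energy_rate \<beta> * (sqrt (cav_dev_rate \<beta> h * rate (Suc N)) + 1 / real (Suc N)))" for N
    proof -
      have ins: "insert (Suc N) {1..N} = {1..Suc N}" by auto
      have "(\<integral>g. overlap_dev (real (Suc N)) \<beta> h {1..N} q g \<partial>gauss_array) \<le> cav_dev_rate \<beta> h * rate (Suc N)"
        using overlap_dev_removed_le[of "{1..N}" "Suc N" "real (Suc N)" q \<beta> h] q unfolding ins rate_def by simp
      then have "sqrt (\<integral>g. overlap_dev (real (Suc N)) \<beta> h {1..N} q g \<partial>gauss_array) + 1 / real (Suc N)
          \<le> sqrt (cav_dev_rate \<beta> h * rate (Suc N)) + 1 / real (Suc N)"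
        by (intro add_right_mono real_sqrt_le_mono)
      moreover have "0 \<le> energy_rate \<beta>"
        unfolding energy_rate_def energy_bound_def by (intro mult_nonneg_nonneg add_nonneg_nonneg) auto
      ultimately show ?thesis
        unfolding L2_def energy_limit_def
        by (intro real_sqrt_le_mono order_trans[OF site_energy_concentration] q mult_left_mono) auto
    qed
    then show "\<forall>\<^sub>F N in sequentially. L2 (\<lambda>g. site_energy (real (Suc N)) \<beta> h {1..N} g - energy_limit)
        \<le> sqrt (energy_rate \<beta> * (sqrt (cav_dev_rate \<beta> h * rate (Suc N)) + 1 / real (Suc N)))"
      by simp
    show "(\<lambda>N. sqrt (energy_rate \<beta> * (sqrt (cav_dev_rate \<beta> h * rate (Suc N)) + 1 / real (Suc N)))) \<longlonglongrightarrow> 0"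
      using r' by simp
  qed (simp add: L2_nonneg)
qed

text \<open>The step from \<open>N\<close> to \<open>N + 1\<close> sites passes through \<open>N\<close> sites with the coupling constant of the larger
  system.\<close>

abbreviation old_ln_Z :: "nat \<Rightarrow> (nat \<times> nat \<Rightarrow> real) \<Rightarrow> real" where
  "old_ln_Z N g \<equiv> ln (Zsum (\<beta> / sqrt (2 * real (Suc N))) h {1..N} g)"

abbreviation ln_Z :: "nat \<Rightarrow> (nat \<times> nat \<Rightarrow> real) \<Rightarrow> real" where
  "ln_Z N g \<equiv> ln (Zsum (\<beta> / sqrt (2 * real N)) h {1..N} g)"

lemma renormalization_L2: "(\<lambda>N. L2 (\<lambda>g. ln_Z N g - old_ln_Z N g - energy_limit / 2)) \<longlonglongrightarrow> 0"
proof -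
  let ?a = "\<lambda>N::nat. (sqrt (real (Suc N) / real N) - 1) * real (Suc N)"
  let ?a' = "\<lambda>N::nat. (1 - sqrt (real N / real (Suc N))) * real N"
  let ?W = "\<lambda>N g. site_energy (real (Suc N)) \<beta> h {1..N} g" and ?W' = "\<lambda>N g. site_energy (real N) \<beta> h {1..N} g"
  let ?b = "\<lambda>a L N. \<bar>a N\<bar> * L N + \<bar>(a N - 1 / 2) * energy_limit\<bar>"
  have scaled: "L2 (\<lambda>g. a * W g - energy_limit / 2) \<le> \<bar>a\<bar> * L2 (\<lambda>g. W g - energy_limit) + \<bar>(a - 1 / 2) * energy_limit\<bar>"
    if W: "tame W" for a :: real and W :: "(nat \<times> nat \<Rightarrow> real) \<Rightarrow> real"
  proof -
    have "L2 (\<lambda>g. a * (W g - energy_limit) + (a - 1 / 2) * energy_limit)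
        \<le> L2 (\<lambda>g. a * (W g - energy_limit)) + L2 (\<lambda>_ :: nat \<times> nat \<Rightarrow> real. (a - 1 / 2) * energy_limit)"
      by (intro L2_triangle tame_mult tame_diff tame_const W)
    moreover have "(\<lambda>g. a * (W g - energy_limit) + (a - 1 / 2) * energy_limit) = (\<lambda>g. a * W g - energy_limit / 2)"
      by (simp add: fun_eq_iff algebra_simps)
    ultimately show ?thesis by (simp only: L2_cmult L2_const)
  qed
  have lim: "(\<lambda>N. ?b a L N) \<longlonglongrightarrow> 0" if "a \<longlonglongrightarrow> 1 / 2" "L \<longlonglongrightarrow> 0" for a L :: "nat \<Rightarrow> real"
  proof -
    have "(\<lambda>N. ?b a L N) \<longlonglongrightarrow> \<bar>1 / 2\<bar> * 0 + \<bar>(1 / 2 - 1 / 2) * energy_limit\<bar>"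
      by (intro tendsto_intros that)
    then show ?thesis by simp
  qed
  have path: "L2 (\<lambda>g. ln_Z N g - old_ln_Z N g - energy_limit / 2)
      \<le> ?b ?a (\<lambda>N. L2 (\<lambda>g. ?W N g - energy_limit)) N + ?b ?a' (\<lambda>N. L2 (\<lambda>g. ?W' N g - energy_limit)) N" if N: "N \<ge> 1" for N
  proof -
    have t: "tame (?W N)" "tame (?W' N)" by (intro tame_site_energy; simp)+
    have between: "\<bar>x - e\<bar> \<le> \<bar>l - e\<bar> + \<bar>u - e\<bar>" if "l \<le> x" "x \<le> u" for l x u e :: real
      using that by linarith
    have "L2 (\<lambda>g. ln_Z N g - old_ln_Z N g - energy_limit / 2)
        \<le> L2 (\<lambda>g. \<bar>?a N * ?W N g - energy_limit / 2\<bar> + \<bar>?a' N * ?W' N g - energy_limit / 2\<bar>)"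
    proof (rule L2_mono)
      show "tame (\<lambda>g. ln_Z N g - old_ln_Z N g - energy_limit / 2)"
        by (intro tame_diff tame_ln_Zsum tame_const) simp_all
      show "tame (\<lambda>g. \<bar>?a N * ?W N g - energy_limit / 2\<bar> + \<bar>?a' N * ?W' N g - energy_limit / 2\<bar>)"
        by (intro tame_add tame_abs tame_diff tame_mult[OF tame_const] tame_const t)
      show "\<bar>ln_Z N g - old_ln_Z N g - energy_limit / 2\<bar>
          \<le> \<bar>?a N * ?W N g - energy_limit / 2\<bar> + \<bar>?a' N * ?W' N g - energy_limit / 2\<bar>" for g
        by (rule between[OF renormalization_bracket[OF N]])
    qed
    also have "\<dots> \<le> L2 (\<lambda>g. \<bar>?a N * ?W N g - energy_limit / 2\<bar>) + L2 (\<lambda>g. \<bar>?a' N * ?W' N g - energy_limit / 2\<bar>)"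
      by (intro L2_triangle tame_abs tame_diff tame_mult[OF tame_const] tame_const t)
    also have "\<dots> = L2 (\<lambda>g. ?a N * ?W N g - energy_limit / 2) + L2 (\<lambda>g. ?a' N * ?W' N g - energy_limit / 2)"
      unfolding L2_def by (simp only: power2_abs)
    also have "\<dots> \<le> ?b ?a (\<lambda>N. L2 (\<lambda>g. ?W N g - energy_limit)) N + ?b ?a' (\<lambda>N. L2 (\<lambda>g. ?W' N g - energy_limit)) N"
      by (intro add_mono scaled t)
    finally show ?thesis .
  qed
  show ?thesis
  proof (rule tendsto_sandwich[OF _ _ tendsto_const])
    show "\<forall>\<^sub>F N in sequentially. L2 (\<lambda>g. ln_Z N g - old_ln_Z N g - energy_limit / 2)
      \<le> ?b ?a (\<lambda>N. L2 (\<lambda>g. ?W N g - energy_limit)) N + ?b ?a' (\<lambda>N. L2 (\<lambda>g. ?W' N g - energy_limit)) N"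
      using eventually_ge_at_top[of 1] by eventually_elim (rule path)
    show "(\<lambda>N. ?b ?a (\<lambda>N. L2 (\<lambda>g. ?W N g - energy_limit)) N + ?b ?a' (\<lambda>N. L2 (\<lambda>g. ?W' N g - energy_limit)) N) \<longlonglongrightarrow> 0"
      using tendsto_add[OF lim[OF renormalization_factors(1) site_energy_L2(2)] lim[OF renormalization_factors(2) site_energy_L2(1)]]
      by simp
  qed (simp add: L2_nonneg)
qed

text \<open>The limiting mean of the logarithm of the partition function gained with one site: half of the
  noise variance, plus \<open>ln (2 * cosh)\<close> of the effective field.\<close>

definition site_free_energy :: real where
  "site_free_energy = \<beta>\<^sup>2 * (1 - q) / 2 + (\<integral>t. ln (2 * cosh (h + sqrt (\<beta>\<^sup>2 * q) * t)) \<partial>std_normal_distribution)"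

definition spread_rate :: real where
  "spread_rate = \<beta>\<^sup>2 * (cav_dev_rate \<beta> h + 1)"

text \<open>The first bracket bounds the distance between the increment and \<open>ln (2 * cosh)\<close> of the mean cavity
  field; the second one bounds the conditional mean of the latter, with a free parameter \<open>r\<close> from the
  modulus of continuity.\<close>

definition step_error :: "real \<Rightarrow> nat \<Rightarrow> real" where
  "step_error r N = (\<bar>\<beta> / sqrt (2 * real (Suc N))\<bar> + 2 * sqrt (11 * exp (16 * \<beta>\<^sup>2) * (spread_rate * rate (Suc N))))
     + (r + 1 / (4 * r) * sqrt (3 * \<beta>\<^sup>2 * (spread_rate * rate (Suc N))))"

lemma step_error_tendsto: "step_error r \<longlonglongrightarrow> r"
proof -
  have "(\<lambda>N. sqrt (\<beta>\<^sup>2 / 2 * inverse (real (Suc N)))) \<longlonglongrightarrow> sqrt (\<beta>\<^sup>2 / 2 * 0)"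
    by (intro tendsto_real_sqrt tendsto_mult tendsto_const LIMSEQ_inverse_real_of_nat)
  moreover have "sqrt (\<beta>\<^sup>2 / 2 * inverse (real (Suc N))) = \<bar>\<beta> / sqrt (2 * real (Suc N))\<bar>" for N
    using coupling_power[of "real (Suc N)" \<beta>] by (metis divide_inverse inverse_mult_distrib mult.assoc of_nat_0_less_iff real_sqrt_abs zero_less_Suc)
  ultimately have c: "(\<lambda>N. \<bar>\<beta> / sqrt (2 * real (Suc N))\<bar>) \<longlonglongrightarrow> 0" by simp
  have "step_error r \<longlonglongrightarrow> (0 + 2 * sqrt (11 * exp (16 * \<beta>\<^sup>2) * (spread_rate * 0)))
     + (r + 1 / (4 * r) * sqrt (3 * \<beta>\<^sup>2 * (spread_rate * 0)))"
    unfolding step_error_def[abs_def]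
    by (intro tendsto_add tendsto_mult tendsto_const tendsto_real_sqrt c LIMSEQ_Suc[OF rate_tendsto])
  then show ?thesis by simp
qed

definition step_bound :: real where
  "step_bound = \<bar>\<beta>\<bar> + sqrt (1 + weight_bound \<beta> h) + \<bar>site_free_energy\<bar>"

text \<open>The increment of \<open>ln Z\<close> is not small, but by the first part it is nearly uncorrelated with everything
  that does not involve the bonds at the new site.\<close>

lemma add_site:
  fixes N :: nat
  assumes r: "r > 0"
    and \<Theta>: "tame \<Theta>" "\<And>x y. \<Theta> (override_on x y (cross_bonds {1..N} (Suc N))) = \<Theta> x"
  shows "\<bar>\<integral>g. \<Theta> g * (ln_Z (Suc N) g - old_ln_Z N g - site_free_energy) \<partial>gauss_array\<bar> \<le> L2 \<Theta> * step_error r N" (is ?first)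
    and "L2 (\<lambda>g. ln_Z (Suc N) g - old_ln_Z N g - site_free_energy) \<le> step_bound" (is ?second)
proof -
  let ?n = "real (Suc N)" and ?U = "{1..N}" and ?i = "Suc N"
  let ?c = "\<beta> / sqrt (2 * ?n)"
  let ?z = "cav_mean ?n \<beta> h ?U ?i" and ?p = "cav_error 1 ?n \<beta> h q ?U ?i" and ?m = "cav_error (-1) ?n \<beta> h q ?U ?i"
  let ?W = "cav_weight ?n \<beta> h ?U ?i" and ?sp = "cav_spread ?n \<beta> h q ?U"
  let ?d = "\<beta>\<^sup>2 * (1 - q) / 2"
  let ?F = "\<lambda>u. ln (2 * cosh (h + u))"
  let ?mF = "\<integral>t. ?F (sqrt (\<beta>\<^sup>2 * q) * t) \<partial>std_normal_distribution"
  let ?X = "\<lambda>g. ln_Z (Suc N) g - old_ln_Z N g - site_free_energy"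
  let ?X2 = "\<lambda>g. ?F (?z g) - ?mF"
  let ?X1 = "\<lambda>g. ?X g - ?X2 g"
  have U: "finite ?U" "?i \<notin> ?U" and n: "?n > 0" "real (card ?U) \<le> ?n" by simp_all
  have ins: "{1..Suc N} = insert ?i ?U" by auto
  have s: "sqrt (\<integral>g. overlap_dev ?n \<beta> h (insert ?i ?U) q g \<partial>gauss_array) + 1 / ?n = rate (Suc N)"
    unfolding rate_def ins ..
  have W2: "2 \<le> ?W g" for g by (rule cav_weight_ge[OF U(1)])
  have ratio: "ln_Z (Suc N) g - old_ln_Z N g = ?c * g (?i, ?i) + ln (?W g)" for g
    using Zsum_pos[OF U(1), of ?c h g] W2[of g]
    unfolding ins Zsum_insert[OF U] cav_weight_def[symmetric] by (simp add: ln_mult)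
  have tX: "tame ?X" by (intro tame_diff tame_ln_Zsum tame_const) simp_all
  have tz: "tame ?z" by (rule tame_cav_mean) simp
  have tp: "tame ?p" and tm: "tame ?m" by (intro tame_cav_error U)+
  have tW: "tame ?W" by (rule tame_cav_weight[OF U])
  have tsp: "tame ?sp" by (rule tame_cav_spread) simp
  have lip: "\<bar>?F x - ?F y\<bar> \<le> \<bar>x - y\<bar>" for x y
    using ln_cosh_lipschitz[of "h + x" "h + y"] by simp
  have cF: "continuous_on UNIV ?F" by (auto intro!: continuous_intros)
  have tF: "tame (\<lambda>g. ?F (?z g))"
  proof (rule tame_bounded_by)
    show "tame (\<lambda>g. \<bar>?F 0\<bar> + \<bar>?z g\<bar>)" by (intro tame_add tame_const tame_abs tz)
    show "(\<lambda>g. ?F (?z g)) \<in> borel_measurable gauss_array"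
      using measurable_compose[OF tame_measurable[OF tz] borel_measurable_continuous_onI[OF cF]] .
    show "\<bar>?F (?z g)\<bar> \<le> \<bar>\<bar>?F 0\<bar> + \<bar>?z g\<bar>\<bar>" for g using lip[of "?z g" 0] by linarith
  qed
  have tX2: "tame ?X2" by (intro tame_diff tF tame_const)
  have tX1: "tame ?X1" by (rule tame_diff[OF tX tX2])
  have spread: "(\<integral>g. ?sp g \<partial>gauss_array) \<le> spread_rate * rate (Suc N)"
    using cav_spread_mean_le[OF U, of ?n \<beta> h q] unfolding s spread_rate_def by simp
  have err: "L2 (cav_error s ?n \<beta> h q ?U ?i) \<le> sqrt (11 * exp (16 * \<beta>\<^sup>2) * (spread_rate * rate (Suc N)))" if "s * s = 1" for s
    unfolding L2_def
  proof (rule real_sqrt_le_mono)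
    have "(\<integral>g. (cav_error s ?n \<beta> h q ?U ?i g)\<^sup>2 \<partial>gauss_array) \<le> 11 * exp (16 * \<beta>\<^sup>2) * (\<integral>g. ?sp g \<partial>gauss_array)"
      by (rule cav_error_second_moment[OF U n q that])
    also have "\<dots> \<le> 11 * exp (16 * \<beta>\<^sup>2) * (spread_rate * rate (Suc N))"
      using spread by simp
    finally show "(\<integral>g. (cav_error s ?n \<beta> h q ?U ?i g)\<^sup>2 \<partial>gauss_array) \<le> 11 * exp (16 * \<beta>\<^sup>2) * (spread_rate * rate (Suc N))" .
  qed
  have X1: "L2 ?X1 \<le> \<bar>?c\<bar> + 2 * sqrt (11 * exp (16 * \<beta>\<^sup>2) * (spread_rate * rate (Suc N)))"
  proof -
    have path: "\<bar>?X1 g\<bar> \<le> \<bar>?c * g (?i, ?i)\<bar> + (\<bar>?p g\<bar> + \<bar>?m g\<bar>)" for g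
    proof -
      let ?e = "?d + (?p g + ?m g) / 2" and ?y = "?z g + (?p g - ?m g) / 2"
      have "ln (?W g) = ?e + ?F ?y"
        unfolding cav_weight_def gavg_cosh_sinh(1)[OF U(1), where q = q] by (simp add: ln_mult add.assoc)
      then have eq: "?X1 g = ?c * g (?i, ?i) + (?p g + ?m g) / 2 + (?F ?y - ?F (?z g))"
        unfolding ratio site_free_energy_def by simp
      have w: "\<bar>?F ?y - ?F (?z g)\<bar> \<le> \<bar>(?p g - ?m g) / 2\<bar>" using lip[of ?y "?z g"] by simp
      have tri: "\<bar>u + (x + y) / 2 + w\<bar> \<le> \<bar>u\<bar> + (\<bar>x\<bar> + \<bar>y\<bar>)" if "\<bar>w\<bar> \<le> \<bar>(x - y) / 2\<bar>" for u x y w :: real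
      proof -
        have "\<bar>x + y\<bar> + \<bar>x - y\<bar> \<le> 2 * \<bar>x\<bar> + 2 * \<bar>y\<bar>" by linarith
        then have "\<bar>(x + y) / 2\<bar> + \<bar>(x - y) / 2\<bar> \<le> \<bar>x\<bar> + \<bar>y\<bar>"
          unfolding abs_divide by simp
        moreover have "\<bar>u + v + w\<bar> \<le> \<bar>u\<bar> + (\<bar>v\<bar> + \<bar>w\<bar>)" for v by linarith
        ultimately show ?thesis using that by (meson add_left_mono order_trans)
      qed
      show ?thesis unfolding eq by (rule tri[OF w])
    qed
    have "L2 ?X1 \<le> L2 (\<lambda>g. \<bar>?c * g (?i, ?i)\<bar> + (\<bar>?p g\<bar> + \<bar>?m g\<bar>))"
      by (intro L2_mono path tX1 tame_add tame_abs tame_mult tame_const tame_coordinate tp tm)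
    also have "\<dots> \<le> L2 (\<lambda>g. \<bar>?c * g (?i, ?i)\<bar>) + L2 (\<lambda>g. \<bar>?p g\<bar> + \<bar>?m g\<bar>)"
      by (intro L2_triangle tame_add tame_abs tame_mult tame_const tame_coordinate tp tm)
    also have "\<dots> \<le> L2 (\<lambda>g. \<bar>?c * g (?i, ?i)\<bar>) + (L2 (\<lambda>g. \<bar>?p g\<bar>) + L2 (\<lambda>g. \<bar>?m g\<bar>))"
      by (intro add_left_mono L2_triangle tame_abs tp tm)
    also have "\<dots> = L2 (\<lambda>g. ?c * g (?i, ?i)) + (L2 ?p + L2 ?m)"
      unfolding L2_def by (simp only: power2_abs)
    also have "L2 (\<lambda>g. ?c * g (?i, ?i)) = \<bar>?c\<bar>" unfolding L2_cmult L2_coordinate by simp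
    also have "\<bar>?c\<bar> + (L2 ?p + L2 ?m) \<le> \<bar>?c\<bar> + 2 * sqrt (11 * exp (16 * \<beta>\<^sup>2) * (spread_rate * rate (Suc N)))"
      using err[of 1] err[of "-1"] by simp
    finally show ?thesis .
  qed
  have sp_bounds: "0 \<le> ?sp g" "?sp g \<le> 3 * \<beta>\<^sup>2" for g
  proof -
    let ?A = "gavg ?c h ?U g"
    have "0 \<le> ?A (\<lambda>\<sigma>. ?A (\<lambda>\<tau>. \<bar>olap ?n ?U \<sigma> \<tau> - q\<bar>))" by (intro gavg_ge U) simp
    moreover have "?A (\<lambda>\<sigma>. ?A (\<lambda>\<tau>. \<bar>olap ?n ?U \<sigma> \<tau> - q\<bar>)) \<le> 2"
    proof (intro gavg_le U)
      fix \<sigma> \<tau> assume "\<sigma> \<in> spins ?U" "\<tau> \<in> spins ?U"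
      then have "\<bar>olap ?n ?U \<sigma> \<tau>\<bar> \<le> 1" using n by (intro abs_olap_le U) auto
      then show "\<bar>olap ?n ?U \<sigma> \<tau> - q\<bar> \<le> 2" using q by linarith
    qed
    moreover have "0 \<le> 1 - real (card ?U) / ?n" "1 - real (card ?U) / ?n \<le> 1" by simp_all
    ultimately have "0 \<le> \<beta>\<^sup>2 * ?A (\<lambda>\<sigma>. ?A (\<lambda>\<tau>. \<bar>olap ?n ?U \<sigma> \<tau> - q\<bar>))"
      "\<beta>\<^sup>2 * ?A (\<lambda>\<sigma>. ?A (\<lambda>\<tau>. \<bar>olap ?n ?U \<sigma> \<tau> - q\<bar>)) \<le> \<beta>\<^sup>2 * 2"
      "0 \<le> \<beta>\<^sup>2 * (1 - real (card ?U) / ?n)" "\<beta>\<^sup>2 * (1 - real (card ?U) / ?n) \<le> \<beta>\<^sup>2 * 1"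
      by (intro mult_nonneg_nonneg mult_left_mono; simp)+
    then show "0 \<le> ?sp g" "?sp g \<le> 3 * \<beta>\<^sup>2" unfolding cav_spread_def by linarith+
  qed
  have L2sp: "L2 ?sp \<le> sqrt (3 * \<beta>\<^sup>2 * (spread_rate * rate (Suc N)))"
    unfolding L2_def
  proof (rule real_sqrt_le_mono)
    have "(\<integral>g. (?sp g)\<^sup>2 \<partial>gauss_array) \<le> (\<integral>g. 3 * \<beta>\<^sup>2 * ?sp g \<partial>gauss_array)"
      using sp_bounds unfolding power2_eq_square[of "?sp _"]
      by (intro expectation_mono tame_mult tame_const tsp mult_right_mono) auto
    also have "\<dots> \<le> 3 * \<beta>\<^sup>2 * (spread_rate * rate (Suc N))"
      using spread by (simp add: mult_left_mono)
    finally show "(\<integral>g. (?sp g)\<^sup>2 \<partial>gauss_array) \<le> 3 * \<beta>\<^sup>2 * (spread_rate * rate (Suc N))" .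
  qed
  have X2: "\<bar>\<integral>g. \<Theta> g * ?X2 g \<partial>gauss_array\<bar> \<le> L2 \<Theta> * (r + 1 / (4 * r) * sqrt (3 * \<beta>\<^sup>2 * (spread_rate * rate (Suc N))))"
  proof -
    let ?k = "1 / (4 * r)"
    have k: "0 \<le> ?k" using r by simp
    have "\<bar>\<integral>g. \<Theta> g * ?X2 g \<partial>gauss_array\<bar> \<le> (\<integral>g. \<bar>\<Theta> g\<bar> * (r + ?k * ?sp g) \<partial>gauss_array)"
      by (rule cav_mean_decouple[OF U n q cF quadratic_modulus_of_lipschitz[OF lip r] tF \<Theta>])
    also have "\<dots> \<le> L2 (\<lambda>g. \<bar>\<Theta> g\<bar>) * L2 (\<lambda>g. r + ?k * ?sp g)"
      by (intro order_trans[OF abs_ge_self L2_Cauchy_Schwarz] tame_abs \<Theta> tame_add tame_mult tame_const tsp)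
    also have "\<dots> = L2 \<Theta> * L2 (\<lambda>g. r + ?k * ?sp g)" unfolding L2_def by (simp only: power2_abs)
    also have "\<dots> \<le> L2 \<Theta> * (r + ?k * sqrt (3 * \<beta>\<^sup>2 * (spread_rate * rate (Suc N))))"
    proof (intro mult_left_mono L2_nonneg)
      have "L2 (\<lambda>g. r + ?k * ?sp g) \<le> L2 (\<lambda>_ :: nat \<times> nat \<Rightarrow> real. r) + L2 (\<lambda>g. ?k * ?sp g)"
        by (intro L2_triangle tame_const tame_mult tsp)
      also have "\<dots> = r + ?k * L2 ?sp" unfolding L2_const L2_cmult using r by simp
      also have "\<dots> \<le> r + ?k * sqrt (3 * \<beta>\<^sup>2 * (spread_rate * rate (Suc N)))"
        by (intro add_left_mono mult_left_mono L2sp k)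
      finally show "L2 (\<lambda>g. r + ?k * ?sp g) \<le> r + ?k * sqrt (3 * \<beta>\<^sup>2 * (spread_rate * rate (Suc N)))" .
    qed
    finally show ?thesis .
  qed
  have "(\<integral>g. \<Theta> g * ?X g \<partial>gauss_array) = (\<integral>g. \<Theta> g * ?X1 g + \<Theta> g * ?X2 g \<partial>gauss_array)"
    by (intro Bochner_Integration.integral_cong refl) (simp add: right_diff_distrib)
  also have "\<dots> = (\<integral>g. \<Theta> g * ?X1 g \<partial>gauss_array) + (\<integral>g. \<Theta> g * ?X2 g \<partial>gauss_array)"
    by (intro Bochner_Integration.integral_add tame_integrable tame_mult \<Theta> tX1 tX2)
  finally have "\<bar>\<integral>g. \<Theta> g * ?X g \<partial>gauss_array\<bar> \<le> \<bar>\<integral>g. \<Theta> g * ?X1 g \<partial>gauss_array\<bar> + \<bar>\<integral>g. \<Theta> g * ?X2 g \<partial>gauss_array\<bar>"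
    by (simp only: abs_triangle_ineq)
  also have "\<dots> \<le> L2 \<Theta> * (\<bar>?c\<bar> + 2 * sqrt (11 * exp (16 * \<beta>\<^sup>2) * (spread_rate * rate (Suc N))))
      + L2 \<Theta> * (r + 1 / (4 * r) * sqrt (3 * \<beta>\<^sup>2 * (spread_rate * rate (Suc N))))"
    by (intro add_mono X2 order_trans[OF L2_Cauchy_Schwarz[OF \<Theta>(1) tX1]] mult_left_mono X1 L2_nonneg)
  also have "\<dots> = L2 \<Theta> * step_error r N" unfolding step_error_def by (simp only: distrib_left)
  finally show ?first .
  have "L2 ?X \<le> L2 (\<lambda>g. \<bar>?c * g (?i, ?i)\<bar> + ?W g + \<bar>site_free_energy\<bar>)"
  proof (rule L2_mono[OF tX])
    show "tame (\<lambda>g. \<bar>?c * g (?i, ?i)\<bar> + ?W g + \<bar>site_free_energy\<bar>)"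
      by (intro tame_add tame_abs tame_mult tame_const tame_coordinate tW)
    fix g
    have "0 \<le> ln (?W g)" "ln (?W g) \<le> ?W g"
      using W2[of g] ln_le_minus_one[of "?W g"] by auto
    then show "\<bar>?X g\<bar> \<le> \<bar>?c * g (?i, ?i)\<bar> + ?W g + \<bar>site_free_energy\<bar>"
      unfolding ratio by linarith
  qed
  also have "\<dots> \<le> L2 (\<lambda>g. \<bar>?c * g (?i, ?i)\<bar> + ?W g) + L2 (\<lambda>_ :: nat \<times> nat \<Rightarrow> real. \<bar>site_free_energy\<bar>)"
    by (intro L2_triangle tame_add tame_abs tame_mult tame_const tame_coordinate tW)
  also have "\<dots> \<le> L2 (\<lambda>g. \<bar>?c * g (?i, ?i)\<bar>) + L2 ?W + L2 (\<lambda>_ :: nat \<times> nat \<Rightarrow> real. \<bar>site_free_energy\<bar>)"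
    by (intro add_right_mono L2_triangle tame_abs tame_mult tame_const tame_coordinate tW)
  also have "\<dots> = \<bar>?c\<bar> + L2 ?W + \<bar>site_free_energy\<bar>"
  proof -
    have "L2 (\<lambda>g. \<bar>?c * g (?i, ?i)\<bar>) = L2 (\<lambda>g. ?c * g (?i, ?i))" unfolding L2_def by (simp only: power2_abs)
    then show ?thesis by (simp only: L2_cmult L2_coordinate L2_const abs_idempotent mult_1_right)
  qed
  also have "\<dots> \<le> step_bound"
    unfolding step_bound_def
  proof (intro add_right_mono add_mono)
    have "1 \<le> sqrt (2 * ?n)" by simp
    then show "\<bar>?c\<bar> \<le> \<bar>\<beta>\<bar>" unfolding abs_divide
      using mult_left_mono[of 1 "sqrt (2 * ?n)" "\<bar>\<beta>\<bar>"] by (simp add: divide_le_eq)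
    have "(\<integral>g. (?W g)\<^sup>2 \<partial>gauss_array) \<le> (\<integral>g. 1 + (?W g) ^ 4 \<partial>gauss_array)"
    proof (intro expectation_mono tame_power tame_add tame_const tW)
      have "x\<^sup>2 \<le> 1 + x ^ 4" for x :: real
      proof -
        have "2 * x\<^sup>2 \<le> x ^ 4 + 1" using zero_le_power2[of "x\<^sup>2 - 1"] by (simp add: power2_diff)
        then show ?thesis using zero_le_power2[of x] by linarith
      qed
      then show "(?W g)\<^sup>2 \<le> 1 + (?W g) ^ 4" for g .
    qed
    also have "\<dots> = 1 + (\<integral>g. (?W g) ^ 4 \<partial>gauss_array)"
      using tame_integrable[OF tame_power[OF tW, of 4]] by simp
    also have "\<dots> \<le> 1 + weight_bound \<beta> h"
      by (intro add_left_mono cav_weight_fourth_moment U n)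
    finally show "L2 ?W \<le> sqrt (1 + weight_bound \<beta> h)" unfolding L2_def by (rule real_sqrt_le_mono)
  qed
  finally show ?second .
qed

text \<open>The renormalization of the coupling gives back half of the energy per site.\<close>

definition free_energy :: real where "free_energy = site_free_energy - energy_limit / 2"

text \<open>One recursion yields the limit of the free energy and its concentration together.\<close>

lemma ln_Z_L2: "(\<lambda>N. L2 (\<lambda>g. ln_Z N g - free_energy * real N) / real N) \<longlonglongrightarrow> 0"
proof (rule sublinear_of_square_recursion[where K = step_bound])
  let ?D = "\<lambda>N g. ln_Z N g - free_energy * real N"
  let ?Y = "\<lambda>N g. ln_Z N g - old_ln_Z N g - energy_limit / 2"
  fix r :: real assume r: "r > 0"
  have "\<forall>\<^sub>F N in sequentially. step_error (r / 4) N < r / 2"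
    using r by (intro order_tendstoD(2)[OF step_error_tendsto]) auto
  moreover have "\<forall>\<^sub>F N in sequentially. L2 (?Y N) < r / 2"
    using r by (intro order_tendstoD(2)[OF renormalization_L2]) auto
  ultimately show "\<forall>\<^sub>F N in sequentially. (L2 (?D (Suc N)))\<^sup>2 \<le> (L2 (?D N) + r)\<^sup>2 + step_bound\<^sup>2"
  proof eventually_elim
    case (elim N)
    \<comment> \<open>Up to the renormalization error this is \<open>?D N\<close>, but it ignores the bonds at the new site.\<close>
    let ?\<Theta> = "\<lambda>g. old_ln_Z N g - free_energy * real N + energy_limit / 2"
    let ?X = "\<lambda>g. ln_Z (Suc N) g - old_ln_Z N g - site_free_energy"
    have tD: "tame (?D N)" and tY: "tame (?Y N)" and t\<Theta>: "tame ?\<Theta>" and tX: "tame ?X"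
      by (intro tame_add tame_diff tame_ln_Zsum tame_const; simp)+
    have loc: "?\<Theta> (override_on x y (cross_bonds {1..N} (Suc N))) = ?\<Theta> x" for x y
    proof -
      have "pair_energy {1..N} (override_on x y (cross_bonds {1..N} (Suc N))) \<sigma> = pair_energy {1..N} x \<sigma>" for \<sigma>
        unfolding pair_energy_def by (intro sum.cong refl) (auto simp: override_on_def cross_bonds_def)
      then show ?thesis by (simp add: Zsum_def energy_def)
    qed
    have r4: "r / 4 > 0" using r by simp
    have \<Theta>: "L2 ?\<Theta> \<le> L2 (?D N) + r / 2"
    proof -
      have "?\<Theta> = (\<lambda>g. ?D N g - ?Y N g)" by auto
      then have "L2 ?\<Theta> \<le> L2 (?D N) + L2 (?Y N)" using L2_triangle_diff[OF tD tY] by simp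
      then show ?thesis using elim(2) by linarith
    qed
    have "(L2 (?D (Suc N)))\<^sup>2 = (\<integral>g. (?\<Theta> g + ?X g)\<^sup>2 \<partial>gauss_array)"
      unfolding L2_square
      by (intro Bochner_Integration.integral_cong refl arg_cong[where f = "\<lambda>x. x\<^sup>2"])
         (simp add: free_energy_def algebra_simps)
    also have "\<dots> = (L2 ?\<Theta>)\<^sup>2 + 2 * (\<integral>g. ?\<Theta> g * ?X g \<partial>gauss_array) + (L2 ?X)\<^sup>2"
      unfolding expectation_square_add[OF t\<Theta> tX] L2_square ..
    also have "\<dots> \<le> (L2 ?\<Theta>)\<^sup>2 + 2 * (L2 ?\<Theta> * (r / 2)) + step_bound\<^sup>2"
    proof (intro add_mono mult_left_mono order_refl power_mono add_site(2)[OF r4 t\<Theta> loc] L2_nonneg)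
      have "(\<integral>g. ?\<Theta> g * ?X g \<partial>gauss_array) \<le> L2 ?\<Theta> * step_error (r / 4) N"
        using add_site(1)[OF r4 t\<Theta> loc] by (rule order_trans[OF abs_ge_self])
      also have "\<dots> \<le> L2 ?\<Theta> * (r / 2)" using elim(1) by (intro mult_left_mono L2_nonneg) auto
      finally show "(\<integral>g. ?\<Theta> g * ?X g \<partial>gauss_array) \<le> L2 ?\<Theta> * (r / 2)" .
    qed simp
    also have "\<dots> \<le> (L2 ?\<Theta> + r / 2)\<^sup>2 + step_bound\<^sup>2"
      by (simp add: power2_sum mult_ac)
    also have "\<dots> \<le> (L2 (?D N) + r)\<^sup>2 + step_bound\<^sup>2"
      using \<Theta> r L2_nonneg[of ?\<Theta>] by (intro add_right_mono power_mono) auto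
    finally show ?case .
  qed
qed (rule L2_nonneg)

end

section \<open>The replica symmetric identity\<close>

lemma continuous_on_x_ln_x: "continuous_on {0..1} (\<lambda>t::real. t * ln t)"
proof (rule continuous_on_eq_continuous_within[THEN iffD2], intro ballI)
  fix x :: real assume x: "x \<in> {0..1}"
  show "continuous (at x within {0..1}) (\<lambda>t. t * ln t)"
  proof (cases "x = 0")
    case True
    have "((\<lambda>t. t * ln t) \<longlongrightarrow> 0) (at 0 within {0..1::real})"
    proof (rule Lim_null_comparison)
      show "\<forall>\<^sub>F t in at 0 within {0..1}. norm (t * ln t) \<le> 2 * sqrt t"
        unfolding eventually_at_filter
      proof (intro always_eventually allI impI)
        fix t :: real assume t: "t \<noteq> 0" "t \<in> {0..1}"
        have "- ln t = 2 * ln (inverse (sqrt t))" using t by (simp add: ln_inverse ln_sqrt)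
        also have "\<dots> \<le> 2 * inverse (sqrt t)"
          using ln_le_minus_one[of "inverse (sqrt t)"] t by simp
        finally have "t * (- ln t) \<le> t * (2 * inverse (sqrt t))" using t by (intro mult_left_mono) auto
        also have "\<dots> = 2 * sqrt t" using t by (simp add: field_simps)
        finally have "t * (- ln t) \<le> 2 * sqrt t" .
        moreover have "ln t \<le> 0" using t by simp
        ultimately show "norm (t * ln t) \<le> 2 * sqrt t"
          using t by (simp add: abs_mult abs_of_nonpos)
      qed
      have "((\<lambda>t. 2 * sqrt t) \<longlongrightarrow> 2 * sqrt 0) (at 0 within {0..1::real})" by (intro tendsto_intros)
      then show "((\<lambda>t. 2 * sqrt t) \<longlongrightarrow> 0) (at 0 within {0..1::real})" by simp
    qed
    then show ?thesis using True by (simp add: continuous_within)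
  next
    case False
    then show ?thesis using x by (intro continuous_intros) auto
  qed
qed

lemma continuous_on_coin_neg_entropy: "continuous_on {-1..1} coin_neg_entropy"
proof -
  have "continuous_on {-1..1} (\<lambda>x::real. (1 + x) / 2 * ln ((1 + x) / 2))"
    by (rule continuous_on_compose2[OF continuous_on_x_ln_x]) (auto intro!: continuous_intros)
  moreover have "continuous_on {-1..1} (\<lambda>x::real. (1 - x) / 2 * ln ((1 - x) / 2))"
    by (rule continuous_on_compose2[OF continuous_on_x_ln_x]) (auto intro!: continuous_intros)
  ultimately show ?thesis
    unfolding coin_neg_entropy_def[abs_def] by (rule continuous_on_add)
qed

lemma coin_neg_entropy_tanh: "coin_neg_entropy (tanh x) = x * tanh x - ln (2 * cosh x)"
proof -
  let ?c = "2 * cosh x" and ?L = "ln (2 * cosh x)"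
  have c: "?c > 0" by simp
  have p: "(1 + tanh x) / 2 = exp x / ?c" "(1 - tanh x) / 2 = exp (- x) / ?c"
    using c two_cosh[of x] two_sinh[of x] by (auto simp: tanh_def field_simps)
  have l: "ln (exp x / ?c) = x - ?L" "ln (exp (- x) / ?c) = - x - ?L"
    using ln_divide_pos[OF exp_gt_zero c] by (simp_all only: ln_exp)
  have "coin_neg_entropy (tanh x) = (exp x * (x - ?L) + exp (- x) * (- x - ?L)) / ?c"
    unfolding coin_neg_entropy_def p l by (simp only: add_divide_distrib times_divide_eq_left)
  also have "exp x * (x - ?L) + exp (- x) * (- x - ?L) = x * (exp x - exp (- x)) - ?L * (exp x + exp (- x))"
  proof -
    have "u * (x - L) + v * (- x - L) = x * (u - v) - L * (u + v)" for u v L :: real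
      by (simp add: algebra_simps)
    then show ?thesis .
  qed
  also have "\<dots> = x * (2 * sinh x) - ?L * ?c" by (simp only: two_cosh two_sinh)
  also have "\<dots> / ?c = x * tanh x - ?L" using c by (simp add: tanh_def diff_divide_distrib)
  finally show ?thesis .
qed

context overlap_concentration
begin

text \<open>The sum of the squared magnetizations is the mean overlap, which has the limit \<open>q\<close> by hypothesis and
  the replica symmetric limit by the cavity argument. So \<open>q\<close> solves the replica symmetric equation.\<close>

lemma rs_mean_square: "rs_mean (\<lambda>x. x\<^sup>2) \<beta> h q = q"
proof -
  let ?X = "\<lambda>N. mag_avg (\<lambda>x. x\<^sup>2) (real N) \<beta> h {1..N}" and ?r = "rs_mean (\<lambda>x. x\<^sup>2) \<beta> h q"
  have c: "continuous_on {-1..1} (\<lambda>x::real. x\<^sup>2)" by (intro continuous_intros)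
  have tX: "tame (?X N)" for N
    unfolding mag_avg_def by (intro tame_divide_const tame_sum tame_power tame_magnetization) simp
  have 1: "(\<lambda>N. L2 (\<lambda>g. ?X N g - ?r)) \<longlonglongrightarrow> 0"
    using tendsto_real_sqrt[OF mag_avg_tendsto[OF c q conv]] unfolding L2_def by simp
  have dev: "L2 (\<lambda>g. ?X N g - q) \<le> sqrt (\<integral>g. overlap_dev (real N) \<beta> h {1..N} q g \<partial>gauss_array)" for N
    unfolding L2_def
  proof (intro real_sqrt_le_mono expectation_mono tame_power tame_diff tX tame_const tame_overlap_dev)
    fix g
    let ?A = "gavg (\<beta> / sqrt (2 * real N)) h {1..N} g" and ?o = "olap (real N) {1..N}"
    have V: "finite {1..N}" by simp
    have "?X N g = ?A (\<lambda>\<sigma>. ?A (\<lambda>\<tau>. ?o \<sigma> \<tau>))"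
      unfolding mag_avg_def mag_def power2_eq_square gavg_def olap_def
      by (simp add: wavg_product wavg_divide wavg_sum)
    then have "?X N g - q = ?A (\<lambda>\<sigma>. ?A (\<lambda>\<tau>. ?o \<sigma> \<tau> - q))"
      by (simp add: gavg_linear(2) gavg_const)
    then have "(?X N g - q)\<^sup>2 \<le> ?A (\<lambda>\<sigma>. (?A (\<lambda>\<tau>. ?o \<sigma> \<tau> - q))\<^sup>2)"
      by (simp only: gavg_square_le[OF V])
    also have "\<dots> \<le> overlap_dev (real N) \<beta> h {1..N} q g"
      unfolding overlap_dev_def by (intro gavg_mono V gavg_square_le)
    finally show "(?X N g - q)\<^sup>2 \<le> overlap_dev (real N) \<beta> h {1..N} q g" .
  qed simp
  have "\<bar>q - ?r\<bar> \<le> L2 (\<lambda>g. ?X N g - ?r) + sqrt (\<integral>g. overlap_dev (real N) \<beta> h {1..N} q g \<partial>gauss_array)" for N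
  proof -
    have "\<bar>q - ?r\<bar> = L2 (\<lambda>g. (?X N g - ?r) - (?X N g - q))" by (simp add: L2_const)
    also have "\<dots> \<le> L2 (\<lambda>g. ?X N g - ?r) + L2 (\<lambda>g. ?X N g - q)"
      by (intro L2_triangle_diff tame_diff tX tame_const)
    finally show ?thesis using dev[of N] by linarith
  qed
  moreover have "(\<lambda>N. L2 (\<lambda>g. ?X N g - ?r) + sqrt (\<integral>g. overlap_dev (real N) \<beta> h {1..N} q g \<partial>gauss_array)) \<longlonglongrightarrow> 0"
    using tendsto_add[OF 1 tendsto_real_sqrt[OF conv]] by simp
  ultimately have "\<bar>q - ?r\<bar> \<le> 0"
    by (intro tendsto_lowerbound[where F = sequentially]) auto
  then show ?thesis by simp
qed

text \<open>By \<open>coin_neg_entropy_tanh\<close>, the integrals of \<open>ln (2 * cosh)\<close> in the entropy and in the free energy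
  cancel. What is left is the mean of the field times its \<open>tanh\<close>, which Stein's identity and the
  equation for \<open>q\<close> evaluate.\<close>

lemma limit_identity:
  "energy_limit + rs_mean (\<lambda>x. h * x - coin_neg_entropy x) \<beta> h q - free_energy = \<beta>\<^sup>2 / 4 * (1 - q)\<^sup>2"
proof -
  let ?k = "sqrt (\<beta>\<^sup>2 * q)" and ?N = "std_normal_distribution"
  let ?T = "\<lambda>t. tanh (h + ?k * t)" and ?L = "\<lambda>t. ln (2 * cosh (h + ?k * t))"
  have k: "?k * ?k = \<beta>\<^sup>2 * q" using q by simp
  have k0: "0 \<le> ?k" using q by simp
  have cT: "continuous_on UNIV ?T" and cL: "continuous_on UNIV ?L"
    by (auto intro!: continuous_intros)
  note [measurable] = borel_measurable_continuous_onI[OF cT] borel_measurable_continuous_onI[OF cL]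
  have T1: "\<bar>?T t\<bar> \<le> 1" for t using tanh_real_bounds[of "h + ?k * t"] by (simp add: abs_le_iff)
  have T2: "(?T t)\<^sup>2 \<le> 1" for t using T1[of t] by (simp add: abs_square_le_1)
  have iT2: "integrable ?N (\<lambda>t. (?T t)\<^sup>2)"
    by (rule std_normal.integrable_const_bound[where B = 1]) (use T2 in auto)
  have it: "integrable ?N (\<lambda>t. \<bar>t\<bar>)"
    using integrable_std_normal_distribution_moment[of 1] by simp
  have itT: "integrable ?N (\<lambda>t. t * ?T t)"
    by (rule Bochner_Integration.integrable_bound[OF it])
       (use T1 in \<open>auto simp: abs_mult mult_left_le\<close>)
  have iL: "integrable ?N ?L"
  proof (rule Bochner_Integration.integrable_bound)
    show "integrable ?N (\<lambda>t. \<bar>?L 0\<bar> + ?k * \<bar>t\<bar>)" using it by simp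
    have "\<bar>?L t\<bar> \<le> \<bar>?L 0\<bar> + ?k * \<bar>t\<bar>" for t
    proof -
      have "\<bar>?L t - ?L 0\<bar> \<le> \<bar>(h + ?k * t) - (h + ?k * 0)\<bar>" by (rule ln_cosh_lipschitz)
      also have "\<dots> = ?k * \<bar>t\<bar>" using k0 by (simp add: abs_mult)
      finally show ?thesis by linarith
    qed
    then show "AE t in ?N. norm (?L t) \<le> norm (\<bar>?L 0\<bar> + ?k * \<bar>t\<bar>)"
      by (intro AE_I2) (auto intro: order_trans[OF _ abs_ge_self])
  qed simp
  have stein: "(\<integral>t. t * ?T t \<partial>?N) = (\<integral>t. ?k * (1 - (?T t)\<^sup>2) \<partial>?N)"
  proof (rule std_normal_integration_by_parts[where C = "1 + ?k" and c = 0])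
    show "(?T has_real_derivative ?k * (1 - (?T t)\<^sup>2)) (at t)" for t
      by (auto intro!: derivative_eq_intros)
    show "isCont (\<lambda>t. ?k * (1 - (?T t)\<^sup>2)) t" for t
      by (auto intro!: continuous_intros)
    have "\<bar>?T t\<bar> \<le> 1 + ?k" for t using T1[of t] k0 by linarith
    then show "\<bar>?T t\<bar> \<le> (1 + ?k) * exp (0 * \<bar>t\<bar>)" for t by simp
    have "\<bar>?k * (1 - (?T t)\<^sup>2)\<bar> \<le> ?k" for t
    proof -
      have "\<bar>1 - (?T t)\<^sup>2\<bar> \<le> 1" using T2[of t] zero_le_power2[of "?T t"] by linarith
      then show ?thesis unfolding abs_mult using k0 by (simp add: mult_left_le)
    qed
    then show "\<bar>?k * (1 - (?T t)\<^sup>2)\<bar> \<le> (1 + ?k) * exp (0 * \<bar>t\<bar>)" for t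
      by (rule order_trans) simp
  qed
  have q2: "(\<integral>t. (?T t)\<^sup>2 \<partial>?N) = q" using rs_mean_square unfolding rs_mean_def .
  have "rs_mean (\<lambda>x. h * x - coin_neg_entropy x) \<beta> h q = (\<integral>t. ?L t - ?k * (t * ?T t) \<partial>?N)"
    unfolding rs_mean_def coin_neg_entropy_tanh
    by (intro Bochner_Integration.integral_cong refl) (simp add: algebra_simps)
  also have "\<dots> = (\<integral>t. ?L t \<partial>?N) - ?k * (\<integral>t. t * ?T t \<partial>?N)"
    using iL itT by simp
  also have "(\<integral>t. t * ?T t \<partial>?N) = ?k * (1 - q)"
    unfolding stein using iT2 q2 std_normal.prob_space by simp
  also have "?k * (?k * (1 - q)) = \<beta>\<^sup>2 * q * (1 - q)" by (simp only: mult.assoc[symmetric] k)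
  finally have rs: "rs_mean (\<lambda>x. h * x - coin_neg_entropy x) \<beta> h q = (\<integral>t. ?L t \<partial>?N) - \<beta>\<^sup>2 * q * (1 - q)" .
  show ?thesis
    unfolding rs free_energy_def site_free_energy_def energy_limit_def
    by (simp add: field_simps power2_eq_square)
qed

end

section \<open>From the product measure to the given disorder\<close>

text \<open>A function of finitely many entries of the given disorder has the same mean as under the product
  measure: both laws have the same finite-dimensional marginals.\<close>

lemma expectation_eq_gauss_array:
  fixes F :: "('k \<Rightarrow> real) \<Rightarrow> real" and g :: "'k \<Rightarrow> 'w \<Rightarrow> real"
  assumes M: "prob_space M" and indep: "prob_space.indep_vars M (\<lambda>_. borel) g K"
    and normal: "\<And>k. k \<in> K \<Longrightarrow> distributed M lborel (g k) std_normal_density"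
    and I: "finite I" "I \<noteq> {}" "I \<subseteq> K"
    and F: "F \<in> borel_measurable gauss_array" and loc: "\<And>x. F (restrict x I) = F x"
  shows "prob_space.expectation M (\<lambda>\<omega>. F (\<lambda>k. g k \<omega>)) = (\<integral>x. F x \<partial>gauss_array)"
proof -
  interpret M: prob_space M by fact
  let ?P = "PiM I (\<lambda>_. std_normal_distribution)"
  have ind: "M.indep_vars (\<lambda>_. borel) g I" using indep I(3) by (rule M.indep_vars_subset)
  have rv: "M.random_variable borel (g k)" if "k \<in> I" for k
    using ind that unfolding M.indep_vars_def by auto
  have "distr M borel (g k) = std_normal_distribution" if "k \<in> I" for k
  proof -
    have "distr M lborel (g k) = std_normal_distribution"
      using distributed_distr_eq_density[OF normal] I(3) that by auto
    moreover have "distr M lborel (g k) = distr M borel (g k)" by (rule distr_cong) auto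
    ultimately show ?thesis by simp
  qed
  then have "distr M (PiM I (\<lambda>_. borel)) (\<lambda>\<omega>. \<lambda>k\<in>I. g k \<omega>) = ?P"
    using M.indep_vars_iff_distr_eq_PiM'[OF I(2) rv, THEN iffD1, OF _ ind] by (simp cong: PiM_cong)
  moreover have sets: "sets (PiM I (\<lambda>_. borel :: real measure)) = sets ?P" by (intro sets_PiM_cong) auto
  ultimately have D1: "distr M ?P (\<lambda>\<omega>. \<lambda>k\<in>I. g k \<omega>) = ?P"
    by (metis distr_cong)
  have m1: "(\<lambda>\<omega>. \<lambda>k\<in>I. g k \<omega>) \<in> measurable M ?P"
    by (rule measurable_restrict) (use rv in simp)
  have D2: "distr gauss_array ?P (\<lambda>x. restrict x I) = ?P"
    by (rule gaussP.distr_PiM_restrict_finite) (use I in auto)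
  have m2: "(\<lambda>x. restrict x I) \<in> measurable gauss_array ?P"
    by (rule measurable_restrict_subset) simp
  have "(\<lambda>x. x) \<in> measurable ?P gauss_array"
  proof (rule measurable_into_gauss_array)
    fix k
    show "(\<lambda>x. x k) \<in> borel_measurable ?P"
    proof (cases "k \<in> I")
      case True
      then show ?thesis using measurable_component_singleton[of k I "\<lambda>_. std_normal_distribution"] by simp
    next
      case False
      have "(\<lambda>x. undefined) \<in> borel_measurable ?P" by simp
      moreover have "x k = undefined" if "x \<in> space ?P" for x
        using that False by (auto simp: space_PiM PiE_def extensional_def)
      ultimately show ?thesis by (metis (mono_tags, lifting) measurable_cong)
    qed
  qed
  then have mF: "F \<in> borel_measurable ?P" using measurable_compose[OF _ F] by blast
  have "M.expectation (\<lambda>\<omega>. F (\<lambda>k. g k \<omega>)) = M.expectation (\<lambda>\<omega>. F (\<lambda>k\<in>I. g k \<omega>))"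
    using loc[of "\<lambda>k. g k _"] by simp
  also have "\<dots> = (\<integral>x. F x \<partial>?P)" by (subst D1[symmetric]) (simp add: integral_distr[OF m1 mF])
  also have "\<dots> = (\<integral>x. F (restrict x I) \<partial>gauss_array)"
    by (subst D2[symmetric]) (simp add: integral_distr[OF m2 mF])
  finally show ?thesis unfolding loc .
qed

lemma hamiltonian_eq_energy: "hamiltonian \<beta> h N g \<sigma> = energy (\<beta> / sqrt (2 * real N)) h {1..N} g \<sigma>"
  unfolding hamiltonian_def energy_def pair_energy_def
  by (simp add: sum.cartesian_product split_beta mult.assoc)

lemma gibbs_eq: "gibbs \<beta> h N g \<sigma>
    = exp (energy (\<beta> / sqrt (2 * real N)) h {1..N} g \<sigma>) / Zsum (\<beta> / sqrt (2 * real N)) h {1..N} g"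
  unfolding gibbs_def hamiltonian_eq_energy Zsum_def spins_def configs_def ..

lemma gibbs_avg_eq: "gibbs_avg \<beta> h N g f = gavg (\<beta> / sqrt (2 * real N)) h {1..N} g f"
  unfolding gibbs_avg_def gibbs_eq gavg_def wavg_def Zsum_def spins_def configs_def
  by (simp add: sum_divide_distrib)

lemma gibbs_avg2_eq: "gibbs_avg2 \<beta> h N g f
    = gavg (\<beta> / sqrt (2 * real N)) h {1..N} g (\<lambda>\<sigma>. gavg (\<beta> / sqrt (2 * real N)) h {1..N} g (f \<sigma>))"
proof -
  have "gibbs_avg2 \<beta> h N g f = gibbs_avg \<beta> h N g (\<lambda>\<sigma>. gibbs_avg \<beta> h N g (f \<sigma>))"
    unfolding gibbs_avg2_def gibbs_avg_def
    by (simp add: sum.cartesian_product[symmetric] sum_distrib_left mult.assoc)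
  then show ?thesis by (simp add: gibbs_avg_eq)
qed

lemma overlap_eq: "overlap N \<sigma> \<tau> = olap (real N) {1..N} \<sigma> \<tau>"
  unfolding overlap_def olap_def by simp

text \<open>Since \<open>ln (gibbs \<sigma>)\<close> is the energy minus \<open>ln Z\<close>, the quantity in the theorem splits into an energy, a
  function of the magnetizations and a free energy, each of which has a deterministic limit.\<close>

lemma neg_entropy_defect_eq:
  assumes N: "N \<ge> 1"
  shows "1 / real N * gibbs_avg \<beta> h N g (\<lambda>\<sigma>. ln (gibbs \<beta> h N g \<sigma>)) - mean_coin_neg_entropy N (magnetization \<beta> h N g)
    = site_energy (real N) \<beta> h {1..N} g + mag_avg (\<lambda>x. h * x - coin_neg_entropy x) (real N) \<beta> h {1..N} g
       - ln (Zsum (\<beta> / sqrt (2 * real N)) h {1..N} g) / real N"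
proof -
  let ?c = "\<beta> / sqrt (2 * real N)"
  let ?A = "gavg ?c h {1..N} g" and ?Z = "Zsum ?c h {1..N} g"
  have V: "finite {1..N}" by simp
  have Z: "?Z > 0" by (rule Zsum_pos) simp
  have "gibbs_avg \<beta> h N g (\<lambda>\<sigma>. ln (gibbs \<beta> h N g \<sigma>))
      = ?A (\<lambda>\<sigma>. ?c * pair_energy {1..N} g \<sigma> + h * (\<Sum>i\<in>{1..N}. \<sigma> i) - ln ?Z)"
    unfolding gibbs_avg_eq gibbs_eq using Z by (simp add: ln_div energy_def)
  also have "\<dots> = ?A (\<lambda>\<sigma>. ?c * pair_energy {1..N} g \<sigma>) + h * (\<Sum>i\<in>{1..N}. mag (real N) \<beta> h {1..N} g i) - ln ?Z"
    by (simp only: gavg_linear(1-3) gavg_sum gavg_const[OF V] mag_def)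
  finally have 1: "1 / real N * gibbs_avg \<beta> h N g (\<lambda>\<sigma>. ln (gibbs \<beta> h N g \<sigma>))
      = site_energy (real N) \<beta> h {1..N} g + h * (\<Sum>i\<in>{1..N}. mag (real N) \<beta> h {1..N} g i) / real N - ln ?Z / real N"
    unfolding site_energy_def gavg_linear(5) by (simp add: add_divide_distrib diff_divide_distrib)
  have 2: "mean_coin_neg_entropy N (magnetization \<beta> h N g)
      = (\<Sum>i\<in>{1..N}. coin_neg_entropy (mag (real N) \<beta> h {1..N} g i)) / real N"
    unfolding mean_coin_neg_entropy_def magnetization_def gibbs_avg_eq mag_def by simp
  show ?thesis
    unfolding 1 2 mag_avg_def by (simp add: sum_subtractf sum_distrib_left diff_divide_distrib)
qed

lemma pair_energy_restrict: "pair_energy V (restrict x (V \<times> V)) \<sigma> = pair_energy V x \<sigma>"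
  unfolding pair_energy_def by (intro sum.cong refl) simp

lemma restrict_invariant:
  shows gavg_restrict: "gavg c h V (restrict x (V \<times> V)) f = gavg c h V x f"
    and Zsum_restrict: "Zsum c h V (restrict x (V \<times> V)) = Zsum c h V x"
    and site_energy_restrict: "site_energy n \<beta> h V (restrict x (V \<times> V)) = site_energy n \<beta> h V x"
  by (simp_all add: site_energy_def gavg_def Zsum_def energy_def pair_energy_restrict)

theorem theorem3:
  fixes M :: "'w measure" and g :: "nat \<times> nat \<Rightarrow> 'w \<Rightarrow> real" and \<beta> h q :: real
  assumes "prob_space M"
    and "prob_space.indep_vars M (\<lambda>_. borel) g ({1..} \<times> {1..})"
    and "\<And>i j. i \<ge> 1 \<Longrightarrow> j \<ge> 1 \<Longrightarrow> distributed M lborel (g (i, j)) std_normal_density"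
    and "q \<in> {0..1}"
    and "(\<lambda>N. prob_space.expectation M (\<lambda>\<omega>.
            gibbs_avg2 \<beta> h N (\<lambda>p. g p \<omega>) (\<lambda>\<sigma> \<tau>. (overlap N \<sigma> \<tau> - q)\<^sup>2)))
          \<longlonglongrightarrow> 0"
  shows "(\<lambda>N. prob_space.expectation M (\<lambda>\<omega>.
            (1 / real N * gibbs_avg \<beta> h N (\<lambda>p. g p \<omega>) (\<lambda>\<sigma>. ln (gibbs \<beta> h N (\<lambda>p. g p \<omega>) \<sigma>))
             - mean_coin_neg_entropy N (magnetization \<beta> h N (\<lambda>p. g p \<omega>))
             - onsager (xi \<beta>) q)\<^sup>2))
          \<longlonglongrightarrow> 0"
proof -
  let ?V = "\<lambda>N::nat. {1..N}"
  have normal: "\<And>k. k \<in> {1..} \<times> {1..} \<Longrightarrow> distributed M lborel (g k) std_normal_density"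
    using assms(3) by auto
  have transfer: "prob_space.expectation M (\<lambda>\<omega>. F (\<lambda>p. g p \<omega>)) = (\<integral>x. F x \<partial>gauss_array)"
    if "N \<ge> 1" "tame F" "\<And>x. F (restrict x (?V N \<times> ?V N)) = F x" for N F
    by (rule expectation_eq_gauss_array[OF assms(1,2) normal, of "?V N \<times> ?V N"])
       (use that in \<open>auto simp: tame_measurable\<close>)
  have "(\<lambda>N. \<integral>x. overlap_dev (real N) \<beta> h (?V N) q x \<partial>gauss_array) \<longlonglongrightarrow> 0"
  proof (rule Lim_transform_eventually[OF assms(5)])
    show "\<forall>\<^sub>F N in sequentially. prob_space.expectation M (\<lambda>\<omega>.
            gibbs_avg2 \<beta> h N (\<lambda>p. g p \<omega>) (\<lambda>\<sigma> \<tau>. (overlap N \<sigma> \<tau> - q)\<^sup>2))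
        = (\<integral>x. overlap_dev (real N) \<beta> h (?V N) q x \<partial>gauss_array)"
      using eventually_ge_at_top[of 1]
    proof eventually_elim
      case (elim N)
      show ?case
        unfolding gibbs_avg2_eq overlap_eq overlap_dev_def[symmetric]
        by (rule transfer[OF elim tame_overlap_dev]) (simp, simp only: overlap_dev_def gavg_restrict)
    qed
  qed
  then interpret overlap_concentration \<beta> h q
    using assms(4) by unfold_locales auto
  let ?\<phi> = "\<lambda>x. h * x - coin_neg_entropy x"
  let ?E = "\<lambda>N g. site_energy (real N) \<beta> h (?V N) g - energy_limit"
  let ?S = "\<lambda>N g. mag_avg ?\<phi> (real N) \<beta> h (?V N) g - rs_mean ?\<phi> \<beta> h q"
  let ?F = "\<lambda>N g. ln_Z N g - free_energy * real N"
  let ?X = "\<lambda>N g. ?E N g + ?S N g - 1 / real N * ?F N g"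
  have \<phi>: "continuous_on {-1..1} ?\<phi>"
    by (intro continuous_intros continuous_on_coin_neg_entropy)
  have tE: "tame (?E N)" and tF: "tame (\<lambda>g. 1 / real N * ?F N g)" for N
    by (intro tame_diff tame_site_energy tame_const tame_mult tame_ln_Zsum; simp)+
  have tS: "tame (?S N)" for N
    unfolding mag_avg_def
    by (intro tame_diff tame_const tame_divide_const tame_sum tame_bounded_continuous[OF \<phi>] tame_magnetization mag_bounds) auto
  have tX: "tame (?X N)" for N by (intro tame_diff[OF tame_add] tE tS tF)
  have sum_lim: "(\<lambda>N. L2 (?E N) + L2 (?S N) + L2 (?F N) / real N) \<longlonglongrightarrow> 0 + 0 + 0"
  proof (intro tendsto_add site_energy_L2(1) ln_Z_L2)
    show "(\<lambda>N. L2 (?S N)) \<longlonglongrightarrow> 0"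
      using tendsto_real_sqrt[OF mag_avg_tendsto[OF \<phi> q conv]] unfolding L2_def by simp
  qed
  have sum_le: "L2 (?X N) \<le> L2 (?E N) + L2 (?S N) + L2 (?F N) / real N" for N
  proof -
    have "L2 (?X N) \<le> L2 (\<lambda>g. ?E N g + ?S N g) + L2 (\<lambda>g. 1 / real N * ?F N g)"
      by (intro L2_triangle_diff tame_add tE tS tF)
    also have "\<dots> \<le> (L2 (?E N) + L2 (?S N)) + L2 (\<lambda>g. 1 / real N * ?F N g)"
      by (intro add_right_mono L2_triangle tE tS)
    also have "L2 (\<lambda>g. 1 / real N * ?F N g) = L2 (?F N) / real N" unfolding L2_cmult by simp
    finally show ?thesis .
  qed
  have "(\<lambda>N. L2 (?X N)) \<longlonglongrightarrow> 0"
  proof (rule tendsto_sandwich[OF _ _ tendsto_const])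
    show "\<forall>\<^sub>F N in sequentially. L2 (?X N) \<le> L2 (?E N) + L2 (?S N) + L2 (?F N) / real N"
      by (intro always_eventually allI sum_le)
    show "\<forall>\<^sub>F N in sequentially. 0 \<le> L2 (?X N)"
      by (intro always_eventually allI L2_nonneg)
    show "(\<lambda>N. L2 (?E N) + L2 (?S N) + L2 (?F N) / real N) \<longlonglongrightarrow> 0"
      using sum_lim by (simp only: add_0)
  qed
  from tendsto_power[OF this, of 2] have lim: "(\<lambda>N. \<integral>x. (?X N x)\<^sup>2 \<partial>gauss_array) \<longlonglongrightarrow> 0"
    by (simp only: L2_square zero_power2)
  show ?thesis
  proof (rule Lim_transform_eventually[OF lim])
    show "\<forall>\<^sub>F N in sequentially. (\<integral>x. (?X N x)\<^sup>2 \<partial>gauss_array)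
        = prob_space.expectation M (\<lambda>\<omega>.
            (1 / real N * gibbs_avg \<beta> h N (\<lambda>p. g p \<omega>) (\<lambda>\<sigma>. ln (gibbs \<beta> h N (\<lambda>p. g p \<omega>) \<sigma>))
             - mean_coin_neg_entropy N (magnetization \<beta> h N (\<lambda>p. g p \<omega>))
             - onsager (xi \<beta>) q)\<^sup>2)"
      using eventually_ge_at_top[of 1]
    proof eventually_elim
      case (elim N)
      have "1 / real N * gibbs_avg \<beta> h N x (\<lambda>\<sigma>. ln (gibbs \<beta> h N x \<sigma>))
             - mean_coin_neg_entropy N (magnetization \<beta> h N x) - onsager (xi \<beta>) q = ?X N x" for x
        unfolding neg_entropy_defect_eq[OF elim] onsager_xi limit_identity[symmetric]
        using elim by (simp add: right_diff_distrib)
      then have "prob_space.expectation M (\<lambda>\<omega>.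
            (1 / real N * gibbs_avg \<beta> h N (\<lambda>p. g p \<omega>) (\<lambda>\<sigma>. ln (gibbs \<beta> h N (\<lambda>p. g p \<omega>) \<sigma>))
             - mean_coin_neg_entropy N (magnetization \<beta> h N (\<lambda>p. g p \<omega>))
             - onsager (xi \<beta>) q)\<^sup>2)
          = prob_space.expectation M (\<lambda>\<omega>. (?X N (\<lambda>p. g p \<omega>))\<^sup>2)"
        by (simp only:)
      also have "\<dots> = (\<integral>x. (?X N x)\<^sup>2 \<partial>gauss_array)"
        by (rule transfer[OF elim tame_power[OF tX]])
           (simp only: site_energy_restrict Zsum_restrict mag_avg_def mag_def gavg_restrict)
      finally show ?case by (rule sym)
    qed
  qed
qed

end
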